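(* Let $\mathcal{A}$ be an abelian category with enough projectives and enough injectives, and let $\mathcal{X}$ be a functorially finite subcategory of $\mathcal{A}$ which contains all projective objects and all injective objects of $\mathcal{A}$ and is closed under kernels of epimorphisms and cokernels of monomorphisms. (i) Suppose $\underline{\mathcal{X}}$ has split idempotents. Then: (1) for every $A\in\mathcal{X}$, if $F$ is a direct summand of $\mathrm{Ext}^1_{\mathcal{A}}(A,-)|_{\mathcal{X}}$, then there exists $B\in\mathcal{X}$ such that $F\simeq\mathrm{Ext}^1_{\mathcal{A}}(B,-)|_{\mathcal{X}}$; (2) in particular, if $\mathcal{X}=\mathcal{A}$ is a Krull–Schmidt category, then for every $A\in\mathcal{A}$ every direct summand of the functor $\mathrm{Ext}^1_{\mathcal{A}}(A,-)$ is isomorphic to $\mathrm{Ext}^1_{\mathcal{A}}(B,-)$ for some $B\in\mathcal{A}$. (ii) Suppose $\overline{\mathcal{X}}$ has split idempotents. Then: (1) for every $A\in\mathcal{X}$, if $F$ is a direct summand of $\mathrm{Ext}^1_{\mathcal{A}}(-,A)|_{\mathcal{X}}$, then there exists $B\in\mathcal{X}$ such that $F\simeq\mathrm{Ext}^1_{\mathcal{A}}(-,B)|_{\mathcal{X}}$; (2) in particular, if $\mathcal{X}=\mathcal{A}$ is a Krull–Schmidt category, then for every $A\in\mathcal{A}$ every direct summand of the functor $\mathrm{Ext}^1_{\mathcal{A}}(-,A)$ is isomorphic to $\mathrm{Ext}^1_{\mathcal{A}}(-,B)$ for some $B\in\mathcal{A}$.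
   Context: All subcategories are full, closed under isomorphisms and finite direct sums. Functorially finite means that every object $A\in\mathcal{A}$ admits a right $\mathcal{X}$-approximation (a morphism $X\to A$, $X\in\mathcal{X}$, through which every morphism from an object of $\mathcal{X}$ to $A$ factors) and, dually, a left $\mathcal{X}$-approximation. $\underline{\mathcal{X}}$ (resp. $\overline{\mathcal{X}}$) has the same objects as $\mathcal{X}$, with morphisms modulo those factoring through projective (resp. injective) objects of $\mathcal{A}$. $\mathrm{Ext}^1_{\mathcal{A}}(A,-)|_{\mathcal{X}}$ and $\mathrm{Ext}^1_{\mathcal{A}}(-,A)|_{\mathcal{X}}$ are the restrictions to $\mathcal{X}$ of the usual Ext functors with values in abelian groups; direct summands are taken in the category of additive functors (covariant, resp. contravariant) from $\mathcal{X}$ to abelian groups. *)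

theory Defs
  imports "HOL-Algebra.Ring"
begin

section \<open>Abelian categories\<close>

text \<open>A category enriched with an addition on its hom-sets. Composition and addition are total
  functions on the type of arrows; they are meaningful only for composable, respectively
  parallel, arrows.\<close>

record ('o, 'm) cat =
  Obj :: "'o set"
  Arr :: "'m set"
  Src :: "'m \<Rightarrow> 'o"
  Tgt :: "'m \<Rightarrow> 'o"
  Ident :: "'o \<Rightarrow> 'm"
  Comp :: "'m \<Rightarrow> 'm \<Rightarrow> 'm"  (infixr "\<^bold>\<circ>\<index>" 70)
  Plus :: "'m \<Rightarrow> 'm \<Rightarrow> 'm"  (infixl "\<^bold>+\<index>" 65)
  Zero :: "'o \<Rightarrow> 'o \<Rightarrow> 'm"

definition Hom :: "('o, 'm) cat \<Rightarrow> 'o \<Rightarrow> 'o \<Rightarrow> 'm set" where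
  "Hom C A B = {f \<in> Arr C. Src C f = A \<and> Tgt C f = B}"

definition hom_group :: "('o, 'm) cat \<Rightarrow> 'o \<Rightarrow> 'o \<Rightarrow> 'm monoid" where
  "hom_group C A B = \<lparr>carrier = Hom C A B, monoid.mult = Plus C, one = Zero C A B\<rparr>"

definition end_ring :: "('o, 'm) cat \<Rightarrow> 'o \<Rightarrow> 'm ring" where
  "end_ring C A = \<lparr>carrier = Hom C A A, monoid.mult = Comp C, one = Ident C A,
                   zero = Zero C A A, add = Plus C\<rparr>"

definition op_cat :: "('o, 'm) cat \<Rightarrow> ('o, 'm) cat" where
  "op_cat C = \<lparr>Obj = Obj C, Arr = Arr C, Src = Tgt C, Tgt = Src C, Ident = Ident C,
               Comp = (\<lambda>g f. f \<^bold>\<circ>\<^bsub>C\<^esub> g), Plus = Plus C, Zero = (\<lambda>A B. Zero C B A)\<rparr>"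

locale category =
  fixes C :: "('o, 'm) cat" (structure)
  assumes src_obj: "f \<in> Arr C \<Longrightarrow> Src C f \<in> Obj C"
    and tgt_obj: "f \<in> Arr C \<Longrightarrow> Tgt C f \<in> Obj C"
    and ident_hom: "A \<in> Obj C \<Longrightarrow> Ident C A \<in> Hom C A A"
    and comp_hom: "f \<in> Hom C A B \<Longrightarrow> g \<in> Hom C B D \<Longrightarrow> g \<^bold>\<circ> f \<in> Hom C A D"
    and comp_ident_right: "f \<in> Hom C A B \<Longrightarrow> f \<^bold>\<circ> Ident C A = f"
    and comp_ident_left: "f \<in> Hom C A B \<Longrightarrow> Ident C B \<^bold>\<circ> f = f"
    and comp_assoc: "f \<in> Hom C A B \<Longrightarrow> g \<in> Hom C B D \<Longrightarrow> h \<in> Hom C D E \<Longrightarrow>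
                       (h \<^bold>\<circ> g) \<^bold>\<circ> f = h \<^bold>\<circ> (g \<^bold>\<circ> f)"

locale preadditive_category = category +
  assumes hom_comm_group: "A \<in> Obj C \<Longrightarrow> B \<in> Obj C \<Longrightarrow> comm_group (hom_group C A B)"
    and comp_plus_right: "f \<in> Hom C A B \<Longrightarrow> f' \<in> Hom C A B \<Longrightarrow> g \<in> Hom C B D \<Longrightarrow>
                            g \<^bold>\<circ> (f \<^bold>+ f') = (g \<^bold>\<circ> f) \<^bold>+ (g \<^bold>\<circ> f')"
    and comp_plus_left: "f \<in> Hom C A B \<Longrightarrow> g \<in> Hom C B D \<Longrightarrow> g' \<in> Hom C B D \<Longrightarrow>
                            (g \<^bold>+ g') \<^bold>\<circ> f = (g \<^bold>\<circ> f) \<^bold>+ (g' \<^bold>\<circ> f)"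

definition is_mono :: "('o, 'm) cat \<Rightarrow> 'm \<Rightarrow> bool" where
  "is_mono C f \<longleftrightarrow> f \<in> Arr C \<and>
     (\<forall>D. \<forall>g \<in> Hom C D (Src C f). \<forall>h \<in> Hom C D (Src C f). f \<^bold>\<circ>\<^bsub>C\<^esub> g = f \<^bold>\<circ>\<^bsub>C\<^esub> h \<longrightarrow> g = h)"

definition is_epi :: "('o, 'm) cat \<Rightarrow> 'm \<Rightarrow> bool" where
  "is_epi C f \<longleftrightarrow> f \<in> Arr C \<and>
     (\<forall>D. \<forall>g \<in> Hom C (Tgt C f) D. \<forall>h \<in> Hom C (Tgt C f) D. g \<^bold>\<circ>\<^bsub>C\<^esub> f = h \<^bold>\<circ>\<^bsub>C\<^esub> f \<longrightarrow> g = h)"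

definition is_kernel :: "('o, 'm) cat \<Rightarrow> 'm \<Rightarrow> 'm \<Rightarrow> bool" where
  "is_kernel C k f \<longleftrightarrow> f \<in> Arr C \<and> k \<in> Arr C \<and> Tgt C k = Src C f \<and>
     f \<^bold>\<circ>\<^bsub>C\<^esub> k = Zero C (Src C k) (Tgt C f) \<and>
     (\<forall>D. \<forall>g \<in> Hom C D (Src C f). f \<^bold>\<circ>\<^bsub>C\<^esub> g = Zero C D (Tgt C f) \<longrightarrow>
        (\<exists>!h. h \<in> Hom C D (Src C k) \<and> k \<^bold>\<circ>\<^bsub>C\<^esub> h = g))"

definition is_cokernel :: "('o, 'm) cat \<Rightarrow> 'm \<Rightarrow> 'm \<Rightarrow> bool" where
  "is_cokernel C c f \<longleftrightarrow> f \<in> Arr C \<and> c \<in> Arr C \<and> Src C c = Tgt C f \<and>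
     c \<^bold>\<circ>\<^bsub>C\<^esub> f = Zero C (Src C f) (Tgt C c) \<and>
     (\<forall>D. \<forall>g \<in> Hom C (Tgt C f) D. g \<^bold>\<circ>\<^bsub>C\<^esub> f = Zero C (Src C f) D \<longrightarrow>
        (\<exists>!h. h \<in> Hom C (Tgt C c) D \<and> h \<^bold>\<circ>\<^bsub>C\<^esub> c = g))"

definition is_zero_object :: "('o, 'm) cat \<Rightarrow> 'o \<Rightarrow> bool" where
  "is_zero_object C Z \<longleftrightarrow> Z \<in> Obj C \<and>
     (\<forall>A \<in> Obj C. (\<exists>!f. f \<in> Hom C A Z) \<and> (\<exists>!f. f \<in> Hom C Z A))"

definition is_biproduct ::
    "('o, 'm) cat \<Rightarrow> 'o \<Rightarrow> 'o \<Rightarrow> 'o \<Rightarrow> 'm \<Rightarrow> 'm \<Rightarrow> 'm \<Rightarrow> 'm \<Rightarrow> bool" where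
  "is_biproduct C A B S i\<^sub>1 i\<^sub>2 p\<^sub>1 p\<^sub>2 \<longleftrightarrow> A \<in> Obj C \<and> B \<in> Obj C \<and> S \<in> Obj C \<and>
     i\<^sub>1 \<in> Hom C A S \<and> i\<^sub>2 \<in> Hom C B S \<and> p\<^sub>1 \<in> Hom C S A \<and> p\<^sub>2 \<in> Hom C S B \<and>
     p\<^sub>1 \<^bold>\<circ>\<^bsub>C\<^esub> i\<^sub>1 = Ident C A \<and> p\<^sub>2 \<^bold>\<circ>\<^bsub>C\<^esub> i\<^sub>2 = Ident C B \<and>
     p\<^sub>1 \<^bold>\<circ>\<^bsub>C\<^esub> i\<^sub>2 = Zero C B A \<and> p\<^sub>2 \<^bold>\<circ>\<^bsub>C\<^esub> i\<^sub>1 = Zero C A B \<and>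
     (i\<^sub>1 \<^bold>\<circ>\<^bsub>C\<^esub> p\<^sub>1) \<^bold>+\<^bsub>C\<^esub> (i\<^sub>2 \<^bold>\<circ>\<^bsub>C\<^esub> p\<^sub>2) = Ident C S"

text \<open>\<open>S\<close> is the direct sum of \<open>B 0, \<dots>, B (n - 1)\<close>; since \<^const>\<open>finprod\<close> is taken in
  \<^const>\<open>hom_group\<close>, it denotes the sum of arrows. For \<open>n = 0\<close> the condition says that \<open>S\<close> is a
  zero object.\<close>

definition is_finite_direct_sum :: "('o, 'm) cat \<Rightarrow> nat \<Rightarrow> (nat \<Rightarrow> 'o) \<Rightarrow> 'o \<Rightarrow> bool" where
  "is_finite_direct_sum C n B S \<longleftrightarrow> S \<in> Obj C \<and> (\<forall>k<n. B k \<in> Obj C) \<and>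
     (\<exists>i p. (\<forall>k<n. i k \<in> Hom C (B k) S \<and> p k \<in> Hom C S (B k)) \<and>
        (\<forall>j<n. \<forall>k<n. p j \<^bold>\<circ>\<^bsub>C\<^esub> i k = (if j = k then Ident C (B k) else Zero C (B k) (B j))) \<and>
        finprod (hom_group C S S) (\<lambda>k. i k \<^bold>\<circ>\<^bsub>C\<^esub> p k) {..<n} = Ident C S)"

locale abelian_category = preadditive_category +
  assumes ex_zero_object: "\<exists>Z. is_zero_object C Z"
    and ex_biproduct: "A \<in> Obj C \<Longrightarrow> B \<in> Obj C \<Longrightarrow> \<exists>S i\<^sub>1 i\<^sub>2 p\<^sub>1 p\<^sub>2. is_biproduct C A B S i\<^sub>1 i\<^sub>2 p\<^sub>1 p\<^sub>2"
    and ex_kernel: "f \<in> Arr C \<Longrightarrow> \<exists>k. is_kernel C k f"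
    and ex_cokernel: "f \<in> Arr C \<Longrightarrow> \<exists>c. is_cokernel C c f"
    and mono_is_kernel: "is_mono C f \<Longrightarrow> \<exists>g. is_kernel C f g"
    and epi_is_cokernel: "is_epi C f \<Longrightarrow> \<exists>g. is_cokernel C f g"

definition isomorphic :: "('o, 'm) cat \<Rightarrow> 'o \<Rightarrow> 'o \<Rightarrow> bool" where
  "isomorphic C A B \<longleftrightarrow>
     (\<exists>f \<in> Hom C A B. \<exists>g \<in> Hom C B A. g \<^bold>\<circ>\<^bsub>C\<^esub> f = Ident C A \<and> f \<^bold>\<circ>\<^bsub>C\<^esub> g = Ident C B)"

definition projective :: "('o, 'm) cat \<Rightarrow> 'o \<Rightarrow> bool" where
  "projective C P \<longleftrightarrow> P \<in> Obj C \<and>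
     (\<forall>e. is_epi C e \<longrightarrow>
        (\<forall>f \<in> Hom C P (Tgt C e). \<exists>g \<in> Hom C P (Src C e). e \<^bold>\<circ>\<^bsub>C\<^esub> g = f))"

definition injective :: "('o, 'm) cat \<Rightarrow> 'o \<Rightarrow> bool" where
  "injective C I \<longleftrightarrow> I \<in> Obj C \<and>
     (\<forall>m. is_mono C m \<longrightarrow>
        (\<forall>f \<in> Hom C (Src C m) I. \<exists>g \<in> Hom C (Tgt C m) I. g \<^bold>\<circ>\<^bsub>C\<^esub> m = f))"

definition enough_projectives :: "('o, 'm) cat \<Rightarrow> bool" where
  "enough_projectives C \<longleftrightarrow> (\<forall>A \<in> Obj C. \<exists>P. projective C P \<and> (\<exists>e \<in> Hom C P A. is_epi C e))"

definition enough_injectives :: "('o, 'm) cat \<Rightarrow> bool" where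
  "enough_injectives C \<longleftrightarrow> (\<forall>A \<in> Obj C. \<exists>I. injective C I \<and> (\<exists>m \<in> Hom C A I. is_mono C m))"


section \<open>Subcategories\<close>

text \<open>A full subcategory is given by its set of objects.\<close>

definition subcategory :: "('o, 'm) cat \<Rightarrow> 'o set \<Rightarrow> bool" where
  "subcategory C X \<longleftrightarrow> X \<subseteq> Obj C \<and>
     (\<forall>A \<in> X. \<forall>B. isomorphic C A B \<longrightarrow> B \<in> X) \<and>
     (\<forall>n B S. is_finite_direct_sum C n B S \<and> (\<forall>k<n. B k \<in> X) \<longrightarrow> S \<in> X)"

definition right_approximation :: "('o, 'm) cat \<Rightarrow> 'o set \<Rightarrow> 'o \<Rightarrow> 'm \<Rightarrow> bool" where
  "right_approximation C X A f \<longleftrightarrow> f \<in> Arr C \<and> Src C f \<in> X \<and> Tgt C f = A \<and>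
     (\<forall>X' \<in> X. \<forall>g \<in> Hom C X' A. \<exists>h \<in> Hom C X' (Src C f). f \<^bold>\<circ>\<^bsub>C\<^esub> h = g)"

definition left_approximation :: "('o, 'm) cat \<Rightarrow> 'o set \<Rightarrow> 'o \<Rightarrow> 'm \<Rightarrow> bool" where
  "left_approximation C X A f \<longleftrightarrow> f \<in> Arr C \<and> Src C f = A \<and> Tgt C f \<in> X \<and>
     (\<forall>X' \<in> X. \<forall>g \<in> Hom C A X'. \<exists>h \<in> Hom C (Tgt C f) X'. h \<^bold>\<circ>\<^bsub>C\<^esub> f = g)"

definition functorially_finite :: "('o, 'm) cat \<Rightarrow> 'o set \<Rightarrow> bool" where
  "functorially_finite C X \<longleftrightarrow>
     (\<forall>A \<in> Obj C. (\<exists>f. right_approximation C X A f) \<and> (\<exists>f. left_approximation C X A f))"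

definition closed_kernels_of_epis :: "('o, 'm) cat \<Rightarrow> 'o set \<Rightarrow> bool" where
  "closed_kernels_of_epis C X \<longleftrightarrow>
     (\<forall>f k. is_epi C f \<and> Src C f \<in> X \<and> Tgt C f \<in> X \<and> is_kernel C k f \<longrightarrow> Src C k \<in> X)"

definition closed_cokernels_of_monos :: "('o, 'm) cat \<Rightarrow> 'o set \<Rightarrow> bool" where
  "closed_cokernels_of_monos C X \<longleftrightarrow>
     (\<forall>f c. is_mono C f \<and> Src C f \<in> X \<and> Tgt C f \<in> X \<and> is_cokernel C c f \<longrightarrow> Tgt C c \<in> X)"

definition factors_through :: "('o, 'm) cat \<Rightarrow> ('o \<Rightarrow> bool) \<Rightarrow> 'm \<Rightarrow> bool" where
  "factors_through C \<P> h \<longleftrightarrow>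
     (\<exists>Q. \<P> Q \<and> (\<exists>u \<in> Hom C (Src C h) Q. \<exists>v \<in> Hom C Q (Tgt C h). h = v \<^bold>\<circ>\<^bsub>C\<^esub> u))"

definition stable_class :: "('o, 'm) cat \<Rightarrow> ('o \<Rightarrow> bool) \<Rightarrow> 'm \<Rightarrow> 'm set" where
  "stable_class C \<P> f = {g \<in> Hom C (Src C f) (Tgt C f).
     \<exists>h \<in> Hom C (Src C f) (Tgt C f). factors_through C \<P> h \<and> f = g \<^bold>+\<^bsub>C\<^esub> h}"

text \<open>The full subcategory on \<open>X\<close> modulo the arrows factoring through an object satisfying \<open>\<P>\<close>;
  the operations are computed on chosen representatives.\<close>

definition stable_cat :: "('o, 'm) cat \<Rightarrow> 'o set \<Rightarrow> ('o \<Rightarrow> bool) \<Rightarrow> ('o, 'm set) cat" where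
  "stable_cat C X \<P> = \<lparr>Obj = X,
     Arr = stable_class C \<P> ` {f \<in> Arr C. Src C f \<in> X \<and> Tgt C f \<in> X},
     Src = (\<lambda>u. Src C (SOME f. f \<in> u)),
     Tgt = (\<lambda>u. Tgt C (SOME f. f \<in> u)),
     Ident = (\<lambda>A. stable_class C \<P> (Ident C A)),
     Comp = (\<lambda>v u. stable_class C \<P> ((SOME g. g \<in> v) \<^bold>\<circ>\<^bsub>C\<^esub> (SOME f. f \<in> u))),
     Plus = (\<lambda>u v. stable_class C \<P> ((SOME f. f \<in> u) \<^bold>+\<^bsub>C\<^esub> (SOME g. g \<in> v))),
     Zero = (\<lambda>A B. stable_class C \<P> (Zero C A B))\<rparr>"

definition projectively_stable_cat :: "('o, 'm) cat \<Rightarrow> 'o set \<Rightarrow> ('o, 'm set) cat" where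
  "projectively_stable_cat C X = stable_cat C X (projective C)"

definition injectively_stable_cat :: "('o, 'm) cat \<Rightarrow> 'o set \<Rightarrow> ('o, 'm set) cat" where
  "injectively_stable_cat C X = stable_cat C X (injective C)"

definition has_split_idempotents :: "('o, 'm) cat \<Rightarrow> bool" where
  "has_split_idempotents C \<longleftrightarrow>
     (\<forall>A \<in> Obj C. \<forall>e \<in> Hom C A A. e \<^bold>\<circ>\<^bsub>C\<^esub> e = e \<longrightarrow>
        (\<exists>B \<in> Obj C. \<exists>r \<in> Hom C A B. \<exists>s \<in> Hom C B A. r \<^bold>\<circ>\<^bsub>C\<^esub> s = Ident C B \<and> s \<^bold>\<circ>\<^bsub>C\<^esub> r = e))"

text \<open>A not necessarily commutative ring is local if it is nonzero and the sum of any two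
  non-units is a non-unit.\<close>

definition local_ring :: "('a, 'b) ring_scheme \<Rightarrow> bool" where
  "local_ring R \<longleftrightarrow> ring R \<and> \<one>\<^bsub>R\<^esub> \<noteq> \<zero>\<^bsub>R\<^esub> \<and>
     (\<forall>x \<in> carrier R - Units R. \<forall>y \<in> carrier R - Units R. x \<oplus>\<^bsub>R\<^esub> y \<notin> Units R)"

definition krull_schmidt :: "('o, 'm) cat \<Rightarrow> bool" where
  "krull_schmidt C \<longleftrightarrow>
     (\<forall>A \<in> Obj C. \<exists>n B. is_finite_direct_sum C n B A \<and> (\<forall>k<n. local_ring (end_ring C (B k))))"


section \<open>The functor \<open>Ext\<^sup>1\<close>\<close>

text \<open>The Yoneda description: an extension \<open>0 \<rightarrow> B \<rightarrow> E \<rightarrow> A \<rightarrow> 0\<close> of \<open>A\<close> by \<open>B\<close> is the pair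
  \<open>(i, p)\<close> of its two arrows, and \<open>Ext\<^sup>1(A, B)\<close> is the set of equivalence classes of such
  extensions with the Baer sum.\<close>

definition short_exact :: "('o, 'm) cat \<Rightarrow> 'm \<times> 'm \<Rightarrow> bool" where
  "short_exact C x \<longleftrightarrow> is_kernel C (fst x) (snd x) \<and> is_cokernel C (snd x) (fst x)"

definition extensions :: "('o, 'm) cat \<Rightarrow> 'o \<Rightarrow> 'o \<Rightarrow> ('m \<times> 'm) set" where
  "extensions C A B = {x. short_exact C x \<and> Src C (fst x) = B \<and> Tgt C (snd x) = A}"

definition extension_morphism ::
    "('o, 'm) cat \<Rightarrow> 'm \<times> 'm \<Rightarrow> 'm \<times> 'm \<Rightarrow> 'm \<Rightarrow> 'm \<Rightarrow> 'm \<Rightarrow> bool" where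
  "extension_morphism C x y b e a \<longleftrightarrow>
     b \<in> Hom C (Src C (fst x)) (Src C (fst y)) \<and>
     e \<in> Hom C (Tgt C (fst x)) (Tgt C (fst y)) \<and>
     a \<in> Hom C (Tgt C (snd x)) (Tgt C (snd y)) \<and>
     e \<^bold>\<circ>\<^bsub>C\<^esub> fst x = fst y \<^bold>\<circ>\<^bsub>C\<^esub> b \<and> snd y \<^bold>\<circ>\<^bsub>C\<^esub> e = a \<^bold>\<circ>\<^bsub>C\<^esub> snd x"

definition extension_equiv :: "('o, 'm) cat \<Rightarrow> 'o \<Rightarrow> 'o \<Rightarrow> (('m \<times> 'm) \<times> ('m \<times> 'm)) set" where
  "extension_equiv C A B = {(x, y). x \<in> extensions C A B \<and> y \<in> extensions C A B \<and>
     (\<exists>e. extension_morphism C x y (Ident C B) e (Ident C A))}"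

text \<open>For \<open>b : B \<rightarrow> B'\<close>, the class \<open>b\<^sub>*\<xi>\<close> consists of the extensions \<open>y\<close> by \<open>B'\<close> that receive a
  morphism \<open>(b, e, 1)\<close> from a representative of \<open>\<xi>\<close>; equivalently, \<open>y\<close> is obtained from it by
  pushout along \<open>b\<close>. Dually for the pullback \<open>a\<^sup>*\<xi>\<close> along \<open>a : A' \<rightarrow> A\<close>.\<close>

definition ext_push :: "('o, 'm) cat \<Rightarrow> 'm \<Rightarrow> ('m \<times> 'm) set \<Rightarrow> ('m \<times> 'm) set" where
  "ext_push C b \<xi> = {y. \<exists>x \<in> \<xi>. y \<in> extensions C (Tgt C (snd x)) (Tgt C b) \<and>
     (\<exists>e. extension_morphism C x y b e (Ident C (Tgt C (snd x))))}"

definition ext_pull :: "('o, 'm) cat \<Rightarrow> 'm \<Rightarrow> ('m \<times> 'm) set \<Rightarrow> ('m \<times> 'm) set" where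
  "ext_pull C a \<xi> = {y. \<exists>x \<in> \<xi>. y \<in> extensions C (Src C a) (Src C (fst x)) \<and>
     (\<exists>e. extension_morphism C y x (Ident C (Src C (fst x))) e a)}"

text \<open>The Baer sum \<open>\<nabla>\<^sub>* \<Delta>\<^sup>* (x \<oplus> y)\<close>, with \<open>\<nabla> = p\<^sub>1 + p\<^sub>2 : B \<oplus> B \<rightarrow> B\<close> and
  \<open>\<Delta> = k\<^sub>1 + k\<^sub>2 : A \<rightarrow> A \<oplus> A\<close>. No biproducts are chosen: the class is the union over all choices of
  the biproducts \<open>S = B \<oplus> B\<close>, \<open>T = A \<oplus> A\<close> and \<open>U\<close> (of the two middle terms).\<close>

definition baer_sum ::
    "('o, 'm) cat \<Rightarrow> 'o \<Rightarrow> 'o \<Rightarrow> ('m \<times> 'm) set \<Rightarrow> ('m \<times> 'm) set \<Rightarrow> ('m \<times> 'm) set" where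
  "baer_sum C A B \<xi> \<eta> = {z. \<exists>x \<in> \<xi>. \<exists>y \<in> \<eta>.
     \<exists>S i\<^sub>1 i\<^sub>2 p\<^sub>1 p\<^sub>2 T k\<^sub>1 k\<^sub>2 q\<^sub>1 q\<^sub>2 U j\<^sub>1 j\<^sub>2 r\<^sub>1 r\<^sub>2.
       is_biproduct C B B S i\<^sub>1 i\<^sub>2 p\<^sub>1 p\<^sub>2 \<and> is_biproduct C A A T k\<^sub>1 k\<^sub>2 q\<^sub>1 q\<^sub>2 \<and>
       is_biproduct C (Tgt C (fst x)) (Tgt C (fst y)) U j\<^sub>1 j\<^sub>2 r\<^sub>1 r\<^sub>2 \<and>
       z \<in> ext_push C (p\<^sub>1 \<^bold>+\<^bsub>C\<^esub> p\<^sub>2) (ext_pull C (k\<^sub>1 \<^bold>+\<^bsub>C\<^esub> k\<^sub>2)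
         {((j\<^sub>1 \<^bold>\<circ>\<^bsub>C\<^esub> fst x \<^bold>\<circ>\<^bsub>C\<^esub> p\<^sub>1) \<^bold>+\<^bsub>C\<^esub> (j\<^sub>2 \<^bold>\<circ>\<^bsub>C\<^esub> fst y \<^bold>\<circ>\<^bsub>C\<^esub> p\<^sub>2),
           (k\<^sub>1 \<^bold>\<circ>\<^bsub>C\<^esub> snd x \<^bold>\<circ>\<^bsub>C\<^esub> r\<^sub>1) \<^bold>+\<^bsub>C\<^esub> (k\<^sub>2 \<^bold>\<circ>\<^bsub>C\<^esub> snd y \<^bold>\<circ>\<^bsub>C\<^esub> r\<^sub>2))})}"

definition split_extensions :: "('o, 'm) cat \<Rightarrow> 'o \<Rightarrow> 'o \<Rightarrow> ('m \<times> 'm) set" where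
  "split_extensions C A B = {x \<in> extensions C A B.
     \<exists>s \<in> Hom C A (Src C (snd x)). snd x \<^bold>\<circ>\<^bsub>C\<^esub> s = Ident C A}"

definition Ext1 :: "('o, 'm) cat \<Rightarrow> 'o \<Rightarrow> 'o \<Rightarrow> ('m \<times> 'm) set monoid" where
  "Ext1 C A B = \<lparr>carrier = extensions C A B // extension_equiv C A B,
                 monoid.mult = baer_sum C A B, one = split_extensions C A B\<rparr>"


section \<open>Additive functors to abelian groups\<close>

record ('o, 'm, 'g) ab_functor =
  FObj :: "'o \<Rightarrow> 'g monoid"
  FMap :: "'m \<Rightarrow> 'g \<Rightarrow> 'g"

text \<open>Covariant functors on the full subcategory \<open>X\<close>: only the values on objects and arrows of \<open>X\<close>
  matter, so restriction to \<open>X\<close> leaves the record unchanged. Contravariant functors are functors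
  on \<^const>\<open>op_cat\<close>.\<close>

definition additive_functor :: "('o, 'm) cat \<Rightarrow> 'o set \<Rightarrow> ('o, 'm, 'g) ab_functor \<Rightarrow> bool" where
  "additive_functor C X F \<longleftrightarrow>
     (\<forall>A \<in> X. comm_group (FObj F A)) \<and>
     (\<forall>A \<in> X. \<forall>B \<in> X. \<forall>f \<in> Hom C A B. FMap F f \<in> hom (FObj F A) (FObj F B)) \<and>
     (\<forall>A \<in> X. \<forall>x \<in> carrier (FObj F A). FMap F (Ident C A) x = x) \<and>
     (\<forall>A \<in> X. \<forall>B \<in> X. \<forall>D \<in> X. \<forall>f \<in> Hom C A B. \<forall>g \<in> Hom C B D. \<forall>x \<in> carrier (FObj F A).
        FMap F (g \<^bold>\<circ>\<^bsub>C\<^esub> f) x = FMap F g (FMap F f x)) \<and>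
     (\<forall>A \<in> X. \<forall>B \<in> X. \<forall>f \<in> Hom C A B. \<forall>g \<in> Hom C A B. \<forall>x \<in> carrier (FObj F A).
        FMap F (f \<^bold>+\<^bsub>C\<^esub> g) x = FMap F f x \<otimes>\<^bsub>FObj F B\<^esub> FMap F g x)"

definition functor_iso ::
    "('o, 'm) cat \<Rightarrow> 'o set \<Rightarrow> ('o, 'm, 'g) ab_functor \<Rightarrow> ('o, 'm, 'h) ab_functor \<Rightarrow> bool" where
  "functor_iso C X F G \<longleftrightarrow> (\<exists>\<tau>.
     (\<forall>A \<in> X. \<tau> A \<in> iso (FObj F A) (FObj G A)) \<and>
     (\<forall>A \<in> X. \<forall>B \<in> X. \<forall>f \<in> Hom C A B. \<forall>x \<in> carrier (FObj F A).
        \<tau> B (FMap F f x) = FMap G f (\<tau> A x)))"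

definition functor_sum ::
    "('o, 'm, 'g) ab_functor \<Rightarrow> ('o, 'm, 'h) ab_functor \<Rightarrow> ('o, 'm, 'g \<times> 'h) ab_functor" where
  "functor_sum F G = \<lparr>FObj = (\<lambda>A. FObj F A \<times>\<times> FObj G A),
                      FMap = (\<lambda>f. map_prod (FMap F f) (FMap G f))\<rparr>"

text \<open>\<open>F\<close> is a direct summand of \<open>E\<close> with complement \<open>G\<close>. The complement is an explicit argument
  because HOL cannot quantify existentially over the type of its elements.\<close>

definition direct_summand_compl :: "('o, 'm) cat \<Rightarrow> 'o set \<Rightarrow> ('o, 'm, 'g) ab_functor \<Rightarrow>
    ('o, 'm, 'h) ab_functor \<Rightarrow> ('o, 'm, 'e) ab_functor \<Rightarrow> bool" where
  "direct_summand_compl C X F G E \<longleftrightarrow>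
     additive_functor C X F \<and> additive_functor C X G \<and> functor_iso C X E (functor_sum F G)"

definition Ext1_cov :: "('o, 'm) cat \<Rightarrow> 'o \<Rightarrow> ('o, 'm, ('m \<times> 'm) set) ab_functor" where
  "Ext1_cov C A = \<lparr>FObj = (\<lambda>B. Ext1 C A B), FMap = ext_push C\<rparr>"

definition Ext1_contra :: "('o, 'm) cat \<Rightarrow> 'o \<Rightarrow> ('o, 'm, ('m \<times> 'm) set) ab_functor" where
  "Ext1_contra C A = \<lparr>FObj = (\<lambda>B. Ext1 C B A), FMap = ext_pull C\<rparr>"

end

theory Submission
  imports Defs
begin

text \<open>Let \<open>0 \<rightarrow> K \<rightarrow> P \<rightarrow> A \<rightarrow> 0\<close> be a projective presentation with class \<open>\<xi> \<in> Ext\<^sup>1(A, K)\<close>. Every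
  class in \<open>Ext\<^sup>1(A, Y)\<close> is a pushout of \<open>\<xi>\<close>, so a natural transformation
  \<open>Ext\<^sup>1(A, -) \<rightarrow> Ext\<^sup>1(B, -)\<close> on \<open>X\<close> is determined by the image of \<open>\<xi>\<close>; this image vanishes in
  \<open>Ext\<^sup>1(B, P)\<close>, hence equals \<open>a\<^sup>*\<xi>\<close> for some \<open>a : B \<rightarrow> A\<close>, which is unique up to arrows factoring
  through projectives. The idempotent of \<open>Ext\<^sup>1(A, -)\<close> belonging to a direct summand is therefore
  \<open>a\<^sup>*\<close> for an idempotent \<open>a\<close> of the stable category. A splitting of \<open>a\<close> through \<open>B\<close> makes
  \<open>Ext\<^sup>1(B, -)\<close> a retract of \<open>Ext\<^sup>1(A, -)\<close> with the same idempotent as the summand.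

  In the Krull--Schmidt case idempotents of the stable category split: every idempotent is a sum
  \<open>e = g + xy\<close>, where \<open>xy\<close> factors through an object \<open>B\<close> with local endomorphism ring and \<open>g\<close> is a
  sum with fewer terms of this kind. If \<open>1 - yex\<close> is invertible, then \<open>e\<close> factors through \<open>g\<close>;
  if \<open>yex\<close> is invertible, then \<open>e\<close> splits off \<open>B\<close>, and the remaining idempotent factors through \<open>g\<close>.
  The contravariant statements follow by passing to the opposite category.\<close>


section \<open>Preadditive categories\<close>

lemma in_Hom [simp]: "f \<in> Hom C A B \<longleftrightarrow> f \<in> Arr C \<and> Src C f = A \<and> Tgt C f = B"
  by (simp add: Hom_def)

context category begin

declare src_obj [simp] tgt_obj [simp]

lemma Hom_objs:
  assumes "f \<in> Hom C A B"
  shows "A \<in> Obj C" "B \<in> Obj C"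
  using assms by auto

lemma comp_typing [simp]:
  assumes "f \<in> Arr C" "g \<in> Arr C" "Tgt C f = Src C g"
  shows "g \<^bold>\<circ> f \<in> Arr C" "Src C (g \<^bold>\<circ> f) = Src C f" "Tgt C (g \<^bold>\<circ> f) = Tgt C g"
  using comp_hom[of f "Src C f" "Tgt C f" g "Tgt C g"] assms by auto

lemma ident_typing [simp]:
  assumes "A \<in> Obj C"
  shows "Ident C A \<in> Arr C" "Src C (Ident C A) = A" "Tgt C (Ident C A) = A"
  using ident_hom[OF assms] by auto

lemma comp_ident [simp]:
  assumes "f \<in> Arr C"
  shows "Src C f = A \<Longrightarrow> f \<^bold>\<circ> Ident C A = f" "Tgt C f = B \<Longrightarrow> Ident C B \<^bold>\<circ> f = f"
  using comp_ident_right[of f "Src C f" "Tgt C f"] comp_ident_left[of f "Src C f" "Tgt C f"] assms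
  by auto

lemma comp_reassoc [simp]:
  assumes "f \<in> Arr C" "g \<in> Arr C" "h \<in> Arr C" "Tgt C f = Src C g" "Tgt C g = Src C h"
  shows "(h \<^bold>\<circ> g) \<^bold>\<circ> f = h \<^bold>\<circ> g \<^bold>\<circ> f"
  using comp_assoc[of f "Src C f" "Tgt C f" g "Tgt C g" h "Tgt C h"] assms by auto

lemma comp_eq_precomp:
  assumes "g \<^bold>\<circ> f = h" "f \<in> Arr C" "g \<in> Arr C" "Tgt C f = Src C g" "k \<in> Arr C" "Tgt C k = Src C f"
  shows "g \<^bold>\<circ> f \<^bold>\<circ> k = h \<^bold>\<circ> k"
  using assms comp_reassoc[of k f g] by simp

end

lemma hom_group_simps [simp]:
  "carrier (hom_group C A B) = Hom C A B" "monoid.mult (hom_group C A B) = Plus C"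
  "\<one>\<^bsub>hom_group C A B\<^esub> = Zero C A B"
  by (simp_all add: hom_group_def)

context preadditive_category begin

lemma comm_group_parallel:
  assumes "f \<in> Arr C"
  shows "comm_group (hom_group C (Src C f) (Tgt C f))"
  using assms by (simp add: hom_comm_group)

lemma plus_typing [simp]:
  assumes "f \<in> Arr C" "g \<in> Arr C" "Src C f = Src C g" "Tgt C f = Tgt C g"
  shows "f \<^bold>+ g \<in> Arr C" "Src C (f \<^bold>+ g) = Src C f" "Tgt C (f \<^bold>+ g) = Tgt C f"
proof -
  interpret comm_group "hom_group C (Src C f) (Tgt C f)"
    using assms(1) by (rule comm_group_parallel)
  show "f \<^bold>+ g \<in> Arr C" "Src C (f \<^bold>+ g) = Src C f" "Tgt C (f \<^bold>+ g) = Tgt C f"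
    using m_closed[of f g] assms by auto
qed

lemma zero_typing [simp]:
  assumes "A \<in> Obj C" "B \<in> Obj C"
  shows "Zero C A B \<in> Arr C" "Src C (Zero C A B) = A" "Tgt C (Zero C A B) = B"
proof -
  interpret comm_group "hom_group C A B" using assms by (rule hom_comm_group)
  show "Zero C A B \<in> Arr C" "Src C (Zero C A B) = A" "Tgt C (Zero C A B) = B"
    using one_closed by auto
qed

lemma plus_assoc:
  assumes "f \<in> Arr C" "g \<in> Arr C" "h \<in> Arr C"
    "Src C f = Src C g" "Tgt C f = Tgt C g" "Src C g = Src C h" "Tgt C g = Tgt C h"
  shows "(f \<^bold>+ g) \<^bold>+ h = f \<^bold>+ (g \<^bold>+ h)"
proof -
  interpret comm_group "hom_group C (Src C f) (Tgt C f)"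
    using assms(1) by (rule comm_group_parallel)
  show ?thesis using m_assoc[of f g h] assms by auto
qed

lemma plus_comm:
  assumes "f \<in> Arr C" "g \<in> Arr C" "Src C f = Src C g" "Tgt C f = Tgt C g"
  shows "f \<^bold>+ g = g \<^bold>+ f"
proof -
  interpret comm_group "hom_group C (Src C f) (Tgt C f)"
    using assms(1) by (rule comm_group_parallel)
  show ?thesis using m_comm[of f g] assms by auto
qed

lemma plus_left_comm:
  assumes "f \<in> Arr C" "g \<in> Arr C" "h \<in> Arr C"
    "Src C f = Src C g" "Tgt C f = Tgt C g" "Src C g = Src C h" "Tgt C g = Tgt C h"
  shows "f \<^bold>+ (g \<^bold>+ h) = g \<^bold>+ (f \<^bold>+ h)"
  using assms plus_assoc[of f g h] plus_assoc[of g f h] plus_comm[of f g] by simp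

lemma plus_zero [simp]:
  assumes "f \<in> Arr C" "Src C f = A" "Tgt C f = B"
  shows "f \<^bold>+ Zero C A B = f" "Zero C A B \<^bold>+ f = f"
proof -
  interpret comm_group "hom_group C A B" using comm_group_parallel[OF assms(1)] assms(2,3) by simp
  show "f \<^bold>+ Zero C A B = f" "Zero C A B \<^bold>+ f = f" using r_one[of f] l_one[of f] assms by auto
qed

definition neg :: "'b \<Rightarrow> 'b" where
  "neg f = m_inv (hom_group C (Src C f) (Tgt C f)) f"

lemma neg_typing [simp]:
  assumes "f \<in> Arr C"
  shows "neg f \<in> Arr C" "Src C (neg f) = Src C f" "Tgt C (neg f) = Tgt C f"
proof -
  interpret comm_group "hom_group C (Src C f) (Tgt C f)" using assms by (rule comm_group_parallel)
  show "neg f \<in> Arr C" "Src C (neg f) = Src C f" "Tgt C (neg f) = Tgt C f"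
    using inv_closed[of f] assms by (auto simp: neg_def)
qed

lemma plus_neg [simp]:
  assumes "f \<in> Arr C"
  shows "f \<^bold>+ neg f = Zero C (Src C f) (Tgt C f)" "neg f \<^bold>+ f = Zero C (Src C f) (Tgt C f)"
proof -
  interpret comm_group "hom_group C (Src C f) (Tgt C f)" using assms by (rule comm_group_parallel)
  show "f \<^bold>+ neg f = Zero C (Src C f) (Tgt C f)" "neg f \<^bold>+ f = Zero C (Src C f) (Tgt C f)"
    using r_inv[of f] l_inv[of f] assms by (auto simp: neg_def)
qed

lemma plus_neg_cancel [simp]:
  assumes "f \<in> Arr C" "g \<in> Arr C" "Src C f = Src C g" "Tgt C f = Tgt C g"
  shows "f \<^bold>+ (neg f \<^bold>+ g) = g" "neg f \<^bold>+ (f \<^bold>+ g) = g"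
    "f \<^bold>+ (g \<^bold>+ neg f) = g" "neg f \<^bold>+ (g \<^bold>+ f) = g"
  using assms plus_assoc[of f "neg f" g, symmetric] plus_assoc[of "neg f" f g, symmetric]
    plus_comm[of g "neg f"] plus_comm[of g f] by (simp_all del: plus_typing)

lemma minus_eq_if_plus_eq:
  assumes "f \<^bold>+ h = g" "f \<in> Arr C" "h \<in> Arr C" "Src C f = Src C h" "Tgt C f = Tgt C h"
  shows "g \<^bold>+ neg h = f"
  using assms(2-) unfolding assms(1)[symmetric] by (simp add: plus_assoc)

lemma plus_left_cancel:
  assumes "f \<in> Arr C" "g \<in> Arr C" "h \<in> Arr C"
    "Src C f = Src C g" "Tgt C f = Tgt C g" "Src C g = Src C h" "Tgt C g = Tgt C h"
  shows "f \<^bold>+ g = f \<^bold>+ h \<longleftrightarrow> g = h"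
  using assms plus_neg_cancel(2)[of f g] plus_neg_cancel(2)[of f h] by metis

lemma distrib_left:
  assumes "f \<in> Arr C" "f' \<in> Arr C" "g \<in> Arr C" "Src C f = Src C f'" "Tgt C f = Tgt C f'"
    "Tgt C f' = Src C g"
  shows "g \<^bold>\<circ> (f \<^bold>+ f') = g \<^bold>\<circ> f \<^bold>+ g \<^bold>\<circ> f'"
  using comp_plus_right[of f "Src C f" "Tgt C f" f' g "Tgt C g"] assms by auto

lemma distrib_right:
  assumes "f \<in> Arr C" "g' \<in> Arr C" "g \<in> Arr C" "Src C g = Src C g'" "Tgt C g = Tgt C g'"
    "Tgt C f = Src C g'"
  shows "(g \<^bold>+ g') \<^bold>\<circ> f = g \<^bold>\<circ> f \<^bold>+ g' \<^bold>\<circ> f"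
  using comp_plus_left[of f "Src C f" "Tgt C f" g "Tgt C g" g'] assms by auto

lemmas distrib = distrib_left distrib_right

lemma eq_zero_if_plus_self:
  assumes "f \<in> Arr C" "f \<^bold>+ f = f"
  shows "f = Zero C (Src C f) (Tgt C f)"
  using assms plus_left_cancel[of f f "Zero C (Src C f) (Tgt C f)"] by simp

lemma comp_zero_right [simp]:
  assumes "f \<in> Arr C" "Src C f = B" "A \<in> Obj C"
  shows "f \<^bold>\<circ> Zero C A B = Zero C A (Tgt C f)"
proof -
  have "B \<in> Obj C" using assms by auto
  then show ?thesis
    using assms distrib_left[of "Zero C A B" "Zero C A B" f]
      eq_zero_if_plus_self[of "f \<^bold>\<circ> Zero C A B"]
    by simp
qed

lemma comp_zero_left [simp]:
  assumes "f \<in> Arr C" "Tgt C f = A" "B \<in> Obj C"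
  shows "Zero C A B \<^bold>\<circ> f = Zero C (Src C f) B"
proof -
  have "A \<in> Obj C" using assms by auto
  then show ?thesis
    using assms distrib_right[of f "Zero C A B" "Zero C A B"]
      eq_zero_if_plus_self[of "Zero C A B \<^bold>\<circ> f"]
    by simp
qed

lemma neg_unique:
  assumes "f \<in> Arr C" "g \<in> Arr C" "Src C f = Src C g" "Tgt C f = Tgt C g"
    "f \<^bold>+ g = Zero C (Src C f) (Tgt C f)"
  shows "g = neg f"
proof -
  have "neg f = neg f \<^bold>+ (f \<^bold>+ g)" using assms(1-4) by (simp add: assms(5) del: plus_neg_cancel)
  then show ?thesis using assms(1-4) by simp
qed

lemma comp_neg [simp]:
  assumes "f \<in> Arr C" "g \<in> Arr C" "Tgt C f = Src C g"
  shows "g \<^bold>\<circ> neg f = neg (g \<^bold>\<circ> f)" "neg g \<^bold>\<circ> f = neg (g \<^bold>\<circ> f)"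
proof -
  show "g \<^bold>\<circ> neg f = neg (g \<^bold>\<circ> f)"
    using assms by (intro neg_unique) (simp_all add: distrib_left[symmetric])
  show "neg g \<^bold>\<circ> f = neg (g \<^bold>\<circ> f)"
    using assms by (intro neg_unique) (simp_all add: distrib_right[symmetric])
qed

lemma neg_zero [simp]: "A \<in> Obj C \<Longrightarrow> B \<in> Obj C \<Longrightarrow> neg (Zero C A B) = Zero C A B"
  using neg_unique[of "Zero C A B" "Zero C A B"] by simp

lemma neg_neg [simp]: "f \<in> Arr C \<Longrightarrow> neg (neg f) = f"
  using neg_unique[of "neg f" f] by simp

lemma neg_plus [simp]:
  assumes "f \<in> Arr C" "g \<in> Arr C" "Src C f = Src C g" "Tgt C f = Tgt C g"
  shows "neg (f \<^bold>+ g) = neg f \<^bold>+ neg g"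
proof -
  have "(f \<^bold>+ g) \<^bold>+ (neg f \<^bold>+ neg g) = Zero C (Src C f) (Tgt C f)"
    using assms by (simp add: plus_comm[of f g] plus_assoc)
  with assms show ?thesis by (intro neg_unique[symmetric]) simp_all
qed

lemma minus_eq_zero_iff:
  assumes "f \<in> Arr C" "g \<in> Arr C" "Src C f = Src C g" "Tgt C f = Tgt C g"
  shows "f \<^bold>+ neg g = Zero C (Src C f) (Tgt C f) \<longleftrightarrow> f = g"
proof
  assume "f \<^bold>+ neg g = Zero C (Src C f) (Tgt C f)"
  with assms show "f = g" using neg_unique[of "neg g" f] by (simp add: plus_comm[of f])
qed (use assms in simp)

lemma biproduct_typing:
  assumes "is_biproduct C A B S i\<^sub>1 i\<^sub>2 p\<^sub>1 p\<^sub>2"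
  shows "A \<in> Obj C" "B \<in> Obj C" "S \<in> Obj C"
    "i\<^sub>1 \<in> Hom C A S" "i\<^sub>2 \<in> Hom C B S" "p\<^sub>1 \<in> Hom C S A" "p\<^sub>2 \<in> Hom C S B"
  using assms by (simp_all add: is_biproduct_def)

lemma biproduct_eqs:
  assumes "is_biproduct C A B S i\<^sub>1 i\<^sub>2 p\<^sub>1 p\<^sub>2"
  shows "p\<^sub>1 \<^bold>\<circ> i\<^sub>1 = Ident C A" "p\<^sub>2 \<^bold>\<circ> i\<^sub>2 = Ident C B"
    "p\<^sub>1 \<^bold>\<circ> i\<^sub>2 = Zero C B A" "p\<^sub>2 \<^bold>\<circ> i\<^sub>1 = Zero C A B" "(i\<^sub>1 \<^bold>\<circ> p\<^sub>1) \<^bold>+ (i\<^sub>2 \<^bold>\<circ> p\<^sub>2) = Ident C S"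
  using assms by (simp_all add: is_biproduct_def)

lemma biproduct_eqs_comp:
  assumes "is_biproduct C A B S i\<^sub>1 i\<^sub>2 p\<^sub>1 p\<^sub>2" "f \<in> Arr C"
  shows "Tgt C f = A \<Longrightarrow> p\<^sub>1 \<^bold>\<circ> i\<^sub>1 \<^bold>\<circ> f = f" "Tgt C f = B \<Longrightarrow> p\<^sub>2 \<^bold>\<circ> i\<^sub>2 \<^bold>\<circ> f = f"
    "Tgt C f = B \<Longrightarrow> p\<^sub>1 \<^bold>\<circ> i\<^sub>2 \<^bold>\<circ> f = Zero C (Src C f) A"
    "Tgt C f = A \<Longrightarrow> p\<^sub>2 \<^bold>\<circ> i\<^sub>1 \<^bold>\<circ> f = Zero C (Src C f) B"
    "Tgt C f = S \<Longrightarrow> (i\<^sub>1 \<^bold>\<circ> p\<^sub>1 \<^bold>\<circ> f) \<^bold>+ (i\<^sub>2 \<^bold>\<circ> p\<^sub>2 \<^bold>\<circ> f) = f"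
    "Src C f = S \<Longrightarrow> (f \<^bold>\<circ> i\<^sub>1 \<^bold>\<circ> p\<^sub>1) \<^bold>+ (f \<^bold>\<circ> i\<^sub>2 \<^bold>\<circ> p\<^sub>2) = f"
proof -
  note S = biproduct_typing[OF assms(1)] biproduct_eqs[OF assms(1)]
  show "Tgt C f = A \<Longrightarrow> p\<^sub>1 \<^bold>\<circ> i\<^sub>1 \<^bold>\<circ> f = f" "Tgt C f = B \<Longrightarrow> p\<^sub>2 \<^bold>\<circ> i\<^sub>2 \<^bold>\<circ> f = f"
    "Tgt C f = B \<Longrightarrow> p\<^sub>1 \<^bold>\<circ> i\<^sub>2 \<^bold>\<circ> f = Zero C (Src C f) A"
    "Tgt C f = A \<Longrightarrow> p\<^sub>2 \<^bold>\<circ> i\<^sub>1 \<^bold>\<circ> f = Zero C (Src C f) B"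
    using S assms(2) by (simp_all add: comp_eq_precomp)
  show "Tgt C f = S \<Longrightarrow> (i\<^sub>1 \<^bold>\<circ> p\<^sub>1 \<^bold>\<circ> f) \<^bold>+ (i\<^sub>2 \<^bold>\<circ> p\<^sub>2 \<^bold>\<circ> f) = f"
    using S assms(2) distrib_right[of f "i\<^sub>2 \<^bold>\<circ> p\<^sub>2" "i\<^sub>1 \<^bold>\<circ> p\<^sub>1"] by simp
  show "Src C f = S \<Longrightarrow> (f \<^bold>\<circ> i\<^sub>1 \<^bold>\<circ> p\<^sub>1) \<^bold>+ (f \<^bold>\<circ> i\<^sub>2 \<^bold>\<circ> p\<^sub>2) = f"
    using S assms(2) distrib_left[of "i\<^sub>1 \<^bold>\<circ> p\<^sub>1" "i\<^sub>2 \<^bold>\<circ> p\<^sub>2" f] by simp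
qed

lemma biproduct_eqI_proj:
  assumes "is_biproduct C A B S i\<^sub>1 i\<^sub>2 p\<^sub>1 p\<^sub>2" "f \<in> Hom C D S" "g \<in> Hom C D S"
    "p\<^sub>1 \<^bold>\<circ> f = p\<^sub>1 \<^bold>\<circ> g" "p\<^sub>2 \<^bold>\<circ> f = p\<^sub>2 \<^bold>\<circ> g"
  shows "f = g"
proof -
  have "f = i\<^sub>1 \<^bold>\<circ> (p\<^sub>1 \<^bold>\<circ> f) \<^bold>+ i\<^sub>2 \<^bold>\<circ> (p\<^sub>2 \<^bold>\<circ> f)"
    using biproduct_eqs_comp(5)[OF assms(1), of f] assms(2) by simp
  also have "\<dots> = g"
    unfolding assms(4,5) using biproduct_eqs_comp(5)[OF assms(1), of g] assms(3) by simp
  finally show ?thesis .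
qed

end


section \<open>Duality\<close>

lemma op_cat_simps [simp]:
  "Obj (op_cat C) = Obj C" "Arr (op_cat C) = Arr C"
  "Src (op_cat C) = Tgt C" "Tgt (op_cat C) = Src C"
  "Ident (op_cat C) = Ident C" "g \<^bold>\<circ>\<^bsub>op_cat C\<^esub> f = f \<^bold>\<circ>\<^bsub>C\<^esub> g" "Plus (op_cat C) = Plus C"
  "Zero (op_cat C) A B = Zero C B A" "Hom (op_cat C) A B = Hom C B A"
  "hom_group (op_cat C) A B = hom_group C B A"
  by (auto simp: op_cat_def Hom_def hom_group_def)

lemma op_cat_op_cat [simp]: "op_cat (op_cat C) = C"
  by (simp add: op_cat_def)

lemma op_cat_notions [simp]:
  "is_mono (op_cat C) f \<longleftrightarrow> is_epi C f" "is_epi (op_cat C) f \<longleftrightarrow> is_mono C f"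
  "is_kernel (op_cat C) k f \<longleftrightarrow> is_cokernel C k f" "is_cokernel (op_cat C) k f \<longleftrightarrow> is_kernel C k f"
  "is_biproduct (op_cat C) A B S i\<^sub>1 i\<^sub>2 p\<^sub>1 p\<^sub>2 \<longleftrightarrow> is_biproduct C A B S p\<^sub>1 p\<^sub>2 i\<^sub>1 i\<^sub>2"
  "is_zero_object (op_cat C) Z \<longleftrightarrow> is_zero_object C Z"
  "projective (op_cat C) = injective C" "injective (op_cat C) = projective C"
  "enough_projectives (op_cat C) \<longleftrightarrow> enough_injectives C"
  "closed_kernels_of_epis (op_cat C) X \<longleftrightarrow> closed_cokernels_of_monos C X"
  by (auto simp: is_mono_def is_epi_def is_kernel_def is_cokernel_def is_biproduct_def
    is_zero_object_def fun_eq_iff projective_def injective_def enough_projectives_def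
    enough_injectives_def closed_kernels_of_epis_def closed_cokernels_of_monos_def)

lemma (in category) category_op: "category (op_cat C)"
  by unfold_locales auto

lemma (in preadditive_category) preadditive_op: "preadditive_category (op_cat C)"
  by (intro preadditive_category.intro preadditive_category_axioms.intro category_op)
    (auto simp: distrib hom_comm_group)

lemma (in abelian_category) abelian_op: "abelian_category (op_cat C)"
proof (intro abelian_category.intro abelian_category_axioms.intro preadditive_op)
  fix A B assume "A \<in> Obj (op_cat C)" "B \<in> Obj (op_cat C)"
  then show "\<exists>S i\<^sub>1 i\<^sub>2 p\<^sub>1 p\<^sub>2. is_biproduct (op_cat C) A B S i\<^sub>1 i\<^sub>2 p\<^sub>1 p\<^sub>2"
    using ex_biproduct[of A B] by simp blast
qed (auto simp: ex_zero_object ex_kernel ex_cokernel mono_is_kernel epi_is_cokernel)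

lemma (in preadditive_category) biproduct_eqI_inj:
  assumes "is_biproduct C A B S i\<^sub>1 i\<^sub>2 p\<^sub>1 p\<^sub>2" "f \<in> Hom C S D" "g \<in> Hom C S D"
    "f \<^bold>\<circ> i\<^sub>1 = g \<^bold>\<circ> i\<^sub>1" "f \<^bold>\<circ> i\<^sub>2 = g \<^bold>\<circ> i\<^sub>2"
  shows "f = g"
  using preadditive_category.biproduct_eqI_proj[OF preadditive_op, of A B S p\<^sub>1 p\<^sub>2 i\<^sub>1 i\<^sub>2 f D g]
    assms by simp


section \<open>Kernels and cokernels\<close>

lemma is_mono_arr: "is_mono C f \<Longrightarrow> f \<in> Arr C"
  by (simp add: is_mono_def)

lemma is_epi_arr: "is_epi C f \<Longrightarrow> f \<in> Arr C"
  by (simp add: is_epi_def)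

lemma is_kernelD:
  assumes "is_kernel C k f"
  shows "f \<in> Arr C" "k \<in> Hom C (Src C k) (Src C f)" "f \<^bold>\<circ>\<^bsub>C\<^esub> k = Zero C (Src C k) (Tgt C f)"
  using assms by (auto simp: is_kernel_def)

lemma is_cokernelD:
  assumes "is_cokernel C c f"
  shows "f \<in> Arr C" "c \<in> Hom C (Tgt C f) (Tgt C c)" "c \<^bold>\<circ>\<^bsub>C\<^esub> f = Zero C (Src C f) (Tgt C c)"
  using assms by (auto simp: is_cokernel_def)

context preadditive_category begin

lemma monoI:
  assumes f: "f \<in> Hom C A B"
    and cancel: "\<And>g D. g \<in> Hom C D A \<Longrightarrow> f \<^bold>\<circ> g = Zero C D B \<Longrightarrow> g = Zero C D A"
  shows "is_mono C f"
  unfolding is_mono_def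
proof (intro conjI allI ballI impI)
  fix D g h
  assume g: "g \<in> Hom C D (Src C f)" and h: "h \<in> Hom C D (Src C f)" and eq: "f \<^bold>\<circ> g = f \<^bold>\<circ> h"
  have "f \<^bold>\<circ> (g \<^bold>+ neg h) = Zero C D B" using f g h by (simp add: distrib eq)
  then have "g \<^bold>+ neg h = Zero C D A" using f g h by (intro cancel) simp_all
  then show "g = h" using f g h minus_eq_zero_iff[of g h] by simp
qed (use f in simp)

lemma mono_cancel:
  assumes "is_mono C f" "f \<^bold>\<circ> g = f \<^bold>\<circ> h" "g \<in> Hom C D (Src C f)" "h \<in> Hom C D (Src C f)"
  shows "g = h"
  using assms unfolding is_mono_def by blast

lemma mono_cancel_zero:
  assumes "is_mono C f" "f \<^bold>\<circ> g = Zero C D (Tgt C f)" "g \<in> Hom C D (Src C f)"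
  shows "g = Zero C D (Src C f)"
proof (rule mono_cancel[OF assms(1) _ assms(3)])
  have "f \<in> Arr C" "D \<in> Obj C" using is_mono_arr[OF assms(1)] Hom_objs[OF assms(3)] by simp_all
  then show "f \<^bold>\<circ> g = f \<^bold>\<circ> Zero C D (Src C f)" "Zero C D (Src C f) \<in> Hom C D (Src C f)"
    using assms(2) by simp_all
qed

lemma kernel_lift:
  assumes "is_kernel C k f" "g \<in> Hom C D (Src C f)" "f \<^bold>\<circ> g = Zero C D (Tgt C f)"
  obtains h where "h \<in> Hom C D (Src C k)" "k \<^bold>\<circ> h = g"
  using assms unfolding is_kernel_def by blast

lemma kernel_is_mono:
  assumes "is_kernel C k f"
  shows "is_mono C k"
proof (rule monoI)
  note k = is_kernelD[OF assms]
  show "k \<in> Hom C (Src C k) (Src C f)" by (fact k)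
  fix g D assume g: "g \<in> Hom C D (Src C k)" and kg: "k \<^bold>\<circ> g = Zero C D (Src C f)"
  note objs = Hom_objs[OF g] Hom_objs[OF k(2)]
  have "Zero C D (Src C f) \<in> Hom C D (Src C f)" "f \<^bold>\<circ> Zero C D (Src C f) = Zero C D (Tgt C f)"
    using k objs by simp_all
  then have "\<exists>!h. h \<in> Hom C D (Src C k) \<and> k \<^bold>\<circ> h = Zero C D (Src C f)"
    using assms unfolding is_kernel_def by blast
  moreover have "Zero C D (Src C k) \<in> Hom C D (Src C k)"
    "k \<^bold>\<circ> Zero C D (Src C k) = Zero C D (Src C f)"
    using k objs by simp_all
  ultimately show "g = Zero C D (Src C k)" using g kg by blast
qed

lemma is_kernelI:
  assumes "is_mono C k" "f \<in> Arr C" "Tgt C k = Src C f" "f \<^bold>\<circ> k = Zero C (Src C k) (Tgt C f)"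
    and "\<And>g D. g \<in> Hom C D (Src C f) \<Longrightarrow> f \<^bold>\<circ> g = Zero C D (Tgt C f) \<Longrightarrow>
           \<exists>h \<in> Hom C D (Src C k). k \<^bold>\<circ> h = g"
  shows "is_kernel C k f"
proof -
  have "\<exists>!h. h \<in> Hom C D (Src C k) \<and> k \<^bold>\<circ> h = g"
    if "g \<in> Hom C D (Src C f)" "f \<^bold>\<circ> g = Zero C D (Tgt C f)" for g D
    using assms(5)[OF that] mono_cancel[OF assms(1)] by blast
  then show ?thesis using assms(2-4) is_mono_arr[OF assms(1)] unfolding is_kernel_def by blast
qed

lemma epiI:
  assumes "f \<in> Hom C A B"
    and "\<And>g D. g \<in> Hom C B D \<Longrightarrow> g \<^bold>\<circ> f = Zero C A D \<Longrightarrow> g = Zero C B D"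
  shows "is_epi C f"
  using preadditive_category.monoI[OF preadditive_op, of f B A] assms by simp

lemma epi_cancel:
  assumes "is_epi C f" "g \<^bold>\<circ> f = h \<^bold>\<circ> f" "g \<in> Hom C (Tgt C f) D" "h \<in> Hom C (Tgt C f) D"
  shows "g = h"
  using assms unfolding is_epi_def by blast

lemma cokernel_desc:
  assumes "is_cokernel C c f" "g \<in> Hom C (Tgt C f) D" "g \<^bold>\<circ> f = Zero C (Src C f) D"
  obtains h where "h \<in> Hom C (Tgt C c) D" "h \<^bold>\<circ> c = g"
  using assms unfolding is_cokernel_def by blast

lemma cokernel_is_epi: "is_cokernel C c f \<Longrightarrow> is_epi C c"
  using preadditive_category.kernel_is_mono[OF preadditive_op] by simp

lemma is_cokernelI:
  assumes "is_epi C c" "f \<in> Arr C" "Src C c = Tgt C f" "c \<^bold>\<circ> f = Zero C (Src C f) (Tgt C c)"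
    and "\<And>g D. g \<in> Hom C (Tgt C f) D \<Longrightarrow> g \<^bold>\<circ> f = Zero C (Src C f) D \<Longrightarrow>
           \<exists>h \<in> Hom C (Tgt C c) D. h \<^bold>\<circ> c = g"
  shows "is_cokernel C c f"
  using preadditive_category.is_kernelI[OF preadditive_op, of c f] assms by simp

lemma kernel_of_cokernel:
  assumes "is_kernel C f g" "is_cokernel C c f"
  shows "is_kernel C f c"
proof (rule is_kernelI)
  note f = is_kernelD[OF assms(1)] and c = is_cokernelD[OF assms(2)]
  show "is_mono C f" using assms(1) by (rule kernel_is_mono)
  show "c \<in> Arr C" "Tgt C f = Src C c" "c \<^bold>\<circ> f = Zero C (Src C f) (Tgt C c)" using c by auto
  obtain h where h: "h \<in> Hom C (Tgt C c) (Tgt C g)" and hc: "h \<^bold>\<circ> c = g"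
    using cokernel_desc[OF assms(2), of g] f by auto
  fix u D assume u: "u \<in> Hom C D (Src C c)" and cu: "c \<^bold>\<circ> u = Zero C D (Tgt C c)"
  have "g \<^bold>\<circ> u = h \<^bold>\<circ> c \<^bold>\<circ> u" using h c u by (simp flip: hc)
  also have "\<dots> = Zero C D (Tgt C g)" unfolding cu using h Hom_objs[OF u] by simp
  finally have "g \<^bold>\<circ> u = Zero C D (Tgt C g)" .
  moreover have "u \<in> Hom C D (Src C g)" using u c f by simp
  ultimately show "\<exists>v \<in> Hom C D (Src C f). f \<^bold>\<circ> v = u" by (metis kernel_lift[OF assms(1)])
qed

end

context abelian_category begin

lemma mono_kernel_of_cokernel: "is_mono C f \<Longrightarrow> is_cokernel C c f \<Longrightarrow> is_kernel C f c"
  using mono_is_kernel kernel_of_cokernel by blast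

lemma epi_cokernel_of_kernel: "is_epi C f \<Longrightarrow> is_kernel C k f \<Longrightarrow> is_cokernel C f k"
  using abelian_category.mono_kernel_of_cokernel[OF abelian_op] by simp

end

definition biproduct_map :: "('o, 'm) cat \<Rightarrow> 'm \<Rightarrow> 'm \<Rightarrow> 'm \<Rightarrow> 'm \<Rightarrow> 'm \<Rightarrow> 'm \<Rightarrow> 'm" where
  "biproduct_map C j\<^sub>1 j\<^sub>2 p\<^sub>1 p\<^sub>2 f g = (j\<^sub>1 \<^bold>\<circ>\<^bsub>C\<^esub> f \<^bold>\<circ>\<^bsub>C\<^esub> p\<^sub>1) \<^bold>+\<^bsub>C\<^esub> (j\<^sub>2 \<^bold>\<circ>\<^bsub>C\<^esub> g \<^bold>\<circ>\<^bsub>C\<^esub> p\<^sub>2)"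

context preadditive_category begin

lemma biproduct_map_typing:
  assumes "is_biproduct C A B S i\<^sub>1 i\<^sub>2 p\<^sub>1 p\<^sub>2" "is_biproduct C A' B' S' j\<^sub>1 j\<^sub>2 q\<^sub>1 q\<^sub>2"
    "f \<in> Hom C A A'" "g \<in> Hom C B B'"
  shows "biproduct_map C j\<^sub>1 j\<^sub>2 p\<^sub>1 p\<^sub>2 f g \<in> Hom C S S'"
  using biproduct_typing[OF assms(1)] biproduct_typing[OF assms(2)] assms(3,4)
  by (simp add: biproduct_map_def)

lemma biproduct_map_proj:
  assumes "is_biproduct C A B S i\<^sub>1 i\<^sub>2 p\<^sub>1 p\<^sub>2" "is_biproduct C A' B' S' j\<^sub>1 j\<^sub>2 q\<^sub>1 q\<^sub>2"
    "f \<in> Hom C A A'" "g \<in> Hom C B B'"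
  shows "q\<^sub>1 \<^bold>\<circ> biproduct_map C j\<^sub>1 j\<^sub>2 p\<^sub>1 p\<^sub>2 f g = f \<^bold>\<circ> p\<^sub>1"
    "q\<^sub>2 \<^bold>\<circ> biproduct_map C j\<^sub>1 j\<^sub>2 p\<^sub>1 p\<^sub>2 f g = g \<^bold>\<circ> p\<^sub>2"
  using biproduct_typing[OF assms(1)] biproduct_typing[OF assms(2)] biproduct_eqs_comp[OF assms(2)]
    assms(3,4)
  by (simp_all add: biproduct_map_def distrib)

lemma biproduct_map_inj:
  assumes "is_biproduct C A B S i\<^sub>1 i\<^sub>2 p\<^sub>1 p\<^sub>2" "is_biproduct C A' B' S' j\<^sub>1 j\<^sub>2 q\<^sub>1 q\<^sub>2"
    "f \<in> Hom C A A'" "g \<in> Hom C B B'"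
  shows "biproduct_map C j\<^sub>1 j\<^sub>2 p\<^sub>1 p\<^sub>2 f g \<^bold>\<circ> i\<^sub>1 = j\<^sub>1 \<^bold>\<circ> f"
    "biproduct_map C j\<^sub>1 j\<^sub>2 p\<^sub>1 p\<^sub>2 f g \<^bold>\<circ> i\<^sub>2 = j\<^sub>2 \<^bold>\<circ> g"
  using biproduct_typing[OF assms(1)] biproduct_typing[OF assms(2)] biproduct_eqs[OF assms(1)]
    assms(3,4)
  by (simp_all add: biproduct_map_def distrib)

lemma biproduct_map_comp_eq_iff:
  assumes "is_biproduct C A B S i\<^sub>1 i\<^sub>2 p\<^sub>1 p\<^sub>2" "is_biproduct C A' B' S' j\<^sub>1 j\<^sub>2 q\<^sub>1 q\<^sub>2"
    "f \<in> Hom C A A'" "g \<in> Hom C B B'" "h \<in> Hom C D S" "k \<in> Hom C D S'"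
  shows "biproduct_map C j\<^sub>1 j\<^sub>2 p\<^sub>1 p\<^sub>2 f g \<^bold>\<circ> h = k \<longleftrightarrow>
    f \<^bold>\<circ> p\<^sub>1 \<^bold>\<circ> h = q\<^sub>1 \<^bold>\<circ> k \<and> g \<^bold>\<circ> p\<^sub>2 \<^bold>\<circ> h = q\<^sub>2 \<^bold>\<circ> k"
    (is "?m \<^bold>\<circ> h = k \<longleftrightarrow> ?components")
proof -
  note m = biproduct_map_typing[OF assms(1-4)]
  note S = biproduct_typing[OF assms(1)] and S' = biproduct_typing[OF assms(2)]
  have "q\<^sub>1 \<^bold>\<circ> ?m \<^bold>\<circ> h = f \<^bold>\<circ> p\<^sub>1 \<^bold>\<circ> h" "q\<^sub>2 \<^bold>\<circ> ?m \<^bold>\<circ> h = g \<^bold>\<circ> p\<^sub>2 \<^bold>\<circ> h"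
    using biproduct_map_proj[OF assms(1-4), THEN comp_eq_precomp, of h] m S S' assms(3-5)
    by simp_all
  moreover have "?m \<^bold>\<circ> h = k" if "q\<^sub>1 \<^bold>\<circ> ?m \<^bold>\<circ> h = q\<^sub>1 \<^bold>\<circ> k" "q\<^sub>2 \<^bold>\<circ> ?m \<^bold>\<circ> h = q\<^sub>2 \<^bold>\<circ> k"
    using biproduct_eqI_proj[OF assms(2) _ assms(6) that] m assms(5) by simp
  ultimately show ?thesis by auto
qed

lemma biproduct_map_mono:
  assumes "is_biproduct C A B S i\<^sub>1 i\<^sub>2 p\<^sub>1 p\<^sub>2" "is_biproduct C A' B' S' j\<^sub>1 j\<^sub>2 q\<^sub>1 q\<^sub>2"
    "f \<in> Hom C A A'" "g \<in> Hom C B B'" "is_mono C f" "is_mono C g"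
  shows "is_mono C (biproduct_map C j\<^sub>1 j\<^sub>2 p\<^sub>1 p\<^sub>2 f g)"
proof (rule monoI[OF biproduct_map_typing[OF assms(1-4)]])
  note S = biproduct_typing[OF assms(1)] and S' = biproduct_typing[OF assms(2)]
  fix h D assume h: "h \<in> Hom C D S" and "biproduct_map C j\<^sub>1 j\<^sub>2 p\<^sub>1 p\<^sub>2 f g \<^bold>\<circ> h = Zero C D S'"
  then have "f \<^bold>\<circ> p\<^sub>1 \<^bold>\<circ> h = Zero C D A'" "g \<^bold>\<circ> p\<^sub>2 \<^bold>\<circ> h = Zero C D B'"
    using biproduct_map_comp_eq_iff[OF assms(1-4), of h D "Zero C D S'"] S' Hom_objs[OF h]
    by simp_all
  then have "p\<^sub>1 \<^bold>\<circ> h = Zero C D A" "p\<^sub>2 \<^bold>\<circ> h = Zero C D B"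
    using mono_cancel_zero[OF assms(5), of "p\<^sub>1 \<^bold>\<circ> h" D]
      mono_cancel_zero[OF assms(6), of "p\<^sub>2 \<^bold>\<circ> h" D]
      assms(3,4) h S by simp_all
  then show "h = Zero C D S"
    using biproduct_eqI_proj[OF assms(1) h, of "Zero C D S"] S Hom_objs[OF h] by simp
qed

lemma biproduct_map_kernel:
  assumes S: "is_biproduct C B B' S i\<^sub>1 i\<^sub>2 p\<^sub>1 p\<^sub>2" and T: "is_biproduct C A A' T k\<^sub>1 k\<^sub>2 q\<^sub>1 q\<^sub>2"
    and U: "is_biproduct C E E' U j\<^sub>1 j\<^sub>2 r\<^sub>1 r\<^sub>2" and k: "is_kernel C i p"
    and k': "is_kernel C i' p'"
    and hom: "i \<in> Hom C B E" "i' \<in> Hom C B' E'" "p \<in> Hom C E A" "p' \<in> Hom C E' A'"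
  shows "is_kernel C (biproduct_map C j\<^sub>1 j\<^sub>2 p\<^sub>1 p\<^sub>2 i i') (biproduct_map C k\<^sub>1 k\<^sub>2 r\<^sub>1 r\<^sub>2 p p')"
    (is "is_kernel C ?i ?p")
proof (rule is_kernelI)
  note S' = biproduct_typing[OF S] and T' = biproduct_typing[OF T] and U' = biproduct_typing[OF U]
  note i = biproduct_map_typing[OF S U hom(1,2)] and p = biproduct_map_typing[OF U T hom(3,4)]
  show "is_mono C ?i"
    by (rule biproduct_map_mono[OF S U hom(1,2) kernel_is_mono[OF k] kernel_is_mono[OF k']])
  show "?p \<in> Arr C" "Tgt C ?i = Src C ?p" using i p by simp_all
  have "p \<^bold>\<circ> i \<^bold>\<circ> p\<^sub>1 = Zero C S A" "p' \<^bold>\<circ> i' \<^bold>\<circ> p\<^sub>2 = Zero C S A'"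
    using comp_eq_precomp[OF is_kernelD(3)[OF k], of p\<^sub>1]
      comp_eq_precomp[OF is_kernelD(3)[OF k'], of p\<^sub>2]
      hom S' T' by simp_all
  then have "?p \<^bold>\<circ> ?i = Zero C S T"
    using biproduct_map_comp_eq_iff[OF U T hom(3,4) i, of "Zero C S T"]
      biproduct_map_proj[OF S U hom(1,2)] S' T'
    by simp
  then show "?p \<^bold>\<circ> ?i = Zero C (Src C ?i) (Tgt C ?p)" using i p by simp
  fix g D assume "g \<in> Hom C D (Src C ?p)" "?p \<^bold>\<circ> g = Zero C D (Tgt C ?p)"
  then have g: "g \<in> Hom C D U" and "?p \<^bold>\<circ> g = Zero C D T" using p by simp_all
  then have components: "p \<^bold>\<circ> r\<^sub>1 \<^bold>\<circ> g = Zero C D A" "p' \<^bold>\<circ> r\<^sub>2 \<^bold>\<circ> g = Zero C D A'"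
    using biproduct_map_comp_eq_iff[OF U T hom(3,4) g, of "Zero C D T"] T' Hom_objs[OF g]
    by simp_all
  obtain h where h: "h \<in> Hom C D B" "i \<^bold>\<circ> h = r\<^sub>1 \<^bold>\<circ> g"
    using kernel_lift[OF k, of "r\<^sub>1 \<^bold>\<circ> g" D] components g U' hom by auto
  obtain h' where h': "h' \<in> Hom C D B'" "i' \<^bold>\<circ> h' = r\<^sub>2 \<^bold>\<circ> g"
    using kernel_lift[OF k', of "r\<^sub>2 \<^bold>\<circ> g" D] components g U' hom by auto
  have "i\<^sub>1 \<^bold>\<circ> h \<^bold>+ i\<^sub>2 \<^bold>\<circ> h' \<in> Hom C D S" "p\<^sub>1 \<^bold>\<circ> (i\<^sub>1 \<^bold>\<circ> h \<^bold>+ i\<^sub>2 \<^bold>\<circ> h') = h"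
    "p\<^sub>2 \<^bold>\<circ> (i\<^sub>1 \<^bold>\<circ> h \<^bold>+ i\<^sub>2 \<^bold>\<circ> h') = h'"
    using h(1) h'(1) S' biproduct_eqs_comp[OF S] by (simp_all add: distrib)
  then show "\<exists>h \<in> Hom C D (Src C ?i). ?i \<^bold>\<circ> h = g"
    using biproduct_map_comp_eq_iff[OF S U hom(1,2) _ g] h(2) h'(2) i
    by (intro bexI[of _ "i\<^sub>1 \<^bold>\<circ> h \<^bold>+ i\<^sub>2 \<^bold>\<circ> h'"]) auto
qed

end


section \<open>Pushouts\<close>

definition is_pushout :: "('o, 'm) cat \<Rightarrow> 'm \<Rightarrow> 'm \<Rightarrow> 'm \<Rightarrow> 'm \<Rightarrow> bool" where
  "is_pushout C f g f' g' \<longleftrightarrow> f \<in> Arr C \<and> g \<in> Arr C \<and> Src C f = Src C g \<and>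
     f' \<in> Hom C (Tgt C f) (Tgt C f') \<and> g' \<in> Hom C (Tgt C g) (Tgt C f') \<and> f' \<^bold>\<circ>\<^bsub>C\<^esub> f = g' \<^bold>\<circ>\<^bsub>C\<^esub> g \<and>
     (\<forall>D. \<forall>u \<in> Hom C (Tgt C f) D. \<forall>v \<in> Hom C (Tgt C g) D. u \<^bold>\<circ>\<^bsub>C\<^esub> f = v \<^bold>\<circ>\<^bsub>C\<^esub> g \<longrightarrow>
        (\<exists>!h. h \<in> Hom C (Tgt C f') D \<and> h \<^bold>\<circ>\<^bsub>C\<^esub> f' = u \<and> h \<^bold>\<circ>\<^bsub>C\<^esub> g' = v))"

lemma is_pushoutD:
  assumes "is_pushout C f g f' g'"
  shows "f' \<in> Hom C (Tgt C f) (Tgt C f')" "g' \<in> Hom C (Tgt C g) (Tgt C f')"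
    "f' \<^bold>\<circ>\<^bsub>C\<^esub> f = g' \<^bold>\<circ>\<^bsub>C\<^esub> g"
  using assms unfolding is_pushout_def by blast+

lemma pushout_desc:
  assumes "is_pushout C f g f' g'" "u \<in> Hom C (Tgt C f) D" "v \<in> Hom C (Tgt C g) D"
    "u \<^bold>\<circ>\<^bsub>C\<^esub> f = v \<^bold>\<circ>\<^bsub>C\<^esub> g"
  obtains h where "h \<in> Hom C (Tgt C f') D" "h \<^bold>\<circ>\<^bsub>C\<^esub> f' = u" "h \<^bold>\<circ>\<^bsub>C\<^esub> g' = v"
  using assms unfolding is_pushout_def by blast

lemma (in category) pushout_eqI:
  assumes "is_pushout C f g f' g'" "h \<in> Hom C (Tgt C f') D" "k \<in> Hom C (Tgt C f') D"
    "h \<^bold>\<circ> f' = k \<^bold>\<circ> f'" "h \<^bold>\<circ> g' = k \<^bold>\<circ> g'"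
  shows "h = k"
proof -
  have fg: "f \<in> Arr C" "g \<in> Arr C" using assms(1) by (simp_all add: is_pushout_def)
  note square = is_pushoutD[OF assms(1)]
  have "(h \<^bold>\<circ> f') \<^bold>\<circ> f = (h \<^bold>\<circ> g') \<^bold>\<circ> g" using square assms(2) fg by simp
  moreover have "h \<^bold>\<circ> f' \<in> Hom C (Tgt C f) D" "h \<^bold>\<circ> g' \<in> Hom C (Tgt C g) D"
    using square assms(2) by simp_all
  ultimately have "\<exists>!l. l \<in> Hom C (Tgt C f') D \<and> l \<^bold>\<circ> f' = h \<^bold>\<circ> f' \<and> l \<^bold>\<circ> g' = h \<^bold>\<circ> g'"
    using assms(1) unfolding is_pushout_def by blast
  then show ?thesis using assms(2-5) by metis
qed

context preadditive_category begin

lemma cokernel_is_pushout: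
  assumes S: "is_biproduct C B D S j\<^sub>1 j\<^sub>2 r\<^sub>1 r\<^sub>2" and f: "f \<in> Hom C A B" and g: "g \<in> Hom C A D"
    and c: "is_cokernel C c (j\<^sub>1 \<^bold>\<circ> f \<^bold>+ neg (j\<^sub>2 \<^bold>\<circ> g))"
  shows "is_pushout C f g (c \<^bold>\<circ> j\<^sub>1) (c \<^bold>\<circ> j\<^sub>2)"
proof -
  note S' = biproduct_typing[OF S] biproduct_eqs[OF S] and comp = biproduct_eqs_comp[OF S]
  have c': "c \<in> Hom C S (Tgt C c)" using is_cokernelD(2)[OF c] S' f g by simp
  have "c \<^bold>\<circ> j\<^sub>1 \<^bold>\<circ> f \<^bold>+ neg (c \<^bold>\<circ> j\<^sub>2 \<^bold>\<circ> g) = Zero C A (Tgt C c)"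
    using is_cokernelD(3)[OF c] S' c' f g by (simp add: distrib)
  then have square: "c \<^bold>\<circ> j\<^sub>1 \<^bold>\<circ> f = c \<^bold>\<circ> j\<^sub>2 \<^bold>\<circ> g"
    using minus_eq_zero_iff[of "c \<^bold>\<circ> j\<^sub>1 \<^bold>\<circ> f" "c \<^bold>\<circ> j\<^sub>2 \<^bold>\<circ> g"] S' c' f g by simp
  have ex: "\<exists>h \<in> Hom C (Tgt C c) E. h \<^bold>\<circ> c \<^bold>\<circ> j\<^sub>1 = u \<and> h \<^bold>\<circ> c \<^bold>\<circ> j\<^sub>2 = v"
    if u: "u \<in> Hom C B E" and v: "v \<in> Hom C D E" and eq: "u \<^bold>\<circ> f = v \<^bold>\<circ> g" for u v E
  proof -
    have w: "u \<^bold>\<circ> r\<^sub>1 \<^bold>+ v \<^bold>\<circ> r\<^sub>2 \<in> Hom C S E" using u v S' by simp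
    have "(u \<^bold>\<circ> r\<^sub>1 \<^bold>+ v \<^bold>\<circ> r\<^sub>2) \<^bold>\<circ> (j\<^sub>1 \<^bold>\<circ> f \<^bold>+ neg (j\<^sub>2 \<^bold>\<circ> g)) = Zero C A E"
      using u v f g S' comp eq Hom_objs(2)[OF u] Hom_objs(1)[OF f] by (simp add: distrib)
    then obtain h where h: "h \<in> Hom C (Tgt C c) E" "h \<^bold>\<circ> c = u \<^bold>\<circ> r\<^sub>1 \<^bold>+ v \<^bold>\<circ> r\<^sub>2"
      using cokernel_desc[OF c, of "u \<^bold>\<circ> r\<^sub>1 \<^bold>+ v \<^bold>\<circ> r\<^sub>2" E] w f g S' by auto
    have "h \<^bold>\<circ> c \<^bold>\<circ> j\<^sub>1 = u" "h \<^bold>\<circ> c \<^bold>\<circ> j\<^sub>2 = v"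
      using comp_eq_precomp[OF h(2), of j\<^sub>1] comp_eq_precomp[OF h(2), of j\<^sub>2] h(1) u v c' S'
        Hom_objs(2)[OF u]
      by (simp_all add: distrib)
    with h(1) show ?thesis by blast
  qed
  have unique: "h = k" if h: "h \<in> Hom C (Tgt C c) E" and k: "k \<in> Hom C (Tgt C c) E"
    and eq: "h \<^bold>\<circ> c \<^bold>\<circ> j\<^sub>1 = k \<^bold>\<circ> c \<^bold>\<circ> j\<^sub>1" "h \<^bold>\<circ> c \<^bold>\<circ> j\<^sub>2 = k \<^bold>\<circ> c \<^bold>\<circ> j\<^sub>2" for h k E
  proof (rule epi_cancel[OF cokernel_is_epi[OF c] _ h k])
    show "h \<^bold>\<circ> c = k \<^bold>\<circ> c"
      by (rule biproduct_eqI_inj[OF S]) (use h k c' S' eq in simp_all)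
  qed
  have universal: "\<exists>!h. h \<in> Hom C (Tgt C c) E \<and> h \<^bold>\<circ> c \<^bold>\<circ> j\<^sub>1 = u \<and> h \<^bold>\<circ> c \<^bold>\<circ> j\<^sub>2 = v"
    if "u \<in> Hom C B E" "v \<in> Hom C D E" "u \<^bold>\<circ> f = v \<^bold>\<circ> g" for u v E
    using ex[OF that] unique[of _ E] by (intro ex_ex1I) auto
  have tgts: "Tgt C f = B" "Tgt C g = D" "Tgt C (c \<^bold>\<circ> j\<^sub>1) = Tgt C c" using f g c' S' by simp_all
  show ?thesis
    unfolding is_pushout_def tgts
    by (intro conjI allI ballI impI universal) (use f g c' S' square in simp_all)
qed

lemma antidiagonal_mono:
  assumes S: "is_biproduct C B D S j\<^sub>1 j\<^sub>2 r\<^sub>1 r\<^sub>2" and f: "f \<in> Hom C A B" and g: "g \<in> Hom C A D"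
    and mono: "is_mono C f"
  shows "is_mono C (j\<^sub>1 \<^bold>\<circ> f \<^bold>+ neg (j\<^sub>2 \<^bold>\<circ> g))" (is "is_mono C ?m")
proof (rule monoI)
  note S' = biproduct_typing[OF S]
  show m: "?m \<in> Hom C A S" using S' f g by simp
  have proj: "r\<^sub>1 \<^bold>\<circ> ?m = f"
    using S' f g biproduct_eqs_comp[OF S] Hom_objs[OF f] by (simp add: distrib)
  fix h E assume h: "h \<in> Hom C E A" and "?m \<^bold>\<circ> h = Zero C E S"
  then have "f \<^bold>\<circ> h = Zero C E B"
    using comp_eq_precomp[OF proj, of h] m S' Hom_objs[OF h] by simp
  then show "h = Zero C E A" using mono_cancel_zero[OF mono, of h E] h f by simp
qed

end

context abelian_category begin

lemma ex_pushout:
  assumes f: "f \<in> Hom C A B" and g: "g \<in> Hom C A D"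
  shows "\<exists>f' g'. is_pushout C f g f' g'"
proof -
  obtain S j\<^sub>1 j\<^sub>2 r\<^sub>1 r\<^sub>2 where S: "is_biproduct C B D S j\<^sub>1 j\<^sub>2 r\<^sub>1 r\<^sub>2"
    using ex_biproduct Hom_objs[OF f] Hom_objs[OF g] by blast
  then have "j\<^sub>1 \<^bold>\<circ> f \<^bold>+ neg (j\<^sub>2 \<^bold>\<circ> g) \<in> Arr C" using biproduct_typing[OF S] f g by simp
  then obtain c where "is_cokernel C c (j\<^sub>1 \<^bold>\<circ> f \<^bold>+ neg (j\<^sub>2 \<^bold>\<circ> g))" using ex_cokernel by blast
  with cokernel_is_pushout[OF S f g] show ?thesis by blast
qed

lemma pushout_of_mono:
  assumes pushout: "is_pushout C f g f' g'" and mono: "is_mono C f"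
  shows "is_mono C g'"
proof -
  define A B D where "A = Src C f" and "B = Tgt C f" and "D = Tgt C g"
  have f: "f \<in> Hom C A B" and g: "g \<in> Hom C A D"
    using pushout by (auto simp: is_pushout_def A_def B_def D_def)
  note square = is_pushoutD[OF pushout, folded B_def D_def]
  obtain S j\<^sub>1 j\<^sub>2 r\<^sub>1 r\<^sub>2 where S: "is_biproduct C B D S j\<^sub>1 j\<^sub>2 r\<^sub>1 r\<^sub>2"
    using ex_biproduct Hom_objs[OF f] Hom_objs[OF g] by blast
  note S' = biproduct_typing[OF S] and comp = biproduct_eqs_comp[OF S]
  let ?m = "j\<^sub>1 \<^bold>\<circ> f \<^bold>+ neg (j\<^sub>2 \<^bold>\<circ> g)"
  have m: "?m \<in> Hom C A S" using S' f g by simp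
  then obtain c where coker: "is_cokernel C c ?m" using ex_cokernel by auto
  have c: "c \<in> Hom C S (Tgt C c)" using is_cokernelD(2)[OF coker] m by simp
  have ker: "is_kernel C ?m c"
    using mono_kernel_of_cokernel[OF antidiagonal_mono[OF S f g mono] coker] .
  obtain t where t: "t \<in> Hom C (Tgt C f') (Tgt C c)" "t \<^bold>\<circ> g' = c \<^bold>\<circ> j\<^sub>2"
    using pushout_desc[OF pushout, of "c \<^bold>\<circ> j\<^sub>1" "Tgt C c" "c \<^bold>\<circ> j\<^sub>2"]
      is_pushoutD(3)[OF cokernel_is_pushout[OF S f g coker]] c S' f g by auto
  show ?thesis
  proof (rule monoI[OF square(2)])
    fix h E assume h: "h \<in> Hom C E D" and zero: "g' \<^bold>\<circ> h = Zero C E (Tgt C f')"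
    note objs = Hom_objs[OF h]
    have "c \<^bold>\<circ> j\<^sub>2 \<^bold>\<circ> h = t \<^bold>\<circ> g' \<^bold>\<circ> h"
      using comp_eq_precomp[OF t(2), of h] t(1) square(2) h c S' by simp
    also have "\<dots> = Zero C E (Tgt C c)" unfolding zero using t(1) objs by simp
    finally obtain k where k: "k \<in> Hom C E A" "?m \<^bold>\<circ> k = j\<^sub>2 \<^bold>\<circ> h"
      using kernel_lift[OF ker, of "j\<^sub>2 \<^bold>\<circ> h" E] h c S' m by auto
    have "f \<^bold>\<circ> k = r\<^sub>1 \<^bold>\<circ> ?m \<^bold>\<circ> k" using k(1) f g S' comp objs by (simp add: distrib)
    also have "\<dots> = Zero C E B" unfolding k(2) using h S' comp by simp
    finally have "k = Zero C E A" using mono_cancel_zero[OF mono, of k E] k(1) f by simp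
    then have "j\<^sub>2 \<^bold>\<circ> h = Zero C E S" using k(2) m objs S' by simp
    then have "r\<^sub>2 \<^bold>\<circ> j\<^sub>2 \<^bold>\<circ> h = Zero C E D" using S' objs by simp
    then show "h = Zero C E D" using comp h by simp
  qed
qed

lemma is_pushoutI:
  assumes f: "f \<in> Hom C A B" and g: "g \<in> Hom C A D" and f': "f' \<in> Hom C B T"
    and g': "g' \<in> Hom C D T"
    and mono: "is_mono C f" and square: "f' \<^bold>\<circ> f = g' \<^bold>\<circ> g"
    and jointly_epi: "\<And>t E. t \<in> Hom C T E \<Longrightarrow> t \<^bold>\<circ> f' = Zero C B E \<Longrightarrow> t \<^bold>\<circ> g' = Zero C D E \<Longrightarrow>
      t = Zero C T E"
    and lift: "\<And>u v E. u \<in> Hom C E B \<Longrightarrow> v \<in> Hom C E D \<Longrightarrow> f' \<^bold>\<circ> u = g' \<^bold>\<circ> v \<Longrightarrow>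
      \<exists>h \<in> Hom C E A. f \<^bold>\<circ> h = u \<and> g \<^bold>\<circ> h = v"
  shows "is_pushout C f g f' g'"
proof -
  obtain S j\<^sub>1 j\<^sub>2 r\<^sub>1 r\<^sub>2 where S: "is_biproduct C B D S j\<^sub>1 j\<^sub>2 r\<^sub>1 r\<^sub>2"
    using ex_biproduct Hom_objs[OF f] Hom_objs[OF g] by blast
  note S' = biproduct_typing[OF S] and comp = biproduct_eqs_comp[OF S]
  let ?m = "j\<^sub>1 \<^bold>\<circ> f \<^bold>+ neg (j\<^sub>2 \<^bold>\<circ> g)" and ?c = "f' \<^bold>\<circ> r\<^sub>1 \<^bold>+ g' \<^bold>\<circ> r\<^sub>2"
  note objs = Hom_objs[OF f] Hom_objs[OF g] Hom_objs[OF f']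
  have m: "?m \<in> Hom C A S" and c: "?c \<in> Hom C S T" using S' f g f' g' by simp_all
  have cj: "?c \<^bold>\<circ> j\<^sub>1 = f'" "?c \<^bold>\<circ> j\<^sub>2 = g'"
    using S' biproduct_eqs[OF S] f' g' objs by (simp_all add: distrib)
  have "is_epi C ?c"
  proof (rule epiI[OF c])
    fix t E assume t: "t \<in> Hom C T E" and zero: "t \<^bold>\<circ> ?c = Zero C S E"
    have "t \<^bold>\<circ> f' = (t \<^bold>\<circ> ?c) \<^bold>\<circ> j\<^sub>1" "t \<^bold>\<circ> g' = (t \<^bold>\<circ> ?c) \<^bold>\<circ> j\<^sub>2"
      using t c S' f' g' cj comp_reassoc[of j\<^sub>1 ?c t] comp_reassoc[of j\<^sub>2 ?c t] by auto
    then show "t = Zero C T E" unfolding zero using jointly_epi[OF t] S' Hom_objs[OF t] by simp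
  qed
  moreover have "is_kernel C ?m ?c"
  proof (rule is_kernelI[OF antidiagonal_mono[OF S f g mono]])
    show "?c \<in> Arr C" "Tgt C ?m = Src C ?c" using m c by simp_all
    show "?c \<^bold>\<circ> ?m = Zero C (Src C ?m) (Tgt C ?c)"
      using f g f' g' S' comp square objs by (simp add: distrib)
    fix w E assume "w \<in> Hom C E (Src C ?c)" "?c \<^bold>\<circ> w = Zero C E (Tgt C ?c)"
    then have w: "w \<in> Hom C E S" and zero: "f' \<^bold>\<circ> r\<^sub>1 \<^bold>\<circ> w \<^bold>+ g' \<^bold>\<circ> r\<^sub>2 \<^bold>\<circ> w = Zero C E T"
      using c f' g' S' by (simp_all add: distrib)
    then have "f' \<^bold>\<circ> r\<^sub>1 \<^bold>\<circ> w = neg (g' \<^bold>\<circ> r\<^sub>2 \<^bold>\<circ> w)"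
      using neg_unique[of "g' \<^bold>\<circ> r\<^sub>2 \<^bold>\<circ> w" "f' \<^bold>\<circ> r\<^sub>1 \<^bold>\<circ> w"]
        plus_comm[of "f' \<^bold>\<circ> r\<^sub>1 \<^bold>\<circ> w" "g' \<^bold>\<circ> r\<^sub>2 \<^bold>\<circ> w"] f' g' S' by simp
    then obtain h where h: "h \<in> Hom C E A" "f \<^bold>\<circ> h = r\<^sub>1 \<^bold>\<circ> w" "g \<^bold>\<circ> h = neg (r\<^sub>2 \<^bold>\<circ> w)"
      using lift[of "r\<^sub>1 \<^bold>\<circ> w" E "neg (r\<^sub>2 \<^bold>\<circ> w)"] w S' g' by auto
    have "?m \<^bold>\<circ> h = w" using h w f g S' comp by (simp add: distrib)
    with h m show "\<exists>h \<in> Hom C E (Src C ?m). ?m \<^bold>\<circ> h = w" by auto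
  qed
  ultimately have "is_cokernel C ?c ?m" by (rule epi_cokernel_of_kernel)
  from cokernel_is_pushout[OF S f g this] show ?thesis unfolding cj .
qed

end


section \<open>Morphisms of extensions\<close>

definition middle :: "('o, 'm) cat \<Rightarrow> 'm \<times> 'm \<Rightarrow> 'o" where
  "middle C x = Src C (snd x)"

text \<open>For extensions \<open>x\<close> and \<open>y\<close>, this relation expresses \<open>b\<^sub>*x = a\<^sup>*y\<close>.\<close>

definition ext_map :: "('o, 'm) cat \<Rightarrow> 'm \<times> 'm \<Rightarrow> 'm \<times> 'm \<Rightarrow> 'm \<Rightarrow> 'm \<Rightarrow> bool" where
  "ext_map C x y b a \<longleftrightarrow> (\<exists>e. extension_morphism C x y b e a)"

context abelian_category begin

lemma extensionsI:
  assumes "is_kernel C i p" "is_cokernel C p i" "Src C i = B" "Tgt C p = A"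
  shows "(i, p) \<in> extensions C A B"
  using assms by (simp add: extensions_def short_exact_def)

lemma extensions_exact:
  assumes "x \<in> extensions C A B"
  shows "is_kernel C (fst x) (snd x)" "is_cokernel C (snd x) (fst x)"
    "is_mono C (fst x)" "is_epi C (snd x)" "snd x \<^bold>\<circ> fst x = Zero C B A"
proof -
  show ker: "is_kernel C (fst x) (snd x)" and coker: "is_cokernel C (snd x) (fst x)"
    using assms by (auto simp: extensions_def short_exact_def)
  show "is_mono C (fst x)" "is_epi C (snd x)" using ker coker kernel_is_mono cokernel_is_epi by auto
  show "snd x \<^bold>\<circ> fst x = Zero C B A" using is_kernelD(3)[OF ker] assms by (simp add: extensions_def)
qed

lemma extensions_typing:
  assumes "x \<in> extensions C A B"
  shows "fst x \<in> Hom C B (middle C x)" "snd x \<in> Hom C (middle C x) A"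
    "A \<in> Obj C" "B \<in> Obj C" "middle C x \<in> Obj C"
proof -
  show i: "fst x \<in> Hom C B (middle C x)" and p: "snd x \<in> Hom C (middle C x) A"
    using is_kernelD[OF extensions_exact(1)[OF assms]] assms
    by (auto simp: extensions_def middle_def)
  show "A \<in> Obj C" "B \<in> Obj C" "middle C x \<in> Obj C" using Hom_objs[OF i] Hom_objs[OF p] by simp_all
qed

lemma extension_lift:
  assumes "x \<in> extensions C A B" "g \<in> Hom C D (middle C x)" "snd x \<^bold>\<circ> g = Zero C D A"
  obtains h where "h \<in> Hom C D B" "fst x \<^bold>\<circ> h = g"
  using kernel_lift[OF extensions_exact(1)[OF assms(1)], of g D] extensions_typing[OF assms(1)]
    assms(2,3)
  by auto

lemma extension_desc:
  assumes "x \<in> extensions C A B" "g \<in> Hom C (middle C x) D" "g \<^bold>\<circ> fst x = Zero C B D"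
  obtains h where "h \<in> Hom C A D" "h \<^bold>\<circ> snd x = g"
  using cokernel_desc[OF extensions_exact(2)[OF assms(1)], of g D] extensions_typing[OF assms(1)]
    assms(2,3)
  by auto

lemma extension_mono_cancel:
  assumes "x \<in> extensions C A B" "fst x \<^bold>\<circ> g = fst x \<^bold>\<circ> h" "g \<in> Hom C D B" "h \<in> Hom C D B"
  shows "g = h"
  using mono_cancel[OF extensions_exact(3)[OF assms(1)] assms(2)] extensions_typing[OF assms(1)]
    assms(3,4)
  by simp

lemma extension_epi_cancel:
  assumes "x \<in> extensions C A B" "g \<^bold>\<circ> snd x = h \<^bold>\<circ> snd x" "g \<in> Hom C A D" "h \<in> Hom C A D"
  shows "g = h"
  using epi_cancel[OF extensions_exact(4)[OF assms(1)] assms(2)] extensions_typing[OF assms(1)]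
    assms(3,4)
  by simp

lemma ext_map_iff:
  assumes "x \<in> extensions C A B" "y \<in> extensions C A' B'"
  shows "ext_map C x y b a \<longleftrightarrow> b \<in> Hom C B B' \<and> a \<in> Hom C A A' \<and>
    (\<exists>e \<in> Hom C (middle C x) (middle C y). e \<^bold>\<circ> fst x = fst y \<^bold>\<circ> b \<and> snd y \<^bold>\<circ> e = a \<^bold>\<circ> snd x)"
  using extensions_typing[OF assms(1)] extensions_typing[OF assms(2)]
  by (auto simp: ext_map_def extension_morphism_def)

lemma ext_mapE:
  assumes "ext_map C x y b a" "x \<in> extensions C A B" "y \<in> extensions C A' B'"
  obtains e where "b \<in> Hom C B B'" "a \<in> Hom C A A'" "e \<in> Hom C (middle C x) (middle C y)"
    "e \<^bold>\<circ> fst x = fst y \<^bold>\<circ> b" "snd y \<^bold>\<circ> e = a \<^bold>\<circ> snd x"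
  using assms(1) unfolding ext_map_iff[OF assms(2,3)] by blast

lemma ext_map_Hom:
  assumes "ext_map C x y b a" "x \<in> extensions C A B" "y \<in> extensions C A' B'"
  shows "b \<in> Hom C B B'" "a \<in> Hom C A A'"
  using assms(1) unfolding ext_map_iff[OF assms(2,3)] by blast+

lemma ext_map_ident:
  assumes "x \<in> extensions C A B"
  shows "ext_map C x x (Ident C B) (Ident C A)"
  unfolding ext_map_iff[OF assms assms]
  using extensions_typing[OF assms] by (auto intro!: bexI[of _ "Ident C (middle C x)"])

lemma ext_map_comp:
  assumes x: "x \<in> extensions C A B" and y: "y \<in> extensions C A' B'"
    and z: "z \<in> extensions C A'' B''"
    and "ext_map C x y b a" "ext_map C y z b' a'"
  shows "ext_map C x z (b' \<^bold>\<circ> b) (a' \<^bold>\<circ> a)"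
proof -
  note typing = extensions_typing[OF x] extensions_typing[OF y] extensions_typing[OF z]
  obtain e where e: "b \<in> Hom C B B'" "a \<in> Hom C A A'" "e \<in> Hom C (middle C x) (middle C y)"
    "e \<^bold>\<circ> fst x = fst y \<^bold>\<circ> b" "snd y \<^bold>\<circ> e = a \<^bold>\<circ> snd x"
    using assms(4) x y by (rule ext_mapE)
  obtain e' where e': "b' \<in> Hom C B' B''" "a' \<in> Hom C A' A''" "e' \<in> Hom C (middle C y) (middle C z)"
    "e' \<^bold>\<circ> fst y = fst z \<^bold>\<circ> b'" "snd z \<^bold>\<circ> e' = a' \<^bold>\<circ> snd y"
    using assms(5) y z by (rule ext_mapE)
  have "(e' \<^bold>\<circ> e) \<^bold>\<circ> fst x = fst z \<^bold>\<circ> b' \<^bold>\<circ> b"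
    using e e'(1-3) comp_eq_precomp[OF e'(4), of b] typing by simp
  moreover have "snd z \<^bold>\<circ> e' \<^bold>\<circ> e = (a' \<^bold>\<circ> a) \<^bold>\<circ> snd x"
    using e e'(1-3) comp_eq_precomp[OF e'(5), of e] typing by simp
  ultimately show ?thesis
    unfolding ext_map_iff[OF x z] using e(1-3) e'(1-3) by (auto intro!: bexI[of _ "e' \<^bold>\<circ> e"])
qed

lemma ext_map_plus:
  assumes x: "x \<in> extensions C A B" and y: "y \<in> extensions C A' B'"
    and "ext_map C x y b a" "ext_map C x y b' a'"
  shows "ext_map C x y (b \<^bold>+ b') (a \<^bold>+ a')"
proof -
  note typing = extensions_typing[OF x] extensions_typing[OF y]
  obtain e where e: "b \<in> Hom C B B'" "a \<in> Hom C A A'" "e \<in> Hom C (middle C x) (middle C y)"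
    "e \<^bold>\<circ> fst x = fst y \<^bold>\<circ> b" "snd y \<^bold>\<circ> e = a \<^bold>\<circ> snd x"
    using assms(3) x y by (rule ext_mapE)
  obtain e' where e': "b' \<in> Hom C B B'" "a' \<in> Hom C A A'" "e' \<in> Hom C (middle C x) (middle C y)"
    "e' \<^bold>\<circ> fst x = fst y \<^bold>\<circ> b'" "snd y \<^bold>\<circ> e' = a' \<^bold>\<circ> snd x"
    using assms(4) x y by (rule ext_mapE)
  show ?thesis
    unfolding ext_map_iff[OF x y]
    using e e' typing by (auto simp: distrib intro!: bexI[of _ "e \<^bold>+ e'"])
qed

lemma extension_of_pushout:
  assumes x: "x \<in> extensions C A B" and b: "b \<in> Hom C B B'"
    and pushout: "is_pushout C (fst x) b e i"
  obtains p where "(i, p) \<in> extensions C A B'" "p \<in> Hom C (Tgt C e) A" "p \<^bold>\<circ> e = snd x"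
proof -
  note typing = extensions_typing[OF x]
  have square: "e \<in> Hom C (middle C x) (Tgt C e)" "i \<in> Hom C B' (Tgt C e)" "e \<^bold>\<circ> fst x = i \<^bold>\<circ> b"
    using is_pushoutD[OF pushout] typing b by auto
  note objs = Hom_objs[OF b] Hom_objs[OF square(1)]
  have "snd x \<^bold>\<circ> fst x = Zero C B' A \<^bold>\<circ> b" using extensions_exact(5)[OF x] b typing by simp
  then obtain p where p: "p \<in> Hom C (Tgt C e) A" "p \<^bold>\<circ> e = snd x" "p \<^bold>\<circ> i = Zero C B' A"
    using pushout_desc[OF pushout, of "snd x" A "Zero C B' A"] typing b objs by auto
  have epi: "is_epi C p"
  proof (rule epiI[OF p(1)])
    fix g D assume g: "g \<in> Hom C A D" and zero: "g \<^bold>\<circ> p = Zero C (Tgt C e) D"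
    have "g \<^bold>\<circ> snd x = (g \<^bold>\<circ> p) \<^bold>\<circ> e" using g p square by simp
    also have "\<dots> = Zero C A D \<^bold>\<circ> snd x" unfolding zero using square typing Hom_objs[OF g] by simp
    finally show "g = Zero C A D" using extension_epi_cancel[OF x _ g] typing Hom_objs[OF g] by simp
  qed
  have coker: "is_cokernel C p i"
  proof (rule is_cokernelI[OF epi])
    fix g D assume "g \<in> Hom C (Tgt C i) D" and zero: "g \<^bold>\<circ> i = Zero C (Src C i) D"
    then have g: "g \<in> Hom C (Tgt C e) D" using square by simp
    have "(g \<^bold>\<circ> e) \<^bold>\<circ> fst x = (g \<^bold>\<circ> i) \<^bold>\<circ> b" using g square typing b by simp
    also have "\<dots> = Zero C B D" unfolding zero using square b Hom_objs[OF g] by simp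
    finally obtain h where h: "h \<in> Hom C A D" "h \<^bold>\<circ> snd x = g \<^bold>\<circ> e"
      using extension_desc[OF x, of "g \<^bold>\<circ> e" D] g square by auto
    have "h \<^bold>\<circ> p = g"
      by (rule pushout_eqI[OF pushout]) (use h p g zero square objs Hom_objs[OF g] in simp_all)
    with h p show "\<exists>h \<in> Hom C (Tgt C p) D. h \<^bold>\<circ> p = g" by auto
  qed (use p square in simp_all)
  have "is_mono C i" by (rule pushout_of_mono[OF pushout extensions_exact(3)[OF x]])
  then have "(i, p) \<in> extensions C A B'"
    using mono_kernel_of_cokernel[OF _ coker] coker p square by (intro extensionsI) simp_all
  then show thesis using p(1,2) by (rule that)
qed

lemma ex_ext_map_push:
  assumes x: "x \<in> extensions C A B" and b: "b \<in> Hom C B B'"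
  shows "\<exists>y \<in> extensions C A B'. ext_map C x y b (Ident C A)"
proof -
  note typing = extensions_typing[OF x]
  obtain e i where pushout: "is_pushout C (fst x) b e i" using ex_pushout[OF typing(1) b] by blast
  obtain p where y: "(i, p) \<in> extensions C A B'" and p: "p \<in> Hom C (Tgt C e) A" "p \<^bold>\<circ> e = snd x"
    using extension_of_pushout[OF x b pushout] .
  have "e \<in> Hom C (middle C x) (middle C (i, p))" "e \<^bold>\<circ> fst x = i \<^bold>\<circ> b"
    using is_pushoutD[OF pushout] typing b p(1) by (auto simp: middle_def)
  then have "ext_map C x (i, p) b (Ident C A)"
    unfolding ext_map_iff[OF x y] using b p typing by auto
  with y show ?thesis by blast
qed

lemma ext_map_push_is_pushout:
  assumes x: "x \<in> extensions C A B" and y: "y \<in> extensions C A B'" and b: "b \<in> Hom C B B'"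
    and e: "e \<in> Hom C (middle C x) (middle C y)" "e \<^bold>\<circ> fst x = fst y \<^bold>\<circ> b" "snd y \<^bold>\<circ> e = snd x"
  shows "is_pushout C (fst x) b e (fst y)"
proof (rule is_pushoutI[OF extensions_typing(1)[OF x] b e(1) extensions_typing(1)[OF y]
      extensions_exact(3)[OF x] e(2)])
  note x' = extensions_typing[OF x] and y' = extensions_typing[OF y]
  fix t D assume t: "t \<in> Hom C (middle C y) D" and te: "t \<^bold>\<circ> e = Zero C (middle C x) D"
    and ti: "t \<^bold>\<circ> fst y = Zero C B' D"
  obtain s where s: "s \<in> Hom C A D" "s \<^bold>\<circ> snd y = t" using extension_desc[OF y t ti] .
  have "s \<^bold>\<circ> snd x = t \<^bold>\<circ> e" using comp_eq_precomp[OF s(2), of e] s(1) e y' by simp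
  then have "s = Zero C A D" 
    using extension_epi_cancel[OF x, of s "Zero C A D" D] te s(1) x' Hom_objs[OF t] by simp
  then show "t = Zero C (middle C y) D" using s(2) y' Hom_objs[OF t] by simp
next
  note x' = extensions_typing[OF x] and y' = extensions_typing[OF y]
  fix u v D assume u: "u \<in> Hom C D (middle C x)" and v: "v \<in> Hom C D B'"
    and eq: "e \<^bold>\<circ> u = fst y \<^bold>\<circ> v"
  have "snd x \<^bold>\<circ> u = snd y \<^bold>\<circ> e \<^bold>\<circ> u" using comp_eq_precomp[OF e(3), of u] e(1) u y' by simp
  also have "\<dots> = Zero C D A"
    unfolding eq using comp_eq_precomp[OF extensions_exact(5)[OF y], of v] v y' by simp
  finally obtain h where h: "h \<in> Hom C D B" "fst x \<^bold>\<circ> h = u" by (rule extension_lift[OF x u])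
  have "fst y \<^bold>\<circ> b \<^bold>\<circ> h = fst y \<^bold>\<circ> v"
    unfolding eq[symmetric] h(2)[symmetric]
    using comp_eq_precomp[OF e(2), of h] e(1) h(1) b x' y' by simp
  then have "b \<^bold>\<circ> h = v" using extension_mono_cancel[OF y, of "b \<^bold>\<circ> h" v D] h(1) b v by simp
  with h show "\<exists>h \<in> Hom C D B. fst x \<^bold>\<circ> h = u \<and> b \<^bold>\<circ> h = v" by blast
qed

lemma ext_map_push_factor:
  assumes x: "x \<in> extensions C A B" and y: "y \<in> extensions C A B'" and z: "z \<in> extensions C A' B''"
    and xy: "ext_map C x y b (Ident C A)" and xz: "ext_map C x z (b' \<^bold>\<circ> b) a"
    and b': "b' \<in> Hom C B' B''"
  shows "ext_map C y z b' a"
proof -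
  note x' = extensions_typing[OF x] and y' = extensions_typing[OF y]
    and z' = extensions_typing[OF z]
  obtain e where b: "b \<in> Hom C B B'" and e: "e \<in> Hom C (middle C x) (middle C y)"
    "e \<^bold>\<circ> fst x = fst y \<^bold>\<circ> b" "snd y \<^bold>\<circ> e = snd x"
    using ext_mapE[OF xy x y] x' by auto
  obtain f where a: "a \<in> Hom C A A'" and f: "f \<in> Hom C (middle C x) (middle C z)"
    "f \<^bold>\<circ> fst x = fst z \<^bold>\<circ> b' \<^bold>\<circ> b" "snd z \<^bold>\<circ> f = a \<^bold>\<circ> snd x"
    using ext_mapE[OF xz x z] by blast
  note pushout = ext_map_push_is_pushout[OF x y b e]
  obtain h where h: "h \<in> Hom C (middle C y) (middle C z)" "h \<^bold>\<circ> e = f" "h \<^bold>\<circ> fst y = fst z \<^bold>\<circ> b'"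
    using pushout_desc[OF pushout, of f "middle C z" "fst z \<^bold>\<circ> b'"] f b b' e(1) x' z' by auto
  have "snd z \<^bold>\<circ> h = a \<^bold>\<circ> snd y"
  proof (rule pushout_eqI[OF pushout])
    show "snd z \<^bold>\<circ> h \<in> Hom C (Tgt C e) A'" "a \<^bold>\<circ> snd y \<in> Hom C (Tgt C e) A'"
      using e(1) h(1) a y' z' by simp_all
    show "(snd z \<^bold>\<circ> h) \<^bold>\<circ> e = (a \<^bold>\<circ> snd y) \<^bold>\<circ> e" using h e f a y' z' by simp
    show "(snd z \<^bold>\<circ> h) \<^bold>\<circ> fst y = (a \<^bold>\<circ> snd y) \<^bold>\<circ> fst y"
      using h a b' y' z' extensions_exact(5)[OF y]
        comp_eq_precomp[OF extensions_exact(5)[OF z], of b']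
      by simp
  qed
  then show ?thesis unfolding ext_map_iff[OF y z] using a b' h(1,3) by blast
qed

lemma ext_map_sym:
  assumes x: "x \<in> extensions C A B" and y: "y \<in> extensions C A B"
    and xy: "ext_map C x y (Ident C B) (Ident C A)"
  shows "ext_map C y x (Ident C B) (Ident C A)"
  using ext_map_push_factor[OF x y x xy, of "Ident C B" "Ident C A"] ext_map_ident[OF x]
    extensions_typing[OF x]
  by simp

lemma extensions_op [simp]: "x \<in> extensions (op_cat C) B A \<longleftrightarrow> prod.swap x \<in> extensions C A B"
  by (auto simp: extensions_def short_exact_def)

lemma ext_map_op:
  assumes "prod.swap x \<in> extensions C A B" "prod.swap y \<in> extensions C A' B'"
  shows "ext_map (op_cat C) x y a b \<longleftrightarrow> ext_map C (prod.swap y) (prod.swap x) b a"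
  using extensions_typing[OF assms(1)] extensions_typing[OF assms(2)]
  by (auto simp: ext_map_def extension_morphism_def)

lemma ex_ext_map_pull:
  assumes x: "x \<in> extensions C A B" and a: "a \<in> Hom C A' A"
  shows "\<exists>y \<in> extensions C A' B. ext_map C y x (Ident C B) a"
proof -
  obtain y where y: "prod.swap y \<in> extensions C A' B"
    "ext_map (op_cat C) (prod.swap x) y a (Ident C B)"
    using abelian_category.ex_ext_map_push[OF abelian_op, of "prod.swap x" B A a A'] x a by auto
  then have "ext_map C (prod.swap y) x (Ident C B) a"
    using ext_map_op[of "prod.swap x" A B y A' B] x by simp
  with y(1) show ?thesis by blast
qed

lemma ext_map_pull_factor:
  assumes "x \<in> extensions C A B" "y \<in> extensions C A' B" "z \<in> extensions C A'' B''"
    "ext_map C y x (Ident C B) a" "ext_map C z x b (a \<^bold>\<circ> a')" "a' \<in> Hom C A'' A'"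
  shows "ext_map C z y b a'"
  using abelian_category.ext_map_push_factor[OF abelian_op, of "prod.swap x" B A "prod.swap y" A'
      "prod.swap z" B'' A'' a a' b] assms
  by (simp add: ext_map_op)

end


section \<open>Functoriality of \<open>Ext\<^sup>1\<close>\<close>

definition ext_class :: "('o, 'm) cat \<Rightarrow> 'm \<times> 'm \<Rightarrow> ('m \<times> 'm) set" where
  "ext_class C x = {y \<in> extensions C (Tgt C (snd x)) (Src C (fst x)).
     ext_map C x y (Ident C (Src C (fst x))) (Ident C (Tgt C (snd x)))}"

lemma in_swap_image: "z \<in> prod.swap ` S \<longleftrightarrow> prod.swap z \<in> S"
  by (cases z) simp

context abelian_category begin

lemma in_ext_class:
  assumes "x \<in> extensions C A B"
  shows "y \<in> ext_class C x \<longleftrightarrow> y \<in> extensions C A B \<and> ext_map C x y (Ident C B) (Ident C A)"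
  using extensions_typing[OF assms] by (simp add: ext_class_def)

lemma ext_class_subset: "x \<in> extensions C A B \<Longrightarrow> ext_class C x \<subseteq> extensions C A B"
  by (auto simp: in_ext_class)

lemma ext_class_self: "x \<in> extensions C A B \<Longrightarrow> x \<in> ext_class C x"
  by (simp add: in_ext_class ext_map_ident)

lemma carrier_Ext1: "carrier (Ext1 C A B) = ext_class C ` extensions C A B"
proof -
  have "extension_equiv C A B `` {x} = ext_class C x" if "x \<in> extensions C A B" for x
    using in_ext_class[OF that] that by (auto simp: extension_equiv_def ext_map_def)
  then show ?thesis by (auto simp: Ext1_def quotient_def)
qed

lemma carrier_Ext1_subset: "\<xi> \<in> carrier (Ext1 C A B) \<Longrightarrow> \<xi> \<subseteq> extensions C A B"
  by (auto simp: carrier_Ext1 in_ext_class)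

lemma Ext1_ops [simp]:
  "monoid.mult (Ext1 C A B) = baer_sum C A B" "\<one>\<^bsub>Ext1 C A B\<^esub> = split_extensions C A B"
  by (simp_all add: Ext1_def)

lemma ext_map_equiv_left:
  assumes "x \<in> extensions C A B" "x' \<in> extensions C A B" "y \<in> extensions C A' B'"
    "ext_map C x x' (Ident C B) (Ident C A)" "ext_map C x' y b a"
  shows "ext_map C x y b a"
  using ext_map_comp[OF assms] ext_map_Hom[OF assms(5,2,3)] by simp

lemma ext_map_equiv_right:
  assumes "x \<in> extensions C A B" "y \<in> extensions C A' B'" "y' \<in> extensions C A' B'"
    "ext_map C x y b a" "ext_map C y y' (Ident C B') (Ident C A')"
  shows "ext_map C x y' b a"
  using ext_map_comp[OF assms] ext_map_Hom[OF assms(4,1,2)] by simp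

lemma ext_class_eq_iff:
  assumes x: "x \<in> extensions C A B" and y: "y \<in> extensions C A B"
  shows "ext_class C x = ext_class C y \<longleftrightarrow> ext_map C x y (Ident C B) (Ident C A)"
proof
  assume "ext_class C x = ext_class C y"
  then show "ext_map C x y (Ident C B) (Ident C A)"
    using in_ext_class[OF x] ext_class_self[OF y] by blast
next
  assume "ext_map C x y (Ident C B) (Ident C A)"
  then show "ext_class C x = ext_class C y"
    using in_ext_class[OF x] in_ext_class[OF y] ext_map_equiv_left[OF x y]
      ext_map_equiv_left[OF y x]
      ext_map_sym[OF x y] by blast
qed

lemma ext_push_eq_Collect:
  assumes "\<xi> \<subseteq> extensions C A B" "b \<in> Hom C B B'"
  shows "ext_push C b \<xi> = {y \<in> extensions C A B'. \<exists>x \<in> \<xi>. ext_map C x y b (Ident C A)}"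
proof -
  have "Tgt C (snd x) = A" if "x \<in> \<xi>" for x using that assms(1) by (auto simp: extensions_def)
  moreover have "Tgt C b = B'" using assms(2) by simp
  ultimately show ?thesis unfolding ext_push_def ext_map_def by auto
qed

lemma ext_pull_eq_Collect:
  assumes "\<xi> \<subseteq> extensions C A B" "a \<in> Hom C A' A"
  shows "ext_pull C a \<xi> = {y \<in> extensions C A' B. \<exists>x \<in> \<xi>. ext_map C y x (Ident C B) a}"
proof -
  have "Src C (fst x) = B" if "x \<in> \<xi>" for x using that assms(1) by (auto simp: extensions_def)
  moreover have "Src C a = A'" using assms(2) by simp
  ultimately show ?thesis unfolding ext_pull_def ext_map_def by auto
qed

lemma ext_class_op:
  assumes x: "x \<in> extensions C A B"
  shows "ext_class (op_cat C) (prod.swap x) = prod.swap ` ext_class C x"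
proof (intro Set.set_eqI)
  fix z
  have "z \<in> ext_class (op_cat C) (prod.swap x) \<longleftrightarrow>
      prod.swap z \<in> extensions C A B \<and> ext_map (op_cat C) (prod.swap x) z (Ident C A) (Ident C B)"
    using abelian_category.in_ext_class[OF abelian_op, of "prod.swap x" B A z] x by simp
  also have "\<dots> \<longleftrightarrow> prod.swap z \<in> extensions C A B \<and> ext_map C (prod.swap z) x (Ident C B) (Ident C A)"
    using ext_map_op[of "prod.swap x" A B z A B] x by auto
  also have "\<dots> \<longleftrightarrow> prod.swap z \<in> ext_class C x"
    using in_ext_class[OF x] ext_map_sym[OF x] ext_map_sym[OF _ x] by blast
  finally show "z \<in> ext_class (op_cat C) (prod.swap x) \<longleftrightarrow> z \<in> prod.swap ` ext_class C x"
    by (simp add: in_swap_image)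
qed

lemma ext_push_op:
  assumes \<xi>: "\<xi> \<subseteq> extensions C A B" and a: "a \<in> Hom C A' A"
  shows "ext_push (op_cat C) a (prod.swap ` \<xi>) = prod.swap ` ext_pull C a \<xi>"
proof (intro Set.set_eqI)
  fix z
  have "prod.swap ` \<xi> \<subseteq> extensions (op_cat C) B A" using \<xi> by auto
  then have "z \<in> ext_push (op_cat C) a (prod.swap ` \<xi>) \<longleftrightarrow> prod.swap z \<in> extensions C A' B \<and>
      (\<exists>x \<in> \<xi>. ext_map (op_cat C) (prod.swap x) z a (Ident C B))"
    using abelian_category.ext_push_eq_Collect[OF abelian_op, of "prod.swap ` \<xi>" B A a A'] a by simp
  also have "\<dots> \<longleftrightarrow> prod.swap z \<in> ext_pull C a \<xi>"
    unfolding ext_pull_eq_Collect[OF \<xi> a]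
    using \<xi> ext_map_op[of "prod.swap _" A B z A' B] by fastforce
  finally show "z \<in> ext_push (op_cat C) a (prod.swap ` \<xi>) \<longleftrightarrow> z \<in> prod.swap ` ext_pull C a \<xi>"
    by (simp add: in_swap_image)
qed

lemma ext_push_class:
  assumes x: "x \<in> extensions C A B" and b: "b \<in> Hom C B B'"
  shows "ext_push C b (ext_class C x) = {y \<in> extensions C A B'. ext_map C x y b (Ident C A)}"
proof -
  from ext_push_eq_Collect[OF ext_class_subset[OF x] b] show ?thesis
    using in_ext_class[OF x] ext_class_self[OF x] ext_map_equiv_left[OF x] by blast
qed

lemma ext_push_eq:
  assumes x: "x \<in> extensions C A B" and y: "y \<in> extensions C A B'"
    and xy: "ext_map C x y b (Ident C A)"
  shows "ext_push C b (ext_class C x) = ext_class C y"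
proof -
  have b: "b \<in> Hom C B B'" using ext_map_Hom[OF xy x y] by blast
  have "ext_map C x z b (Ident C A) \<longleftrightarrow> ext_map C y z (Ident C B') (Ident C A)"
    if z: "z \<in> extensions C A B'" for z
    using ext_map_push_factor[OF x y z xy, of "Ident C B'" "Ident C A"]
      ext_map_equiv_right[OF x y z xy] b
      extensions_typing[OF y] by auto
  then show ?thesis unfolding ext_push_class[OF x b] using in_ext_class[OF y] by blast
qed

lemma ext_pull_eq:
  assumes x: "x \<in> extensions C A B" and y: "y \<in> extensions C A' B"
    and yx: "ext_map C y x (Ident C B) a"
  shows "ext_pull C a (ext_class C x) = ext_class C y"
proof -
  have a: "a \<in> Hom C A' A" using ext_map_Hom[OF yx y x] by blast
  have "prod.swap ` ext_pull C a (ext_class C x) =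
    ext_push (op_cat C) a (ext_class (op_cat C) (prod.swap x))"
    unfolding ext_class_op[OF x] using ext_push_op[OF ext_class_subset[OF x] a] by simp
  also have "\<dots> = ext_class (op_cat C) (prod.swap y)"
    by (rule abelian_category.ext_push_eq[OF abelian_op]) (use x y yx in \<open>simp_all add: ext_map_op\<close>)
  also have "\<dots> = prod.swap ` ext_class C y" by (rule ext_class_op[OF y])
  finally show ?thesis by (simp add: inj_image_eq_iff)
qed

lemma ext_pull_class:
  assumes x: "x \<in> extensions C A B" and a: "a \<in> Hom C A' A"
  shows "ext_pull C a (ext_class C x) = {y \<in> extensions C A' B. ext_map C y x (Ident C B) a}"
  unfolding ext_pull_eq_Collect[OF ext_class_subset[OF x] a]
  using in_ext_class[OF x] ext_class_self[OF x] ext_map_sym[OF x] ext_map_equiv_right[OF _ _ x]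
  by blast

lemma ext_map_iff_push_eq_pull:
  assumes x: "x \<in> extensions C A B" and y: "y \<in> extensions C A' B'"
    and b: "b \<in> Hom C B B'" and a: "a \<in> Hom C A A'"
  shows "ext_map C x y b a \<longleftrightarrow> ext_push C b (ext_class C x) = ext_pull C a (ext_class C y)"
proof -
  obtain z where z: "z \<in> extensions C A B'" "ext_map C x z b (Ident C A)"
    using ex_ext_map_push[OF x b] by blast
  obtain w where w: "w \<in> extensions C A B'" "ext_map C w y (Ident C B') a"
    using ex_ext_map_pull[OF y a] by blast
  have "ext_map C x y b a \<longleftrightarrow> ext_map C z w (Ident C B') (Ident C A)"
  proof
    assume "ext_map C x y b a"
    then have "ext_map C z y (Ident C B') a"
      using ext_map_push_factor[OF x z(1) y z(2), of "Ident C B'" a] b Hom_objs[OF b] by simp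
    then show "ext_map C z w (Ident C B') (Ident C A)"
      using ext_map_pull_factor[OF y w(1) z(1) w(2), of "Ident C B'" "Ident C A"] a Hom_objs[OF a]
      by simp
  next
    assume "ext_map C z w (Ident C B') (Ident C A)"
    from ext_map_comp[OF x w(1) y ext_map_equiv_right[OF x z(1) w(1) z(2) this] w(2)]
    show "ext_map C x y b a" using a b by simp
  qed
  then show ?thesis
    unfolding ext_push_eq[OF x z] ext_pull_eq[OF y w] ext_class_eq_iff[OF z(1) w(1)] .
qed

lemma ext_push_closed:
  assumes \<xi>: "\<xi> \<in> carrier (Ext1 C A B)" and b: "b \<in> Hom C B B'"
  shows "ext_push C b \<xi> \<in> carrier (Ext1 C A B')"
proof -
  obtain x where x: "x \<in> extensions C A B" "\<xi> = ext_class C x" using \<xi> carrier_Ext1 by blast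
  obtain y where "y \<in> extensions C A B'" "ext_map C x y b (Ident C A)"
    using ex_ext_map_push[OF x(1) b] by blast
  then show ?thesis using x ext_push_eq[OF x(1)] carrier_Ext1 by auto
qed

lemma carrier_Ext1_op: "carrier (Ext1 (op_cat C) B A) = image prod.swap ` carrier (Ext1 C A B)"
proof -
  have "extensions (op_cat C) B A = prod.swap ` extensions C A B"
    by (intro Set.set_eqI) (simp add: in_swap_image)
  then show ?thesis
    unfolding carrier_Ext1 abelian_category.carrier_Ext1[OF abelian_op] image_image
    by (auto simp: ext_class_op image_image)
qed

lemma ext_pull_closed:
  assumes \<xi>: "\<xi> \<in> carrier (Ext1 C A B)" and a: "a \<in> Hom C A' A"
  shows "ext_pull C a \<xi> \<in> carrier (Ext1 C A' B)"
proof -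
  have "prod.swap ` ext_pull C a \<xi> \<in> carrier (Ext1 (op_cat C) B A')"
    using abelian_category.ext_push_closed[OF abelian_op, of "prod.swap ` \<xi>" B A a A'] \<xi> a
    by (simp add: carrier_Ext1_op ext_push_op[OF carrier_Ext1_subset[OF \<xi>]])
  then show ?thesis by (auto simp: carrier_Ext1_op inj_image_eq_iff)
qed

lemma ext_pull_ident:
  assumes "\<xi> \<in> carrier (Ext1 C A B)"
  shows "ext_pull C (Ident C A) \<xi> = \<xi>"
  using assms ext_pull_eq[OF _ _ ext_map_ident] unfolding carrier_Ext1 by blast

lemma ext_push_ident:
  assumes "\<xi> \<in> carrier (Ext1 C A B)"
  shows "ext_push C (Ident C B) \<xi> = \<xi>"
  using assms ext_push_eq[OF _ _ ext_map_ident] unfolding carrier_Ext1 by blast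

lemma ext_push_comp:
  assumes \<xi>: "\<xi> \<in> carrier (Ext1 C A B)" and b: "b \<in> Hom C B B'" and b': "b' \<in> Hom C B' B''"
  shows "ext_push C (b' \<^bold>\<circ> b) \<xi> = ext_push C b' (ext_push C b \<xi>)"
proof -
  obtain x where x: "x \<in> extensions C A B" "\<xi> = ext_class C x" using \<xi> carrier_Ext1 by blast
  obtain y where y: "y \<in> extensions C A B'" "ext_map C x y b (Ident C A)"
    using ex_ext_map_push[OF x(1) b] by blast
  obtain z where z: "z \<in> extensions C A B''" "ext_map C y z b' (Ident C A)"
    using ex_ext_map_push[OF y(1) b'] by blast
  have "ext_map C x z (b' \<^bold>\<circ> b) (Ident C A)"
    using ext_map_comp[OF x(1) y(1) z(1) y(2) z(2)] extensions_typing[OF x(1)] by simp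
  then show ?thesis
    unfolding x(2) ext_push_eq[OF x(1) y] ext_push_eq[OF y(1) z] by (rule ext_push_eq[OF x(1) z(1)])
qed

lemma ext_pull_comp:
  assumes \<xi>: "\<xi> \<in> carrier (Ext1 C A B)" and a: "a \<in> Hom C A' A" and a': "a' \<in> Hom C A'' A'"
  shows "ext_pull C (a \<^bold>\<circ> a') \<xi> = ext_pull C a' (ext_pull C a \<xi>)"
proof -
  note op = ext_push_op[OF carrier_Ext1_subset]
  have "prod.swap ` ext_pull C (a \<^bold>\<circ> a') \<xi> = ext_push (op_cat C) (a \<^bold>\<circ> a') (prod.swap ` \<xi>)"
    using op[OF \<xi>] a a' by simp
  also have "\<dots> = ext_push (op_cat C) a' (ext_push (op_cat C) a (prod.swap ` \<xi>))"
    using abelian_category.ext_push_comp[OF abelian_op, of "prod.swap ` \<xi>" B A a A' a' A''] \<xi> a a'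
    by (simp add: carrier_Ext1_op)
  also have "\<dots> = prod.swap ` ext_pull C a' (ext_pull C a \<xi>)"
    using op[OF \<xi> a] op[OF ext_pull_closed[OF \<xi> a] a'] by simp
  finally show ?thesis by (simp add: inj_image_eq_iff)
qed

lemma ext_push_pull:
  assumes \<xi>: "\<xi> \<in> carrier (Ext1 C A B)" and a: "a \<in> Hom C A' A" and b: "b \<in> Hom C B B'"
  shows "ext_push C b (ext_pull C a \<xi>) = ext_pull C a (ext_push C b \<xi>)"
proof -
  obtain x where x: "x \<in> extensions C A B" "\<xi> = ext_class C x" using \<xi> carrier_Ext1 by blast
  obtain y where y: "y \<in> extensions C A' B" "ext_map C y x (Ident C B) a"
    using ex_ext_map_pull[OF x(1) a] by blast
  obtain z where z: "z \<in> extensions C A B'" "ext_map C x z b (Ident C A)"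
    using ex_ext_map_push[OF x(1) b] by blast
  have "ext_map C y z b a" using ext_map_comp[OF y(1) x(1) z(1) y(2) z(2)] a b by simp
  then show ?thesis
    unfolding x(2) ext_pull_eq[OF x(1) y] ext_push_eq[OF x(1) z]
      ext_map_iff_push_eq_pull[OF y(1) z(1) b a] .
qed


section \<open>Exactness of \<open>Ext\<^sup>1\<close>\<close>

lemma ext_push_eq_class_iff:
  assumes x: "x \<in> extensions C A B" and y: "y \<in> extensions C A B'" and b: "b \<in> Hom C B B'"
  shows "ext_push C b (ext_class C x) = ext_class C y \<longleftrightarrow> ext_map C x y b (Ident C A)"
  using ext_push_eq[OF x y] ext_push_class[OF x b] ext_class_self[OF y] by auto

lemma ext_map_push_iff_factor:
  assumes x: "x \<in> extensions C A K" and y: "y \<in> extensions C A B"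
    and xy: "ext_map C x y f' (Ident C A)"
    and f: "f \<in> Hom C K B"
  shows "ext_map C x y f (Ident C A) \<longleftrightarrow> (\<exists>g \<in> Hom C (middle C x) B. f = f' \<^bold>+ g \<^bold>\<circ> fst x)"
proof -
  note x' = extensions_typing[OF x] and y' = extensions_typing[OF y]
  obtain e' where f': "f' \<in> Hom C K B"
    and e': "e' \<in> Hom C (middle C x) (middle C y)" "e' \<^bold>\<circ> fst x = fst y \<^bold>\<circ> f'" "snd y \<^bold>\<circ> e' = snd x"
    using ext_mapE[OF xy x y] x' by auto
  show ?thesis
  proof
    assume xy: "ext_map C x y f (Ident C A)"
    obtain e where e: "e \<in> Hom C (middle C x) (middle C y)" "e \<^bold>\<circ> fst x = fst y \<^bold>\<circ> f"
      "snd y \<^bold>\<circ> e = snd x"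
      using ext_mapE[OF xy x y] x' by auto
    have "snd y \<^bold>\<circ> (e \<^bold>+ neg e') = Zero C (middle C x) A" using e e' x' y' by (simp add: distrib)
    then obtain g where g: "g \<in> Hom C (middle C x) B" "fst y \<^bold>\<circ> g = e \<^bold>+ neg e'"
      using extension_lift[OF y, of "e \<^bold>+ neg e'" "middle C x"] e e' by auto
    have "fst y \<^bold>\<circ> (f' \<^bold>+ g \<^bold>\<circ> fst x) = fst y \<^bold>\<circ> f"
      using comp_eq_precomp[OF g(2), of "fst x"] g(1) e e' f f' x' y' by (simp add: distrib)
    then have "f = f' \<^bold>+ g \<^bold>\<circ> fst x"
      using extension_mono_cancel[OF y, of "f' \<^bold>+ g \<^bold>\<circ> fst x" f K] g(1) f f' x' by simp
    with g(1) show "\<exists>g \<in> Hom C (middle C x) B. f = f' \<^bold>+ g \<^bold>\<circ> fst x" by blast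
  next
    assume "\<exists>g \<in> Hom C (middle C x) B. f = f' \<^bold>+ g \<^bold>\<circ> fst x"
    then obtain g where g: "g \<in> Hom C (middle C x) B" "f = f' \<^bold>+ g \<^bold>\<circ> fst x" by blast
    have "snd y \<^bold>\<circ> fst y \<^bold>\<circ> g = Zero C (middle C x) A"
      using comp_eq_precomp[OF extensions_exact(5)[OF y], of g] g(1) y' by simp
    then show "ext_map C x y f (Ident C A)"
      unfolding ext_map_iff[OF x y] using g e' f f' x' y'
      by (auto simp: distrib intro!: bexI[of _ "e' \<^bold>+ fst y \<^bold>\<circ> g"])
  qed
qed

lemma ext_push_eq_iff:
  assumes x: "x \<in> extensions C A K" and f: "f \<in> Hom C K B" and f': "f' \<in> Hom C K B"
  shows "ext_push C f (ext_class C x) = ext_push C f' (ext_class C x) \<longleftrightarrow>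
    (\<exists>g \<in> Hom C (middle C x) B. f = f' \<^bold>+ g \<^bold>\<circ> fst x)"
proof -
  obtain y where y: "y \<in> extensions C A B" and xy: "ext_map C x y f' (Ident C A)"
    using ex_ext_map_push[OF x f'] by blast
  show ?thesis
    unfolding ext_push_eq[OF x y xy] ext_push_eq_class_iff[OF x y f]
    by (rule ext_map_push_iff_factor[OF x y xy f])
qed

lemma ext_pull_eq_iff:
  assumes x: "x \<in> extensions C A K" and a: "a \<in> Hom C B A" and a': "a' \<in> Hom C B A"
  shows "ext_pull C a (ext_class C x) = ext_pull C a' (ext_class C x) \<longleftrightarrow>
    (\<exists>g \<in> Hom C B (middle C x). a = a' \<^bold>+ snd x \<^bold>\<circ> g)"
proof -
  have "prod.swap ` ext_pull C a (ext_class C x) = prod.swap ` ext_pull C a' (ext_class C x) \<longleftrightarrow>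
    (\<exists>g \<in> Hom C B (middle (op_cat C) (prod.swap x)). a = a' \<^bold>+ snd x \<^bold>\<circ> g)"
    using abelian_category.ext_push_eq_iff[OF abelian_op, of "prod.swap x" K A a B a'] x a a'
      ext_push_op[OF ext_class_subset[OF x]] ext_class_op[OF x]
    by simp
  then show ?thesis using extensions_typing[OF x] by (auto simp: inj_image_eq_iff middle_def)
qed

lemma ext_map_zero_iff_section:
  assumes x: "x \<in> extensions C A K" and y: "y \<in> extensions C A B"
  shows "ext_map C x y (Zero C K B) (Ident C A) \<longleftrightarrow>
    (\<exists>s \<in> Hom C A (middle C y). snd y \<^bold>\<circ> s = Ident C A)"
proof
  note x' = extensions_typing[OF x] and y' = extensions_typing[OF y]
  assume xy: "ext_map C x y (Zero C K B) (Ident C A)"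
  obtain e where e: "e \<in> Hom C (middle C x) (middle C y)" "e \<^bold>\<circ> fst x = Zero C K (middle C y)"
    "snd y \<^bold>\<circ> e = snd x"
    using ext_mapE[OF xy x y] x' y' by auto
  obtain s where s: "s \<in> Hom C A (middle C y)" "s \<^bold>\<circ> snd x = e" using extension_desc[OF x e(1,2)] .
  have "snd y \<^bold>\<circ> s = Ident C A"
    by (rule extension_epi_cancel[OF x, where D = A]) (use s x' y' e in simp_all)
  with s(1) show "\<exists>s \<in> Hom C A (middle C y). snd y \<^bold>\<circ> s = Ident C A" by blast
next
  note x' = extensions_typing[OF x] and y' = extensions_typing[OF y]
  assume "\<exists>s \<in> Hom C A (middle C y). snd y \<^bold>\<circ> s = Ident C A"
  then obtain s where s: "s \<in> Hom C A (middle C y)" "snd y \<^bold>\<circ> s = Ident C A" by blast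
  show "ext_map C x y (Zero C K B) (Ident C A)"
    unfolding ext_map_iff[OF x y]
    using x' y' s(1) extensions_exact(5)[OF x] comp_eq_precomp[OF s(2), of "snd x"]
    by (intro conjI bexI[of _ "s \<^bold>\<circ> snd x"]) simp_all
qed

lemma ext_push_zero:
  assumes \<xi>: "\<xi> \<in> carrier (Ext1 C A K)" and B: "B \<in> Obj C"
  shows "ext_push C (Zero C K B) \<xi> = split_extensions C A B"
proof -
  obtain x where x: "x \<in> extensions C A K" "\<xi> = ext_class C x" using \<xi> carrier_Ext1 by blast
  have zero: "Zero C K B \<in> Hom C K B" using extensions_typing[OF x(1)] B by simp
  show ?thesis
    unfolding x(2) split_extensions_def ext_push_class[OF x(1) zero]
    using ext_map_zero_iff_section[OF x(1), unfolded middle_def] by blast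
qed


section \<open>The Baer sum\<close>

text \<open>The biproduct of \<open>x\<close> and \<open>y\<close> in the category of extensions, with its injections and
  projections given by their components.\<close>

definition is_extension_biproduct ::
    "'a \<Rightarrow> 'a \<Rightarrow> 'b \<times> 'b \<Rightarrow> 'b \<times> 'b \<Rightarrow> 'a \<Rightarrow> 'b \<Rightarrow> 'b \<Rightarrow> 'b \<Rightarrow> 'b \<Rightarrow> 'a \<Rightarrow> 'b \<Rightarrow> 'b \<Rightarrow> 'b \<Rightarrow> 'b \<Rightarrow> 'b \<times> 'b \<Rightarrow> bool" where
  "is_extension_biproduct A B x y S i\<^sub>1 i\<^sub>2 p\<^sub>1 p\<^sub>2 T k\<^sub>1 k\<^sub>2 q\<^sub>1 q\<^sub>2 z \<longleftrightarrow>
     is_biproduct C B B S i\<^sub>1 i\<^sub>2 p\<^sub>1 p\<^sub>2 \<and> is_biproduct C A A T k\<^sub>1 k\<^sub>2 q\<^sub>1 q\<^sub>2 \<and>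
     z \<in> extensions C T S \<and>
     ext_map C x z i\<^sub>1 k\<^sub>1 \<and> ext_map C y z i\<^sub>2 k\<^sub>2 \<and> ext_map C z x p\<^sub>1 q\<^sub>1 \<and> ext_map C z y p\<^sub>2 q\<^sub>2"

lemma biproduct_map_is_extension_biproduct:
  assumes x: "x \<in> extensions C A B" and y: "y \<in> extensions C A B"
    and S: "is_biproduct C B B S i\<^sub>1 i\<^sub>2 p\<^sub>1 p\<^sub>2" and T: "is_biproduct C A A T k\<^sub>1 k\<^sub>2 q\<^sub>1 q\<^sub>2"
    and U: "is_biproduct C (middle C x) (middle C y) U j\<^sub>1 j\<^sub>2 r\<^sub>1 r\<^sub>2"
  shows "is_extension_biproduct A B x y S i\<^sub>1 i\<^sub>2 p\<^sub>1 p\<^sub>2 T k\<^sub>1 k\<^sub>2 q\<^sub>1 q\<^sub>2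
    (biproduct_map C j\<^sub>1 j\<^sub>2 p\<^sub>1 p\<^sub>2 (fst x) (fst y),
     biproduct_map C k\<^sub>1 k\<^sub>2 r\<^sub>1 r\<^sub>2 (snd x) (snd y))"
    (is "is_extension_biproduct A B x y S i\<^sub>1 i\<^sub>2 p\<^sub>1 p\<^sub>2 T k\<^sub>1 k\<^sub>2 q\<^sub>1 q\<^sub>2 (?i, ?p)")
proof -
  note x' = extensions_typing[OF x] and y' = extensions_typing[OF y]
  note S' = biproduct_typing[OF S] and T' = biproduct_typing[OF T] and U' = biproduct_typing[OF U]
  note i = biproduct_map_typing[OF S U x'(1) y'(1)] and p = biproduct_map_typing[OF U T x'(2) y'(2)]
  have "is_kernel C ?i ?p"
    by (rule biproduct_map_kernel[OF S T U extensions_exact(1)[OF x] extensions_exact(1)[OF y]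
          x'(1) y'(1) x'(2) y'(2)])
  moreover have "is_cokernel C ?p ?i"
    using preadditive_category.biproduct_map_kernel[OF preadditive_op, of A A T q\<^sub>1 q\<^sub>2 k\<^sub>1 k\<^sub>2
        B B S p\<^sub>1 p\<^sub>2 i\<^sub>1 i\<^sub>2 "middle C x" "middle C y" U r\<^sub>1 r\<^sub>2 j\<^sub>1 j\<^sub>2 "snd x" "fst x" "snd y"
          "fst y"]
      S T U x' y' S' T' U' extensions_exact(2)[OF x] extensions_exact(2)[OF y]
    by (simp add: biproduct_map_def)
  ultimately have z: "(?i, ?p) \<in> extensions C T S" using i p by (intro extensionsI) simp_all
  have middle: "middle C (?i, ?p) = U" using p by (simp add: middle_def)
  note proj = biproduct_map_proj[OF S U x'(1) y'(1)] biproduct_map_proj[OF U T x'(2) y'(2)]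
    and inj = biproduct_map_inj[OF S U x'(1) y'(1)] biproduct_map_inj[OF U T x'(2) y'(2)]
  have "ext_map C x (?i, ?p) i\<^sub>1 k\<^sub>1" "ext_map C y (?i, ?p) i\<^sub>2 k\<^sub>2"
    unfolding ext_map_iff[OF x z] ext_map_iff[OF y z] middle fst_conv snd_conv
    using S' T' U' inj by metis+
  moreover have "ext_map C (?i, ?p) x p\<^sub>1 q\<^sub>1" "ext_map C (?i, ?p) y p\<^sub>2 q\<^sub>2"
    unfolding ext_map_iff[OF z x] ext_map_iff[OF z y] middle fst_conv snd_conv
    using S' T' U' proj by metis+
  ultimately show ?thesis using S T z unfolding is_extension_biproduct_def by blast
qed

lemma ext_pull_singleton:
  assumes z: "z \<in> extensions C A B" and a: "a \<in> Hom C A' A"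
  shows "ext_pull C a {z} = ext_pull C a (ext_class C z)"
proof -
  have "{z} \<subseteq> extensions C A B" using z by simp
  from ext_pull_eq_Collect[OF this a] show ?thesis unfolding ext_pull_class[OF z a] by blast
qed

lemma baer_sum_eqI:
  assumes \<xi>: "\<xi> \<in> carrier (Ext1 C A B)" and \<eta>: "\<eta> \<in> carrier (Ext1 C A B)"
    and eq: "\<And>x y S i\<^sub>1 i\<^sub>2 p\<^sub>1 p\<^sub>2 T k\<^sub>1 k\<^sub>2 q\<^sub>1 q\<^sub>2 z. x \<in> \<xi> \<Longrightarrow> y \<in> \<eta> \<Longrightarrow>
      is_extension_biproduct A B x y S i\<^sub>1 i\<^sub>2 p\<^sub>1 p\<^sub>2 T k\<^sub>1 k\<^sub>2 q\<^sub>1 q\<^sub>2 z \<Longrightarrow>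
      ext_push C (p\<^sub>1 \<^bold>+ p\<^sub>2) (ext_pull C (k\<^sub>1 \<^bold>+ k\<^sub>2) (ext_class C z)) = \<zeta>"
  shows "baer_sum C A B \<xi> \<eta> = \<zeta>"
proof -
  have summand: "ext_push C (p\<^sub>1 \<^bold>+ p\<^sub>2) (ext_pull C (k\<^sub>1 \<^bold>+ k\<^sub>2)
      {((j\<^sub>1 \<^bold>\<circ> fst x \<^bold>\<circ> p\<^sub>1) \<^bold>+ (j\<^sub>2 \<^bold>\<circ> fst y \<^bold>\<circ> p\<^sub>2),
        (k\<^sub>1 \<^bold>\<circ> snd x \<^bold>\<circ> r\<^sub>1) \<^bold>+ (k\<^sub>2 \<^bold>\<circ> snd y \<^bold>\<circ> r\<^sub>2))}) = \<zeta>"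
    if x: "x \<in> \<xi>" and y: "y \<in> \<eta>" and S: "is_biproduct C B B S i\<^sub>1 i\<^sub>2 p\<^sub>1 p\<^sub>2"
      and T: "is_biproduct C A A T k\<^sub>1 k\<^sub>2 q\<^sub>1 q\<^sub>2"
      and U: "is_biproduct C (Tgt C (fst x)) (Tgt C (fst y)) U j\<^sub>1 j\<^sub>2 r\<^sub>1 r\<^sub>2"
    for x y S i\<^sub>1 i\<^sub>2 p\<^sub>1 p\<^sub>2 T k\<^sub>1 k\<^sub>2 q\<^sub>1 q\<^sub>2 U j\<^sub>1 j\<^sub>2 r\<^sub>1 r\<^sub>2
  proof -
    have xe: "x \<in> extensions C A B" and ye: "y \<in> extensions C A B"
      using x y carrier_Ext1_subset \<xi> \<eta> by blast+
    have U': "is_biproduct C (middle C x) (middle C y) U j\<^sub>1 j\<^sub>2 r\<^sub>1 r\<^sub>2"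
      using U extensions_typing(1)[OF xe] extensions_typing(1)[OF ye] by simp
    note z = biproduct_map_is_extension_biproduct[OF xe ye S T U', unfolded biproduct_map_def]
    have "k\<^sub>1 \<^bold>+ k\<^sub>2 \<in> Hom C A T" using biproduct_typing[OF T] by simp
    with z show ?thesis
      using eq[OF x y z] ext_pull_singleton unfolding is_extension_biproduct_def by metis
  qed
  obtain x y where xy: "x \<in> \<xi>" "y \<in> \<eta>" "x \<in> extensions C A B" "y \<in> extensions C A B"
    using \<xi> \<eta> ext_class_self unfolding carrier_Ext1 by blast
  note typing = extensions_typing[OF xy(3)] extensions_typing[OF xy(4)]
  obtain S i\<^sub>1 i\<^sub>2 p\<^sub>1 p\<^sub>2 where S: "is_biproduct C B B S i\<^sub>1 i\<^sub>2 p\<^sub>1 p\<^sub>2"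
    using ex_biproduct typing by blast
  obtain T k\<^sub>1 k\<^sub>2 q\<^sub>1 q\<^sub>2 where T: "is_biproduct C A A T k\<^sub>1 k\<^sub>2 q\<^sub>1 q\<^sub>2"
    using ex_biproduct typing by blast
  obtain U j\<^sub>1 j\<^sub>2 r\<^sub>1 r\<^sub>2
    where U: "is_biproduct C (Tgt C (fst x)) (Tgt C (fst y)) U j\<^sub>1 j\<^sub>2 r\<^sub>1 r\<^sub>2"
    using ex_biproduct[of "Tgt C (fst x)" "Tgt C (fst y)"] typing by auto
  have "\<zeta> \<subseteq> baer_sum C A B \<xi> \<eta>"
    using xy(1,2) S T U unfolding baer_sum_def summand[OF xy(1,2) S T U, symmetric] by blast
  moreover have "baer_sum C A B \<xi> \<eta> \<subseteq> \<zeta>" unfolding baer_sum_def using summand by blast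
  ultimately show ?thesis by blast
qed

lemma ext_push_plus:
  assumes \<xi>: "\<xi> \<in> carrier (Ext1 C A K)" and f: "f \<in> Hom C K B" and g: "g \<in> Hom C K B"
  shows "baer_sum C A B (ext_push C f \<xi>) (ext_push C g \<xi>) = ext_push C (f \<^bold>+ g) \<xi>"
proof (rule baer_sum_eqI[OF ext_push_closed[OF \<xi> f] ext_push_closed[OF \<xi> g]])
  obtain w where w: "w \<in> extensions C A K" "\<xi> = ext_class C w" using \<xi> carrier_Ext1 by blast
  fix x y S i\<^sub>1 i\<^sub>2 p\<^sub>1 p\<^sub>2 T k\<^sub>1 k\<^sub>2 q\<^sub>1 q\<^sub>2 z
  assume "x \<in> ext_push C f \<xi>" "y \<in> ext_push C g \<xi>"
    and biproduct: "is_extension_biproduct A B x y S i\<^sub>1 i\<^sub>2 p\<^sub>1 p\<^sub>2 T k\<^sub>1 k\<^sub>2 q\<^sub>1 q\<^sub>2 z"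
  then have wx: "x \<in> extensions C A B" "ext_map C w x f (Ident C A)"
    and wy: "y \<in> extensions C A B" "ext_map C w y g (Ident C A)"
    unfolding w(2) ext_push_class[OF w(1) f] ext_push_class[OF w(1) g] by blast+
  have S: "is_biproduct C B B S i\<^sub>1 i\<^sub>2 p\<^sub>1 p\<^sub>2" and T: "is_biproduct C A A T k\<^sub>1 k\<^sub>2 q\<^sub>1 q\<^sub>2"
    and z: "z \<in> extensions C T S" and xz: "ext_map C x z i\<^sub>1 k\<^sub>1" and yz: "ext_map C y z i\<^sub>2 k\<^sub>2"
    using biproduct unfolding is_extension_biproduct_def by blast+
  note S' = biproduct_typing[OF S] and T' = biproduct_typing[OF T]
  have wz: "ext_map C w z (i\<^sub>1 \<^bold>\<circ> f \<^bold>+ i\<^sub>2 \<^bold>\<circ> g) (k\<^sub>1 \<^bold>+ k\<^sub>2)"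
    using ext_map_plus[OF w(1) z ext_map_comp[OF w(1) wx(1) z wx(2) xz]
        ext_map_comp[OF w(1) wy(1) z wy(2) yz]] T'
    by simp
  have h: "i\<^sub>1 \<^bold>\<circ> f \<^bold>+ i\<^sub>2 \<^bold>\<circ> g \<in> Hom C K S" "k\<^sub>1 \<^bold>+ k\<^sub>2 \<in> Hom C A T" "p\<^sub>1 \<^bold>+ p\<^sub>2 \<in> Hom C S B"
    using f g S' T' by simp_all
  have "ext_push C (p\<^sub>1 \<^bold>+ p\<^sub>2) (ext_pull C (k\<^sub>1 \<^bold>+ k\<^sub>2) (ext_class C z)) =
      ext_push C ((p\<^sub>1 \<^bold>+ p\<^sub>2) \<^bold>\<circ> (i\<^sub>1 \<^bold>\<circ> f \<^bold>+ i\<^sub>2 \<^bold>\<circ> g)) \<xi>"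
    using wz unfolding ext_map_iff_push_eq_pull[OF w(1) z h(1,2)] w(2)[symmetric]
      ext_push_comp[OF \<xi> h(1,3)] by simp
  also have "(p\<^sub>1 \<^bold>+ p\<^sub>2) \<^bold>\<circ> (i\<^sub>1 \<^bold>\<circ> f \<^bold>+ i\<^sub>2 \<^bold>\<circ> g) = f \<^bold>+ g"
    using f g S' biproduct_eqs_comp[OF S] Hom_objs[OF f] by (simp add: distrib)
  finally show "ext_push C (p\<^sub>1 \<^bold>+ p\<^sub>2) (ext_pull C (k\<^sub>1 \<^bold>+ k\<^sub>2) (ext_class C z)) =
    ext_push C (f \<^bold>+ g) \<xi>" .
qed

lemma ext_pull_plus:
  assumes \<xi>: "\<xi> \<in> carrier (Ext1 C A B)" and f: "f \<in> Hom C A' A" and g: "g \<in> Hom C A' A"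
  shows "baer_sum C A' B (ext_pull C f \<xi>) (ext_pull C g \<xi>) = ext_pull C (f \<^bold>+ g) \<xi>"
proof (rule baer_sum_eqI[OF ext_pull_closed[OF \<xi> f] ext_pull_closed[OF \<xi> g]])
  obtain w where w: "w \<in> extensions C A B" "\<xi> = ext_class C w" using \<xi> carrier_Ext1 by blast
  fix x y S i\<^sub>1 i\<^sub>2 p\<^sub>1 p\<^sub>2 T k\<^sub>1 k\<^sub>2 q\<^sub>1 q\<^sub>2 z
  assume "x \<in> ext_pull C f \<xi>" "y \<in> ext_pull C g \<xi>"
    and biproduct: "is_extension_biproduct A' B x y S i\<^sub>1 i\<^sub>2 p\<^sub>1 p\<^sub>2 T k\<^sub>1 k\<^sub>2 q\<^sub>1 q\<^sub>2 z"
  then have xw: "x \<in> extensions C A' B" "ext_map C x w (Ident C B) f"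
    and yw: "y \<in> extensions C A' B" "ext_map C y w (Ident C B) g"
    unfolding w(2) ext_pull_class[OF w(1) f] ext_pull_class[OF w(1) g] by blast+
  have S: "is_biproduct C B B S i\<^sub>1 i\<^sub>2 p\<^sub>1 p\<^sub>2" and T: "is_biproduct C A' A' T k\<^sub>1 k\<^sub>2 q\<^sub>1 q\<^sub>2"
    and z: "z \<in> extensions C T S" and zx: "ext_map C z x p\<^sub>1 q\<^sub>1" and zy: "ext_map C z y p\<^sub>2 q\<^sub>2"
    using biproduct unfolding is_extension_biproduct_def by blast+
  note S' = biproduct_typing[OF S] and T' = biproduct_typing[OF T]
  have zw: "ext_map C z w (p\<^sub>1 \<^bold>+ p\<^sub>2) (f \<^bold>\<circ> q\<^sub>1 \<^bold>+ g \<^bold>\<circ> q\<^sub>2)"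
    using ext_map_plus[OF z w(1) ext_map_comp[OF z xw(1) w(1) zx xw(2)]
        ext_map_comp[OF z yw(1) w(1) zy yw(2)]] S'
    by simp
  have h: "f \<^bold>\<circ> q\<^sub>1 \<^bold>+ g \<^bold>\<circ> q\<^sub>2 \<in> Hom C T A" "k\<^sub>1 \<^bold>+ k\<^sub>2 \<in> Hom C A' T" "p\<^sub>1 \<^bold>+ p\<^sub>2 \<in> Hom C S B"
    using f g S' T' by simp_all
  have "ext_class C z \<in> carrier (Ext1 C T S)" using z carrier_Ext1 by blast
  then have "ext_push C (p\<^sub>1 \<^bold>+ p\<^sub>2) (ext_pull C (k\<^sub>1 \<^bold>+ k\<^sub>2) (ext_class C z)) =
      ext_pull C (k\<^sub>1 \<^bold>+ k\<^sub>2) (ext_push C (p\<^sub>1 \<^bold>+ p\<^sub>2) (ext_class C z))"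
    by (rule ext_push_pull[OF _ h(2,3)])
  also have "\<dots> = ext_pull C ((f \<^bold>\<circ> q\<^sub>1 \<^bold>+ g \<^bold>\<circ> q\<^sub>2) \<^bold>\<circ> (k\<^sub>1 \<^bold>+ k\<^sub>2)) \<xi>"
    using zw unfolding ext_map_iff_push_eq_pull[OF z w(1) h(3,1)] w(2)[symmetric]
      ext_pull_comp[OF \<xi> h(1,2)] by simp
  also have "(f \<^bold>\<circ> q\<^sub>1 \<^bold>+ g \<^bold>\<circ> q\<^sub>2) \<^bold>\<circ> (k\<^sub>1 \<^bold>+ k\<^sub>2) = f \<^bold>+ g"
    using f g T' biproduct_eqs[OF T] Hom_objs[OF f] by (simp add: distrib)
  finally show "ext_push C (p\<^sub>1 \<^bold>+ p\<^sub>2) (ext_pull C (k\<^sub>1 \<^bold>+ k\<^sub>2) (ext_class C z)) =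
    ext_pull C (f \<^bold>+ g) \<xi>" .
qed

end


section \<open>Retracts of functors\<close>

definition natural_transformation ::
    "('o, 'm) cat \<Rightarrow> 'o set \<Rightarrow> ('o, 'm, 'g) ab_functor \<Rightarrow> ('o, 'm, 'h) ab_functor \<Rightarrow>
     ('o \<Rightarrow> 'g \<Rightarrow> 'h) \<Rightarrow> bool" where
  "natural_transformation C X F G \<tau> \<longleftrightarrow>
     (\<forall>A \<in> X. \<tau> A \<in> hom (FObj F A) (FObj G A)) \<and>
     (\<forall>A \<in> X. \<forall>B \<in> X. \<forall>f \<in> Hom C A B. \<forall>u \<in> carrier (FObj F A). \<tau> B (FMap F f u) = FMap G f (\<tau> A u))"

definition functor_retract ::
    "('o, 'm) cat \<Rightarrow> 'o set \<Rightarrow> ('o, 'm, 'g) ab_functor \<Rightarrow> ('o, 'm, 'h) ab_functor \<Rightarrow>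
     ('o \<Rightarrow> 'g \<Rightarrow> 'h) \<Rightarrow> ('o \<Rightarrow> 'h \<Rightarrow> 'g) \<Rightarrow> bool" where
  "functor_retract C X F E \<iota> \<pi> \<longleftrightarrow>
     natural_transformation C X F E \<iota> \<and> natural_transformation C X E F \<pi> \<and>
     (\<forall>A \<in> X. \<forall>u \<in> carrier (FObj F A). \<pi> A (\<iota> A u) = u)"

lemma natural_transformationD:
  assumes "natural_transformation C X F G \<tau>" "A \<in> X"
  shows "\<tau> A \<in> hom (FObj F A) (FObj G A)" "u \<in> carrier (FObj F A) \<Longrightarrow> \<tau> A u \<in> carrier (FObj G A)"
    "B \<in> X \<Longrightarrow> f \<in> Hom C A B \<Longrightarrow> u \<in> carrier (FObj F A) \<Longrightarrow> \<tau> B (FMap F f u) = FMap G f (\<tau> A u)"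
  using assms hom_in_carrier[of "\<tau> A" "FObj F A" "FObj G A" u]
  unfolding natural_transformation_def by blast+

lemma natural_transformation_comp:
  assumes "natural_transformation C X F G \<sigma>" "natural_transformation C X G H \<tau>"
  shows "natural_transformation C X F H (\<lambda>A u. \<tau> A (\<sigma> A u))"
  unfolding natural_transformation_def
proof (intro conjI ballI)
  note \<sigma> = natural_transformationD[OF assms(1)] and \<tau> = natural_transformationD[OF assms(2)]
  show "(\<lambda>u. \<tau> A (\<sigma> A u)) \<in> hom (FObj F A) (FObj H A)" if "A \<in> X" for A
    using hom_compose[OF \<sigma>(1)[OF that] \<tau>(1)[OF that]] by (simp add: comp_def)
  show "\<tau> B (\<sigma> B (FMap F f u)) = FMap H f (\<tau> A (\<sigma> A u))"
    if "A \<in> X" "B \<in> X" "f \<in> Hom C A B" "u \<in> carrier (FObj F A)" for A B f u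
    using \<sigma>(2)[OF that(1,4)] \<sigma>(3)[OF that] \<tau>(3)[OF that(1-3)] by simp
qed

lemma functor_iso_iff:
  "functor_iso C X F G \<longleftrightarrow> (\<exists>\<tau>. natural_transformation C X F G \<tau> \<and>
     (\<forall>A \<in> X. bij_betw (\<tau> A) (carrier (FObj F A)) (carrier (FObj G A))))"
  unfolding functor_iso_def natural_transformation_def iso_def by blast

lemma functor_iso_trans:
  assumes "functor_iso C X F G" "functor_iso C X G H"
  shows "functor_iso C X F H"
proof -
  obtain \<sigma> where \<sigma>: "natural_transformation C X F G \<sigma>"
    "\<forall>A \<in> X. bij_betw (\<sigma> A) (carrier (FObj F A)) (carrier (FObj G A))"
    using assms(1) unfolding functor_iso_iff by blast
  obtain \<tau> where \<tau>: "natural_transformation C X G H \<tau>"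
    "\<forall>A \<in> X. bij_betw (\<tau> A) (carrier (FObj G A)) (carrier (FObj H A))"
    using assms(2) unfolding functor_iso_iff by blast
  have "bij_betw (\<lambda>u. \<tau> A (\<sigma> A u)) (carrier (FObj F A)) (carrier (FObj H A))" if "A \<in> X" for A
    using bij_betw_trans[OF \<sigma>(2)[rule_format, OF that] \<tau>(2)[rule_format, OF that]]
    by (simp add: comp_def)
  with natural_transformation_comp[OF \<sigma>(1) \<tau>(1)] show ?thesis unfolding functor_iso_iff by blast
qed

lemma functor_iso_of_retracts:
  assumes F: "functor_retract C X F E \<iota> \<pi>" and G: "functor_retract C X G E \<iota>' \<pi>'"
    and idem: "\<And>A x. A \<in> X \<Longrightarrow> x \<in> carrier (FObj E A) \<Longrightarrow> \<iota> A (\<pi> A x) = \<iota>' A (\<pi>' A x)"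
  shows "functor_iso C X F G"
  unfolding functor_iso_iff
proof (intro exI conjI ballI)
  have \<iota>: "natural_transformation C X F E \<iota>" and \<pi>: "natural_transformation C X E F \<pi>"
    and \<iota>': "natural_transformation C X G E \<iota>'" and \<pi>': "natural_transformation C X E G \<pi>'"
    using F G unfolding functor_retract_def by blast+
  show "natural_transformation C X F G (\<lambda>A u. \<pi>' A (\<iota> A u))"
    using natural_transformation_comp[OF \<iota> \<pi>'] .
  fix A assume A: "A \<in> X"
  note carrier = natural_transformationD(2)[OF \<iota> A] natural_transformationD(2)[OF \<pi> A]
    natural_transformationD(2)[OF \<iota>' A] natural_transformationD(2)[OF \<pi>' A]
  have F_id: "\<pi> A (\<iota> A u) = u" if "u \<in> carrier (FObj F A)" for u
    using F A that unfolding functor_retract_def by blast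
  have G_id: "\<pi>' A (\<iota>' A v) = v" if "v \<in> carrier (FObj G A)" for v
    using G A that unfolding functor_retract_def by blast
  show "bij_betw (\<lambda>u. \<pi>' A (\<iota> A u)) (carrier (FObj F A)) (carrier (FObj G A))"
  proof (rule bij_betw_byWitness[where f' = "\<lambda>v. \<pi> A (\<iota>' A v)"])
    show "\<forall>u \<in> carrier (FObj F A). \<pi> A (\<iota>' A (\<pi>' A (\<iota> A u))) = u"
      using carrier F_id by (simp flip: idem[OF A])
    show "\<forall>v \<in> carrier (FObj G A). \<pi>' A (\<iota> A (\<pi> A (\<iota>' A v))) = v"
      using carrier G_id by (simp add: idem[OF A])
  qed (use carrier in auto)
qed

lemma additive_functorD:
  assumes "additive_functor C X F" "A \<in> X"
  shows "comm_group (FObj F A)"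
    "B \<in> X \<Longrightarrow> f \<in> Hom C A B \<Longrightarrow> FMap F f \<in> hom (FObj F A) (FObj F B)"
    "B \<in> X \<Longrightarrow> f \<in> Hom C A B \<Longrightarrow> u \<in> carrier (FObj F A) \<Longrightarrow> FMap F f u \<in> carrier (FObj F B)"
  using assms hom_in_carrier[of "FMap F f" "FObj F A" "FObj F B" u]
  unfolding additive_functor_def by blast+

lemma natural_transformation_inverse:
  assumes F: "additive_functor C X F" and \<tau>: "natural_transformation C X F G \<tau>"
    and bij: "\<And>A. A \<in> X \<Longrightarrow> bij_betw (\<tau> A) (carrier (FObj F A)) (carrier (FObj G A))"
  shows "natural_transformation C X G F (\<lambda>A. inv_into (carrier (FObj F A)) (\<tau> A))"
    (is "natural_transformation C X G F ?\<rho>")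
  unfolding natural_transformation_def
proof (intro conjI ballI)
  fix A assume A: "A \<in> X"
  interpret comm_group "FObj F A" using F A by (rule additive_functorD)
  show "?\<rho> A \<in> hom (FObj G A) (FObj F A)"
    using iso_set_sym[of "\<tau> A" "FObj G A"] natural_transformationD(1)[OF \<tau> A] bij[OF A]
    by (simp add: iso_def)
  fix B f v assume B: "B \<in> X" and f: "f \<in> Hom C A B" and v: "v \<in> carrier (FObj G A)"
  have \<rho>v: "?\<rho> A v \<in> carrier (FObj F A)" and \<tau>\<rho>: "\<tau> A (?\<rho> A v) = v"
    using bij[OF A] v by (auto simp: bij_betw_def inv_into_into f_inv_into_f)
  have "FMap F f (?\<rho> A v) \<in> carrier (FObj F B)" by (rule additive_functorD(3)[OF F A B f \<rho>v])
  moreover have "\<tau> B (FMap F f (?\<rho> A v)) = FMap G f v"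
    using natural_transformationD(3)[OF \<tau> A B f \<rho>v] \<tau>\<rho> by simp
  ultimately show "?\<rho> B (FMap G f v) = FMap F f (?\<rho> A v)"
    using bij[OF B] by (metis bij_betw_inv_into_left)
qed

lemma functor_sum_retract:
  assumes F: "additive_functor C X F" and G: "additive_functor C X G"
  shows "functor_retract C X F (functor_sum F G) (\<lambda>A u. (u, \<one>\<^bsub>FObj G A\<^esub>)) (\<lambda>_. fst)"
proof -
  have group: "group (FObj F A)" "group (FObj G A)" if "A \<in> X" for A
    using additive_functorD(1)[OF F that] additive_functorD(1)[OF G that]
    by (simp_all add: comm_group_def)
  have "(\<lambda>u. (u, \<one>\<^bsub>FObj G A\<^esub>)) \<in> hom (FObj F A) (FObj F A \<times>\<times> FObj G A)" if "A \<in> X" for A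
    using group[OF that] by (intro homI) (auto simp: group.is_monoid monoid.one_closed monoid.l_one)
  moreover have "FMap G f \<one>\<^bsub>FObj G A\<^esub> = \<one>\<^bsub>FObj G B\<^esub>" if "A \<in> X" "B \<in> X" "f \<in> Hom C A B" for A B f
    using additive_functorD(2)[OF G that] group that by (intro hom_one) auto
  ultimately have "natural_transformation C X F (functor_sum F G) (\<lambda>A u. (u, \<one>\<^bsub>FObj G A\<^esub>))"
    unfolding natural_transformation_def functor_sum_def by (simp del: in_Hom)
  moreover have "natural_transformation C X (functor_sum F G) F (\<lambda>_. fst)"
    unfolding natural_transformation_def functor_sum_def by (auto intro!: homI)
  ultimately show ?thesis unfolding functor_retract_def by simp
qed

lemma direct_summand_retract:
  assumes E: "additive_functor C X E" and summand: "direct_summand_compl C X F G E"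
  obtains \<iota> \<pi> where "functor_retract C X F E \<iota> \<pi>"
proof -
  have F: "additive_functor C X F" and G: "additive_functor C X G"
    and iso: "functor_iso C X E (functor_sum F G)"
    using summand unfolding direct_summand_compl_def by blast+
  obtain \<tau> where \<tau>: "natural_transformation C X E (functor_sum F G) \<tau>"
    and bij: "\<And>A. A \<in> X \<Longrightarrow> bij_betw (\<tau> A) (carrier (FObj E A)) (carrier (FObj (functor_sum F G) A))"
    using iso unfolding functor_iso_iff by blast
  define \<rho> where "\<rho> A = inv_into (carrier (FObj E A)) (\<tau> A)" for A
  have \<rho>: "natural_transformation C X (functor_sum F G) E \<rho>"
    unfolding \<rho>_def by (rule natural_transformation_inverse[OF E \<tau> bij])
  have \<tau>\<rho>: "\<tau> A (\<rho> A v) = v" if "A \<in> X" "v \<in> carrier (FObj (functor_sum F G) A)" for A v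
    using bij_betw_inv_into_right[OF bij[OF that(1)] that(2)] by (simp add: \<rho>_def)
  let ?j = "\<lambda>A u. (u, \<one>\<^bsub>FObj G A\<^esub>)"
  have j: "natural_transformation C X F (functor_sum F G) ?j"
    and fst: "natural_transformation C X (functor_sum F G) F (\<lambda>_. fst)"
    using functor_sum_retract[OF F G] unfolding functor_retract_def by blast+
  have "functor_retract C X F E (\<lambda>A u. \<rho> A (?j A u)) (\<lambda>A x. fst (\<tau> A x))"
    unfolding functor_retract_def
    using natural_transformation_comp[OF j \<rho>] natural_transformation_comp[OF \<tau> fst]
      \<tau>\<rho> natural_transformationD(2)[OF j] by simp
  then show thesis by (rule that)
qed


section \<open>\<open>Ext\<^sup>1\<close> as an additive functor\<close>

definition projective_presentation :: "('o, 'm) cat \<Rightarrow> 'o \<Rightarrow> 'o \<Rightarrow> 'm \<times> 'm \<Rightarrow> bool" where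
  "projective_presentation C A K x \<longleftrightarrow> x \<in> extensions C A K \<and> projective C (middle C x)"

lemma Ext1_functor_simps [simp]:
  "FObj (Ext1_cov C A) Y = Ext1 C A Y" "FMap (Ext1_cov C A) = ext_push C"
  "FObj (Ext1_contra C A) Y = Ext1 C Y A" "FMap (Ext1_contra C A) = ext_pull C"
  by (simp_all add: Ext1_cov_def Ext1_contra_def)

context abelian_category begin

lemma projective_lift:
  assumes "projective C P" "is_epi C e" "f \<in> Hom C P (Tgt C e)"
  obtains g where "g \<in> Hom C P (Src C e)" "e \<^bold>\<circ> g = f"
  using assms unfolding projective_def by blast

lemma ex_projective_presentation:
  assumes "enough_projectives C" "A \<in> Obj C"
  obtains x K where "projective_presentation C A K x"
proof -
  obtain P e where P: "projective C P" "e \<in> Hom C P A" "is_epi C e"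
    using assms unfolding enough_projectives_def by blast
  obtain i where i: "is_kernel C i e" using ex_kernel P(2) by auto
  have "(i, e) \<in> extensions C A (Src C i)"
    using i epi_cokernel_of_kernel[OF P(3) i] P(2) by (intro extensionsI) simp_all
  then show thesis
    using that[of "Src C i" "(i, e)"] P by (simp add: projective_presentation_def middle_def)
qed

lemma ext_push_presentation_surj:
  assumes x: "projective_presentation C A K x" and \<eta>: "\<eta> \<in> carrier (Ext1 C A Y)"
  obtains f where "f \<in> Hom C K Y" "\<eta> = ext_push C f (ext_class C x)"
proof -
  have xe: "x \<in> extensions C A K" and P: "projective C (middle C x)"
    using x by (simp_all add: projective_presentation_def)
  obtain y where y: "y \<in> extensions C A Y" "\<eta> = ext_class C y" using \<eta> carrier_Ext1 by blast
  note x' = extensions_typing[OF xe] and y' = extensions_typing[OF y(1)]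
  obtain e where e: "e \<in> Hom C (middle C x) (middle C y)" "snd y \<^bold>\<circ> e = snd x"
    using projective_lift[OF P extensions_exact(4)[OF y(1)], of "snd x"] x' y' by auto
  have "snd y \<^bold>\<circ> e \<^bold>\<circ> fst x = Zero C K A"
    using comp_eq_precomp[OF e(2), of "fst x"] e(1) x' y' extensions_exact(5)[OF xe] by simp
  then obtain f where f: "f \<in> Hom C K Y" "fst y \<^bold>\<circ> f = e \<^bold>\<circ> fst x"
    using extension_lift[OF y(1), of "e \<^bold>\<circ> fst x" K] e(1) x' by auto
  have "ext_map C x y f (Ident C A)" unfolding ext_map_iff[OF xe y(1)] using e f x' by auto
  then show thesis using that f(1) y(2) ext_push_eq[OF xe y(1)] by simp
qed

lemma presentation_class_carrier:
  "projective_presentation C A K x \<Longrightarrow> ext_class C x \<in> carrier (Ext1 C A K)"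
  by (auto simp: projective_presentation_def carrier_Ext1)

lemma ext_push_hom_from_Hom:
  assumes \<xi>: "\<xi> \<in> carrier (Ext1 C A K)"
  shows "(\<lambda>f. ext_push C f \<xi>) \<in> hom (hom_group C K Y) (Ext1 C A Y)"
  using ext_push_plus[OF \<xi>] ext_push_closed[OF \<xi>] by (intro homI) (simp_all del: in_Hom)

lemma Ext1_comm_group:
  assumes proj: "enough_projectives C" and A: "A \<in> Obj C" and Y: "Y \<in> Obj C"
  shows "comm_group (Ext1 C A Y)"
proof -
  obtain x K where x: "projective_presentation C A K x"
    by (rule ex_projective_presentation[OF proj A])
  note \<xi> = presentation_class_carrier[OF x]
  have K: "K \<in> Obj C"
    using x extensions_typing(4)[of x A K] by (simp add: projective_presentation_def)
  interpret comm_group "hom_group C K Y" by (rule hom_comm_group[OF K Y])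
  have "(\<lambda>f. ext_push C f (ext_class C x)) ` Hom C K Y = carrier (Ext1 C A Y)"
    using ext_push_closed[OF \<xi>] ext_push_presentation_surj[OF x] by blast
  moreover have "ext_push C (Zero C K Y) (ext_class C x) = \<one>\<^bsub>Ext1 C A Y\<^esub>"
    using ext_push_zero[OF \<xi> Y] by simp
  ultimately show ?thesis
    using hom_imp_img_comm_group[OF ext_push_hom_from_Hom[OF \<xi>, of Y]] by (simp del: Ext1_ops)
qed

lemma ext_push_common_source:
  assumes proj: "enough_projectives C" and \<xi>: "\<xi> \<in> carrier (Ext1 C A Y)"
    and \<eta>: "\<eta> \<in> carrier (Ext1 C A Y)"
  obtains K \<omega> f g where "\<omega> \<in> carrier (Ext1 C A K)" "f \<in> Hom C K Y" "g \<in> Hom C K Y"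
    "\<xi> = ext_push C f \<omega>" "\<eta> = ext_push C g \<omega>"
proof -
  have "A \<in> Obj C" using \<xi> extensions_typing(3) unfolding carrier_Ext1 by blast
  then obtain x K where x: "projective_presentation C A K x"
    by (rule ex_projective_presentation[OF proj])
  obtain f where f: "f \<in> Hom C K Y" "\<xi> = ext_push C f (ext_class C x)"
    by (rule ext_push_presentation_surj[OF x \<xi>])
  obtain g where g: "g \<in> Hom C K Y" "\<eta> = ext_push C g (ext_class C x)"
    by (rule ext_push_presentation_surj[OF x \<eta>])
  from presentation_class_carrier[OF x] f(1) g(1) f(2) g(2) show thesis by (rule that)
qed

lemma ext_push_hom:
  assumes proj: "enough_projectives C" and b: "b \<in> Hom C Y Y'"
  shows "ext_push C b \<in> hom (Ext1 C A Y) (Ext1 C A Y')"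
proof (rule homI)
  show "ext_push C b \<xi> \<in> carrier (Ext1 C A Y')" if "\<xi> \<in> carrier (Ext1 C A Y)" for \<xi>
    using that b by (rule ext_push_closed)
  fix \<xi> \<eta> assume "\<xi> \<in> carrier (Ext1 C A Y)" "\<eta> \<in> carrier (Ext1 C A Y)"
  then obtain K \<omega> f g where \<omega>: "\<omega> \<in> carrier (Ext1 C A K)" and fg: "f \<in> Hom C K Y" "g \<in> Hom C K Y"
    "\<xi> = ext_push C f \<omega>" "\<eta> = ext_push C g \<omega>"
    by (rule ext_push_common_source[OF proj])
  have "f \<^bold>+ g \<in> Hom C K Y" "b \<^bold>\<circ> f \<in> Hom C K Y'" "b \<^bold>\<circ> g \<in> Hom C K Y'"
    "b \<^bold>\<circ> (f \<^bold>+ g) = b \<^bold>\<circ> f \<^bold>+ b \<^bold>\<circ> g"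
    using b fg(1,2) by (simp_all add: distrib)
  then show "ext_push C b (\<xi> \<otimes>\<^bsub>Ext1 C A Y\<^esub> \<eta>) = ext_push C b \<xi> \<otimes>\<^bsub>Ext1 C A Y'\<^esub> ext_push C b \<eta>"
    using b fg by (simp add: ext_push_plus[OF \<omega>] ext_push_comp[OF \<omega>, symmetric] del: in_Hom)
qed

lemma ext_pull_hom:
  assumes proj: "enough_projectives C" and a: "a \<in> Hom C B A"
  shows "ext_pull C a \<in> hom (Ext1 C A Y) (Ext1 C B Y)"
proof (rule homI)
  show "ext_pull C a \<xi> \<in> carrier (Ext1 C B Y)" if "\<xi> \<in> carrier (Ext1 C A Y)" for \<xi>
    using that a by (rule ext_pull_closed)
  fix \<xi> \<eta> assume "\<xi> \<in> carrier (Ext1 C A Y)" "\<eta> \<in> carrier (Ext1 C A Y)"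
  then obtain K \<omega> f g where \<omega>: "\<omega> \<in> carrier (Ext1 C A K)" and fg: "f \<in> Hom C K Y" "g \<in> Hom C K Y"
    "\<xi> = ext_push C f \<omega>" "\<eta> = ext_push C g \<omega>"
    by (rule ext_push_common_source[OF proj])
  have "f \<^bold>+ g \<in> Hom C K Y" using fg(1,2) by simp
  then show "ext_pull C a (\<xi> \<otimes>\<^bsub>Ext1 C A Y\<^esub> \<eta>) = ext_pull C a \<xi> \<otimes>\<^bsub>Ext1 C B Y\<^esub> ext_pull C a \<eta>"
    using fg by (simp add: ext_push_plus[OF \<omega>] ext_push_plus[OF ext_pull_closed[OF \<omega> a]]
        ext_push_pull[OF \<omega> a, symmetric] del: in_Hom)
qed

lemma Ext1_cov_additive:
  assumes proj: "enough_projectives C" and X: "X \<subseteq> Obj C" and A: "A \<in> Obj C"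
  shows "additive_functor C X (Ext1_cov C A)"
  unfolding additive_functor_def Ext1_functor_simps
  using X Ext1_comm_group[OF proj A] ext_push_hom[OF proj] ext_push_ident ext_push_comp
    ext_push_plus
  by (simp add: subsetD del: in_Hom)

lemma ext_pull_natural:
  assumes proj: "enough_projectives C" and a: "a \<in> Hom C B A"
  shows "natural_transformation C X (Ext1_cov C A) (Ext1_cov C B) (\<lambda>_. ext_pull C a)"
  unfolding natural_transformation_def Ext1_functor_simps
  using ext_pull_hom[OF proj a] ext_push_pull[OF _ a] by simp

end


section \<open>Stable categories\<close>

locale stable_ideal = abelian_category +
  fixes \<P> :: "'a \<Rightarrow> bool"
  assumes \<P>_obj: "\<P> Q \<Longrightarrow> Q \<in> Obj C"
    and \<P>_zero: "\<exists>Z. is_zero_object C Z \<and> \<P> Z"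
    and \<P>_biproduct: "is_biproduct C Q Q' S i\<^sub>1 i\<^sub>2 p\<^sub>1 p\<^sub>2 \<Longrightarrow> \<P> Q \<Longrightarrow> \<P> Q' \<Longrightarrow> \<P> S"
begin

abbreviation null :: "'b \<Rightarrow> bool" where
  "null \<equiv> factors_through C \<P>"

abbreviation stable_arr :: "'b \<Rightarrow> 'b set" ("\<langle>_\<rangle>") where
  "\<langle>f\<rangle> \<equiv> stable_class C \<P> f"

lemma nullI:
  assumes "\<P> Q" "u \<in> Hom C A Q" "v \<in> Hom C Q B"
  shows "null (v \<^bold>\<circ> u)"
  using assms
  unfolding factors_through_def by (intro exI[of _ Q] conjI bexI[of _ u] bexI[of _ v]) simp_all

lemma nullE:
  assumes "null h" "h \<in> Hom C A B"
  obtains Q u v where "\<P> Q" "u \<in> Hom C A Q" "v \<in> Hom C Q B" "h = v \<^bold>\<circ> u"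
proof -
  have "Src C h = A" "Tgt C h = B" using assms(2) by simp_all
  then show thesis using assms(1) that unfolding factors_through_def by blast
qed

lemma null_zero:
  assumes "A \<in> Obj C" "B \<in> Obj C"
  shows "null (Zero C A B)"
proof -
  obtain Z where Z: "Z \<in> Obj C" "\<P> Z" using \<P>_zero \<P>_obj by blast
  have "null (Zero C Z B \<^bold>\<circ> Zero C A Z)" using assms Z by (intro nullI) simp_all
  then show ?thesis using assms Z by simp
qed

lemma null_plus:
  assumes "null h" "null h'" and h: "h \<in> Hom C A B" and h': "h' \<in> Hom C A B"
  shows "null (h \<^bold>+ h')"
proof -
  obtain Q u v where Q: "\<P> Q" and uv: "u \<in> Hom C A Q" "v \<in> Hom C Q B" "h = v \<^bold>\<circ> u"
    using nullE[OF assms(1) h] .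
  obtain Q' u' v' where Q': "\<P> Q'" and uv': "u' \<in> Hom C A Q'" "v' \<in> Hom C Q' B" "h' = v' \<^bold>\<circ> u'"
    using nullE[OF assms(2) h'] .
  obtain S i\<^sub>1 i\<^sub>2 p\<^sub>1 p\<^sub>2 where S: "is_biproduct C Q Q' S i\<^sub>1 i\<^sub>2 p\<^sub>1 p\<^sub>2"
    using ex_biproduct \<P>_obj Q Q' by blast
  note S' = biproduct_typing[OF S]
  have "null ((v \<^bold>\<circ> p\<^sub>1 \<^bold>+ v' \<^bold>\<circ> p\<^sub>2) \<^bold>\<circ> (i\<^sub>1 \<^bold>\<circ> u \<^bold>+ i\<^sub>2 \<^bold>\<circ> u'))"
    by (rule nullI[OF \<P>_biproduct[OF S Q Q']]) (use uv uv' S' in simp_all)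
  also have "(v \<^bold>\<circ> p\<^sub>1 \<^bold>+ v' \<^bold>\<circ> p\<^sub>2) \<^bold>\<circ> (i\<^sub>1 \<^bold>\<circ> u \<^bold>+ i\<^sub>2 \<^bold>\<circ> u') = h \<^bold>+ h'"
    using uv uv' S' biproduct_eqs_comp[OF S] Hom_objs[OF h] by (simp add: distrib)
  finally show ?thesis .
qed

lemma null_postcomp:
  assumes "null h" "h \<in> Hom C A B" and g: "g \<in> Hom C B D"
  shows "null (g \<^bold>\<circ> h)"
proof -
  obtain Q u v where Q: "\<P> Q" and uv: "u \<in> Hom C A Q" "v \<in> Hom C Q B" "h = v \<^bold>\<circ> u"
    using nullE[OF assms(1,2)] .
  then have "null ((g \<^bold>\<circ> v) \<^bold>\<circ> u)" using g by (intro nullI[OF Q]) simp_all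
  then show ?thesis using uv g by simp
qed

lemma null_precomp:
  assumes "null h" "h \<in> Hom C A B" and g: "g \<in> Hom C D A"
  shows "null (h \<^bold>\<circ> g)"
proof -
  obtain Q u v where Q: "\<P> Q" and uv: "u \<in> Hom C A Q" "v \<in> Hom C Q B" "h = v \<^bold>\<circ> u"
    using nullE[OF assms(1,2)] .
  then have "null (v \<^bold>\<circ> (u \<^bold>\<circ> g))" using g by (intro nullI[OF Q]) simp_all
  then show ?thesis using uv g by simp
qed

lemma null_neg:
  assumes "null h" and h: "h \<in> Hom C A B"
  shows "null (neg h)"
proof -
  have "null (neg (Ident C B) \<^bold>\<circ> h)" using Hom_objs[OF h] by (intro null_postcomp[OF assms]) simp
  then show ?thesis using h Hom_objs[OF h] by simp
qed

lemma in_stable_arr: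
  assumes f: "f \<in> Hom C A B"
  shows "g \<in> \<langle>f\<rangle> \<longleftrightarrow> g \<in> Hom C A B \<and> null (f \<^bold>+ neg g)"
proof -
  have "g \<in> \<langle>f\<rangle> \<longleftrightarrow> g \<in> Hom C A B \<and> (\<exists>h \<in> Hom C A B. null h \<and> f = g \<^bold>+ h)"
    unfolding stable_class_def using f by simp
  moreover have "(\<exists>h \<in> Hom C A B. null h \<and> f = g \<^bold>+ h) \<longleftrightarrow> null (f \<^bold>+ neg g)" if g: "g \<in> Hom C A B"
  proof
    assume "\<exists>h \<in> Hom C A B. null h \<and> f = g \<^bold>+ h"
    then obtain h where h: "h \<in> Hom C A B" "null h" "f = g \<^bold>+ h" by blast
    then show "null (f \<^bold>+ neg g)" using g by (simp add: plus_comm[of g h] plus_assoc)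
  next
    assume "null (f \<^bold>+ neg g)"
    then show "\<exists>h \<in> Hom C A B. null h \<and> f = g \<^bold>+ h"
      using f g by (intro bexI[of _ "f \<^bold>+ neg g"]) simp_all
  qed
  ultimately show ?thesis by blast
qed

lemma stable_arr_self: "f \<in> Hom C A B \<Longrightarrow> f \<in> \<langle>f\<rangle>"
  using in_stable_arr[of f A B f] null_zero[of A B] Hom_objs[of f A B] by simp

lemma stable_arr_eq_iff:
  assumes f: "f \<in> Hom C A B" and g: "g \<in> Hom C A B"
  shows "\<langle>f\<rangle> = \<langle>g\<rangle> \<longleftrightarrow> null (f \<^bold>+ neg g)"
proof
  assume "\<langle>f\<rangle> = \<langle>g\<rangle>"
  then show "null (f \<^bold>+ neg g)" using stable_arr_self[OF g] in_stable_arr[OF f] by blast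
next
  assume fg: "null (f \<^bold>+ neg g)"
  have "null (neg (f \<^bold>+ neg g))" by (rule null_neg[OF fg]) (use f g in simp)
  then have gf: "null (g \<^bold>+ neg f)" using f g by (simp add: plus_comm[of "neg f" g])
  have trans: "null (u \<^bold>+ neg w)"
    if "null (u \<^bold>+ neg v)" "null (v \<^bold>+ neg w)"
      and uvw: "u \<in> Hom C A B" "v \<in> Hom C A B" "w \<in> Hom C A B" for u v w
    using null_plus[OF that(1,2)] uvw by (simp add: plus_assoc)
  show "\<langle>f\<rangle> = \<langle>g\<rangle>"
    using trans[OF fg _ f g] trans[OF gf _ g f] in_stable_arr[OF f] in_stable_arr[OF g] by blast
qed

lemma stable_arr_comp_cong:
  assumes f: "f \<in> Hom C A B" "f' \<in> Hom C A B" "\<langle>f\<rangle> = \<langle>f'\<rangle>"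
    and g: "g \<in> Hom C B D" "g' \<in> Hom C B D" "\<langle>g\<rangle> = \<langle>g'\<rangle>"
  shows "\<langle>g \<^bold>\<circ> f\<rangle> = \<langle>g' \<^bold>\<circ> f'\<rangle>"
proof -
  have "null (g \<^bold>\<circ> (f \<^bold>+ neg f'))"
    by (rule null_postcomp[OF f(3)[unfolded stable_arr_eq_iff[OF f(1,2)]] _ g(1)]) (use f in simp)
  then have "\<langle>g \<^bold>\<circ> f\<rangle> = \<langle>g \<^bold>\<circ> f'\<rangle>"
    using f g by (subst stable_arr_eq_iff[of _ A D]) (simp_all add: distrib)
  also have "null ((g \<^bold>+ neg g') \<^bold>\<circ> f')"
    by (rule null_precomp[OF g(3)[unfolded stable_arr_eq_iff[OF g(1,2)]] _ f(2)]) (use g in simp)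
  then have "\<langle>g \<^bold>\<circ> f'\<rangle> = \<langle>g' \<^bold>\<circ> f'\<rangle>"
    using f g by (subst stable_arr_eq_iff[of _ A D]) (simp_all add: distrib)
  finally show ?thesis .
qed

lemma stable_arr_plus_cong:
  assumes f: "f \<in> Hom C A B" "f' \<in> Hom C A B" "\<langle>f\<rangle> = \<langle>f'\<rangle>"
    and g: "g \<in> Hom C A B" "g' \<in> Hom C A B" "\<langle>g\<rangle> = \<langle>g'\<rangle>"
  shows "\<langle>f \<^bold>+ g\<rangle> = \<langle>f' \<^bold>+ g'\<rangle>"
proof -
  have "null ((f \<^bold>+ neg f') \<^bold>+ (g \<^bold>+ neg g'))"
    using null_plus[OF f(3)[unfolded stable_arr_eq_iff[OF f(1,2)]]
        g(3)[unfolded stable_arr_eq_iff[OF g(1,2)]]]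
      f g by simp
  also have "(f \<^bold>+ neg f') \<^bold>+ (g \<^bold>+ neg g') = (f \<^bold>+ g) \<^bold>+ neg (f' \<^bold>+ g')"
    using f g plus_left_comm[of "neg f'" g "neg g'"] by (simp add: plus_assoc)
  finally show ?thesis
    using f g by (subst stable_arr_eq_iff[of _ A B]) (simp_all del: neg_plus)
qed

lemma stable_arr_representative:
  assumes f: "f \<in> Hom C A B"
  shows "(SOME g. g \<in> \<langle>f\<rangle>) \<in> Hom C A B" "\<langle>f\<rangle> = \<langle>SOME g. g \<in> \<langle>f\<rangle>\<rangle>"
proof -
  have "(SOME g. g \<in> \<langle>f\<rangle>) \<in> \<langle>f\<rangle>" using stable_arr_self[OF f] by (rule someI)
  then show "(SOME g. g \<in> \<langle>f\<rangle>) \<in> Hom C A B" "\<langle>f\<rangle> = \<langle>SOME g. g \<in> \<langle>f\<rangle>\<rangle>"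
    using in_stable_arr[OF f] stable_arr_eq_iff[OF f] by blast+
qed

end

locale stable_subcategory = stable_ideal +
  fixes X :: "'a set"
  assumes X_obj: "X \<subseteq> Obj C"
begin

abbreviation stable :: "('a, 'b set) cat" where
  "stable \<equiv> stable_cat C X \<P>"

lemma stable_simps [simp]:
  "Obj stable = X" "Ident stable A = \<langle>Ident C A\<rangle>" "Zero stable A B = \<langle>Zero C A B\<rangle>"
  by (simp_all add: stable_cat_def)

lemma stable_src_tgt [simp]:
  assumes "f \<in> Arr C"
  shows "Src stable \<langle>f\<rangle> = Src C f" "Tgt stable \<langle>f\<rangle> = Tgt C f"
  using stable_arr_representative(1)[of f "Src C f" "Tgt C f"] assms
  by (simp_all add: stable_cat_def)

lemma stable_arr_typing [simp]:
  assumes "f \<in> Arr C" "Src C f \<in> X" "Tgt C f \<in> X"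
  shows "\<langle>f\<rangle> \<in> Arr stable"
  using assms by (simp add: stable_cat_def)

lemma stable_HomE:
  assumes "u \<in> Hom stable A B"
  obtains f where "A \<in> X" "B \<in> X" "f \<in> Hom C A B" "u = \<langle>f\<rangle>"
proof -
  obtain f where "f \<in> Arr C" "Src C f \<in> X" "Tgt C f \<in> X" "u = \<langle>f\<rangle>"
    using assms by (auto simp: stable_cat_def)
  then show thesis using that[of f] assms by simp
qed

lemma stable_comp [simp]:
  assumes "f \<in> Arr C" "g \<in> Arr C" "Tgt C f = Src C g"
  shows "\<langle>g\<rangle> \<^bold>\<circ>\<^bsub>stable\<^esub> \<langle>f\<rangle> = \<langle>g \<^bold>\<circ> f\<rangle>"
proof -
  have f: "f \<in> Hom C (Src C f) (Src C g)" and g: "g \<in> Hom C (Src C g) (Tgt C g)"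
    using assms by simp_all
  have "\<langle>g \<^bold>\<circ> f\<rangle> = \<langle>(SOME h. h \<in> \<langle>g\<rangle>) \<^bold>\<circ> (SOME h. h \<in> \<langle>f\<rangle>)\<rangle>"
    by (rule stable_arr_comp_cong[OF f stable_arr_representative[OF f]
          g stable_arr_representative[OF g]])
  then show ?thesis by (simp add: stable_cat_def)
qed

lemma stable_plus [simp]:
  assumes "f \<in> Arr C" "g \<in> Arr C" "Src C f = Src C g" "Tgt C f = Tgt C g"
  shows "\<langle>f\<rangle> \<^bold>+\<^bsub>stable\<^esub> \<langle>g\<rangle> = \<langle>f \<^bold>+ g\<rangle>"
proof -
  have f: "f \<in> Hom C (Src C g) (Tgt C g)" and g: "g \<in> Hom C (Src C g) (Tgt C g)"
    using assms by simp_all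
  have "\<langle>f \<^bold>+ g\<rangle> = \<langle>(SOME h. h \<in> \<langle>f\<rangle>) \<^bold>+ (SOME h. h \<in> \<langle>g\<rangle>)\<rangle>"
    by (rule stable_arr_plus_cong[OF f stable_arr_representative[OF f]
          g stable_arr_representative[OF g]])
  then show ?thesis by (simp add: stable_cat_def)
qed

lemma stable_category: "category stable"
proof
  show "Src stable u \<in> Obj stable" "Tgt stable u \<in> Obj stable" if "u \<in> Arr stable" for u
    using stable_HomE[of u "Src stable u" "Tgt stable u"] that
    unfolding stable_simps in_Hom by blast+
  show "Ident stable A \<in> Hom stable A A" if "A \<in> Obj stable" for A using that X_obj by auto
  show "g \<^bold>\<circ>\<^bsub>stable\<^esub> f \<in> Hom stable A D" if "f \<in> Hom stable A B" "g \<in> Hom stable B D" for f g A B D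
    using that by (elim stable_HomE) simp
  show "f \<^bold>\<circ>\<^bsub>stable\<^esub> Ident stable A = f" "Ident stable B \<^bold>\<circ>\<^bsub>stable\<^esub> f = f" if "f \<in> Hom stable A B"
    for f A B
    using that by (elim stable_HomE, simp add: subsetD[OF X_obj])+
  show "(h \<^bold>\<circ>\<^bsub>stable\<^esub> g) \<^bold>\<circ>\<^bsub>stable\<^esub> f = h \<^bold>\<circ>\<^bsub>stable\<^esub> g \<^bold>\<circ>\<^bsub>stable\<^esub> f"
    if "f \<in> Hom stable A B" "g \<in> Hom stable B D" "h \<in> Hom stable D E" for f g h A B D E
    using that by (elim stable_HomE) simp
qed

lemma stable_hom_group:
  assumes A: "A \<in> X" and B: "B \<in> X"
  shows "comm_group (hom_group stable A B)"
proof (rule comm_groupI; unfold hom_group_simps)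
  have objs: "A \<in> Obj C" "B \<in> Obj C" using A B X_obj by auto
  show "u \<^bold>+\<^bsub>stable\<^esub> v \<in> Hom stable A B" if "u \<in> Hom stable A B" "v \<in> Hom stable A B" for u v
    using that by (elim stable_HomE) simp
  show "Zero stable A B \<in> Hom stable A B" using A B objs by simp
  show "u \<^bold>+\<^bsub>stable\<^esub> v \<^bold>+\<^bsub>stable\<^esub> w = u \<^bold>+\<^bsub>stable\<^esub> (v \<^bold>+\<^bsub>stable\<^esub> w)"
    if "u \<in> Hom stable A B" "v \<in> Hom stable A B" "w \<in> Hom stable A B" for u v w
    using that by (elim stable_HomE) (simp add: plus_assoc)
  show "u \<^bold>+\<^bsub>stable\<^esub> v = v \<^bold>+\<^bsub>stable\<^esub> u" if "u \<in> Hom stable A B" "v \<in> Hom stable A B" for u v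
    using that by (elim stable_HomE) (simp add: plus_comm)
  show "Zero stable A B \<^bold>+\<^bsub>stable\<^esub> u = u" if "u \<in> Hom stable A B" for u
    using that objs by (elim stable_HomE) simp
  show "\<exists>v \<in> Hom stable A B. v \<^bold>+\<^bsub>stable\<^esub> u = Zero stable A B" if u: "u \<in> Hom stable A B" for u
  proof -
    obtain f where "f \<in> Hom C A B" "u = \<langle>f\<rangle>" using stable_HomE[OF u] .
    then show ?thesis using A B by (intro bexI[of _ "\<langle>neg f\<rangle>"]) simp_all
  qed
qed

lemma stable_preadditive: "preadditive_category stable"
proof (intro preadditive_category.intro preadditive_category_axioms.intro stable_category)
  show "comm_group (hom_group stable A B)" if "A \<in> Obj stable" "B \<in> Obj stable" for A B
    using stable_hom_group that by simp
  show "g \<^bold>\<circ>\<^bsub>stable\<^esub> (f \<^bold>+\<^bsub>stable\<^esub> f') = (g \<^bold>\<circ>\<^bsub>stable\<^esub> f) \<^bold>+\<^bsub>stable\<^esub> (g \<^bold>\<circ>\<^bsub>stable\<^esub> f')"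
    if "f \<in> Hom stable A B" "f' \<in> Hom stable A B" "g \<in> Hom stable B D" for f f' g A B D
    using that by (elim stable_HomE) (simp add: distrib)
  show "(g \<^bold>+\<^bsub>stable\<^esub> g') \<^bold>\<circ>\<^bsub>stable\<^esub> f = (g \<^bold>\<circ>\<^bsub>stable\<^esub> f) \<^bold>+\<^bsub>stable\<^esub> (g' \<^bold>\<circ>\<^bsub>stable\<^esub> f)"
    if "f \<in> Hom stable A B" "g \<in> Hom stable B D" "g' \<in> Hom stable B D" for f g g' A B D
    using that by (elim stable_HomE) (simp add: distrib)
qed

end

context abelian_category begin

lemma projective_zero_object:
  assumes Z: "is_zero_object C Z"
  shows "projective C Z"
  unfolding projective_def
proof (intro conjI allI impI ballI)
  show obj: "Z \<in> Obj C" using Z by (simp add: is_zero_object_def)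
  fix e f assume "is_epi C e" and f: "f \<in> Hom C Z (Tgt C e)"
  then have e: "e \<in> Arr C" by (simp add: is_epi_arr)
  then have "e \<^bold>\<circ> Zero C Z (Src C e) \<in> Hom C Z (Tgt C e)" using obj by simp
  then have "e \<^bold>\<circ> Zero C Z (Src C e) = f"
    using Z f e unfolding is_zero_object_def by (metis tgt_obj)
  then show "\<exists>g \<in> Hom C Z (Src C e). e \<^bold>\<circ> g = f" 
    using e obj by (intro bexI[of _ "Zero C Z (Src C e)"]) simp_all
qed

lemma projective_biproduct:
  assumes S: "is_biproduct C P Q S i\<^sub>1 i\<^sub>2 p\<^sub>1 p\<^sub>2" and P: "projective C P" and Q: "projective C Q"
  shows "projective C S"
  unfolding projective_def
proof (intro conjI allI impI ballI)
  note S' = biproduct_typing[OF S]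
  show "S \<in> Obj C" by (fact S'(3))
  fix e f assume e: "is_epi C e" and f: "f \<in> Hom C S (Tgt C e)"
  obtain g where g: "g \<in> Hom C P (Src C e)" "e \<^bold>\<circ> g = f \<^bold>\<circ> i\<^sub>1"
    using projective_lift[OF P e, of "f \<^bold>\<circ> i\<^sub>1"] f S' by auto
  obtain h where h: "h \<in> Hom C Q (Src C e)" "e \<^bold>\<circ> h = f \<^bold>\<circ> i\<^sub>2"
    using projective_lift[OF Q e, of "f \<^bold>\<circ> i\<^sub>2"] f S' by auto
  have "e \<^bold>\<circ> (g \<^bold>\<circ> p\<^sub>1 \<^bold>+ h \<^bold>\<circ> p\<^sub>2) = f"
    using g h f S' is_epi_arr[OF e] comp_eq_precomp[OF g(2), of p\<^sub>1]
      comp_eq_precomp[OF h(2), of p\<^sub>2]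
      biproduct_eqs_comp(6)[OF S, of f]
    by (simp add: distrib)
  then show "\<exists>g \<in> Hom C S (Src C e). e \<^bold>\<circ> g = f" 
    using g(1) h(1) S' by (intro bexI[of _ "g \<^bold>\<circ> p\<^sub>1 \<^bold>+ h \<^bold>\<circ> p\<^sub>2"]) simp_all
qed

lemma projective_stable_ideal: "stable_ideal C (projective C)"
  using projective_zero_object ex_zero_object projective_biproduct
  by (intro stable_ideal.intro stable_ideal_axioms.intro abelian_category_axioms)
    (auto simp: projective_def)

lemma injective_stable_ideal: "stable_ideal C (injective C)"
proof -
  interpret op: stable_ideal "op_cat C" "injective C"
    using abelian_category.projective_stable_ideal[OF abelian_op] by simp
  show ?thesis
    using op.\<P>_obj op.\<P>_zero op.\<P>_biproduct
    by (intro stable_ideal.intro stable_ideal_axioms.intro abelian_category_axioms) simp_all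
qed

end


section \<open>Natural transformations between \<open>Ext\<^sup>1\<close>-functors\<close>

context abelian_category begin

lemma ext_push_eq_split_iff:
  assumes x: "x \<in> extensions C A K" and f: "f \<in> Hom C K B"
  shows "ext_push C f (ext_class C x) = split_extensions C A B \<longleftrightarrow>
    (\<exists>g \<in> Hom C (middle C x) B. f = g \<^bold>\<circ> fst x)"
proof -
  note x' = extensions_typing[OF x] and B = Hom_objs(2)[OF f]
  have "ext_class C x \<in> carrier (Ext1 C A K)" using x carrier_Ext1 by blast
  then have "split_extensions C A B = ext_push C (Zero C K B) (ext_class C x)"
    using ext_push_zero B by simp
  moreover have "Zero C K B \<^bold>+ g \<^bold>\<circ> fst x = g \<^bold>\<circ> fst x" if "g \<in> Hom C (middle C x) B" for g
    using that x' by simp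
  ultimately show ?thesis using ext_push_eq_iff[OF x f, of "Zero C K B"] x' B by auto
qed

lemma ext_map_if_push_inclusion_splits:
  assumes x: "x \<in> extensions C A K" and y: "y \<in> extensions C B K"
    and split: "ext_push C (fst x) (ext_class C y) = split_extensions C B (middle C x)"
  obtains a where "a \<in> Hom C B A" "ext_map C y x (Ident C K) a"
proof -
  note x' = extensions_typing[OF x] and y' = extensions_typing[OF y]
  obtain g where g: "g \<in> Hom C (middle C y) (middle C x)" "fst x = g \<^bold>\<circ> fst y"
    using split ext_push_eq_split_iff[OF y x'(1)] by blast
  have "(snd x \<^bold>\<circ> g) \<^bold>\<circ> fst y = Zero C K A"
    using g x' y' extensions_exact(5)[OF x] by simp
  then obtain a where a: "a \<in> Hom C B A" "a \<^bold>\<circ> snd y = snd x \<^bold>\<circ> g"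
    using extension_desc[OF y, of "snd x \<^bold>\<circ> g" A] g(1) x' by auto
  have "ext_map C y x (Ident C K) a" unfolding ext_map_iff[OF y x] using a g x' y' by auto
  with a(1) show thesis by (rule that)
qed

lemma natural_transformation_is_pull:
  assumes proj: "enough_projectives C" and B: "B \<in> Obj C"
    and x: "projective_presentation C A K x" and X: "K \<in> X" "middle C x \<in> X"
    and \<phi>: "natural_transformation C X (Ext1_cov C A) (Ext1_cov C B) \<phi>"
  shows "\<exists>a \<in> Hom C B A. \<forall>Y \<in> X. \<forall>\<xi> \<in> carrier (Ext1 C A Y). \<phi> Y \<xi> = ext_pull C a \<xi>"
proof -
  have xe: "x \<in> extensions C A K" using x by (simp add: projective_presentation_def)
  note x' = extensions_typing[OF xe] and \<xi> = presentation_class_carrier[OF x]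
  note natural = natural_transformationD[OF \<phi>, unfolded Ext1_functor_simps]
  obtain y where y: "y \<in> extensions C B K" "\<phi> K (ext_class C x) = ext_class C y"
    using natural(2)[OF X(1) \<xi>] unfolding carrier_Ext1 by blast
  have "ext_push C (fst x) (ext_class C x) = split_extensions C A (middle C x)"
    unfolding ext_push_eq_split_iff[OF xe x'(1)]
    using x' by (intro bexI[of _ "Ident C (middle C x)"]) simp_all
  then have "ext_push C (fst x) (ext_class C y) = \<phi> (middle C x) \<one>\<^bsub>Ext1 C A (middle C x)\<^esub>"
    using natural(3)[OF X x'(1) \<xi>] y(2) by simp
  also have "\<dots> = split_extensions C B (middle C x)"
    using hom_one[OF natural(1)[OF X(2)]] Ext1_comm_group[OF proj x'(3,5)]
      Ext1_comm_group[OF proj B x'(5)]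
    by (simp add: comm_group_def)
  finally obtain a where a: "a \<in> Hom C B A" and yx: "ext_map C y x (Ident C K) a"
    by (rule ext_map_if_push_inclusion_splits[OF xe y(1)])
  have "\<phi> Y \<eta> = ext_pull C a \<eta>" if Y: "Y \<in> X" and \<eta>: "\<eta> \<in> carrier (Ext1 C A Y)" for Y \<eta>
  proof -
    obtain f where f: "f \<in> Hom C K Y" "\<eta> = ext_push C f (ext_class C x)"
      by (rule ext_push_presentation_surj[OF x \<eta>])
    have "\<phi> Y \<eta> = ext_push C f (ext_pull C a (ext_class C x))"
      using natural(3)[OF X(1) Y f(1) \<xi>] f(2) y(2) ext_pull_eq[OF xe y(1) yx] by simp
    also have "\<dots> = ext_pull C a \<eta>" using ext_push_pull[OF \<xi> a f(1)] f(2) by simp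
    finally show ?thesis .
  qed
  with a show ?thesis by blast
qed

lemma ext_pull_stable_cong:
  assumes \<xi>: "\<xi> \<in> carrier (Ext1 C A Y)" and a: "a \<in> Hom C B A" and a': "a' \<in> Hom C B A"
    and stable: "stable_class C (projective C) a = stable_class C (projective C) a'"
  shows "ext_pull C a \<xi> = ext_pull C a' \<xi>"
proof -
  interpret stable_ideal C "projective C" by (rule projective_stable_ideal)
  obtain x where x: "x \<in> extensions C A Y" "\<xi> = ext_class C x" using \<xi> carrier_Ext1 by blast
  note x' = extensions_typing[OF x(1)]
  have "null (a \<^bold>+ neg a')" using stable stable_arr_eq_iff[OF a a'] by simp
  then obtain Q u v where Q: "projective C Q"
    and uv: "u \<in> Hom C B Q" "v \<in> Hom C Q A" "a \<^bold>+ neg a' = v \<^bold>\<circ> u"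
    using nullE[of "a \<^bold>+ neg a'" B A] a a' by auto
  obtain w where w: "w \<in> Hom C Q (middle C x)" "snd x \<^bold>\<circ> w = v"
    using projective_lift[OF Q extensions_exact(4)[OF x(1)], of v] uv(2) x' by auto
  have "snd x \<^bold>\<circ> w \<^bold>\<circ> u = a \<^bold>+ neg a'" using comp_eq_precomp[OF w(2), of u] w(1) uv x' by simp
  then have "a = a' \<^bold>+ snd x \<^bold>\<circ> w \<^bold>\<circ> u" using a a' by simp
  then show ?thesis
    unfolding x(2) ext_pull_eq_iff[OF x(1) a a']
    using w(1) uv(1) by (intro bexI[of _ "w \<^bold>\<circ> u"]) simp_all
qed

lemma ext_pull_faithful:
  assumes x: "projective_presentation C A K x" and a: "a \<in> Hom C B A" and a': "a' \<in> Hom C B A"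
    and eq: "ext_pull C a (ext_class C x) = ext_pull C a' (ext_class C x)"
  shows "stable_class C (projective C) a = stable_class C (projective C) a'"
proof -
  interpret stable_ideal C "projective C" by (rule projective_stable_ideal)
  have xe: "x \<in> extensions C A K" and P: "projective C (middle C x)"
    using x by (simp_all add: projective_presentation_def)
  note x' = extensions_typing[OF xe]
  obtain g where g: "g \<in> Hom C B (middle C x)" "a = a' \<^bold>+ snd x \<^bold>\<circ> g"
    using eq ext_pull_eq_iff[OF xe a a'] by blast
  have "a \<^bold>+ neg a' = snd x \<^bold>\<circ> g" unfolding g(2) using g(1) a' x' by (simp add: plus_assoc)
  then show ?thesis unfolding stable_arr_eq_iff[OF a a'] using nullI[OF P g(1) x'(2)] by simp
qed

lemma functor_retract_idempotent:
  assumes proj: "enough_projectives C" and x: "projective_presentation C A K x"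
    and X: "K \<in> X" "middle C x \<in> X"
    and retract: "functor_retract C X F (Ext1_cov C A) \<iota> \<pi>"
  obtains a
    where "a \<in> Hom C A A" "stable_class C (projective C) (a \<^bold>\<circ> a) = stable_class C (projective C) a"
    "\<And>Y \<xi>. Y \<in> X \<Longrightarrow> \<xi> \<in> carrier (Ext1 C A Y) \<Longrightarrow> \<iota> Y (\<pi> Y \<xi>) = ext_pull C a \<xi>"
proof -
  have \<iota>: "natural_transformation C X F (Ext1_cov C A) \<iota>"
    and \<pi>: "natural_transformation C X (Ext1_cov C A) F \<pi>"
    and \<pi>\<iota>: "\<And>Y u. Y \<in> X \<Longrightarrow> u \<in> carrier (FObj F Y) \<Longrightarrow> \<pi> Y (\<iota> Y u) = u"
    using retract unfolding functor_retract_def by blast+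
  have A: "A \<in> Obj C"
    using x extensions_typing(3)[of x A K] by (simp add: projective_presentation_def)
  obtain a where a: "a \<in> Hom C A A"
    and "\<forall>Y \<in> X. \<forall>\<xi> \<in> carrier (Ext1 C A Y). \<iota> Y (\<pi> Y \<xi>) = ext_pull C a \<xi>"
    using natural_transformation_is_pull[OF proj A x X natural_transformation_comp[OF \<pi> \<iota>]] by blast
  then have \<iota>\<pi>: "\<And>Y \<xi>. Y \<in> X \<Longrightarrow> \<xi> \<in> carrier (Ext1 C A Y) \<Longrightarrow> \<iota> Y (\<pi> Y \<xi>) = ext_pull C a \<xi>" by blast
  note \<xi> = presentation_class_carrier[OF x]
  have "ext_pull C (a \<^bold>\<circ> a) (ext_class C x) = \<iota> K (\<pi> K (\<iota> K (\<pi> K (ext_class C x))))"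
    using ext_pull_comp[OF \<xi> a a] \<iota>\<pi>[OF X(1) \<xi>] \<iota>\<pi>[OF X(1) ext_pull_closed[OF \<xi> a]] by simp
  also have "\<dots> = \<iota> K (\<pi> K (ext_class C x))"
    using natural_transformationD(2)[OF \<pi> X(1)] \<pi>\<iota>[OF X(1)] \<xi> by simp
  also have "\<dots> = ext_pull C a (ext_class C x)" by (rule \<iota>\<pi>[OF X(1) \<xi>])
  finally have "stable_class C (projective C) (a \<^bold>\<circ> a) = stable_class C (projective C) a"
    by (intro ext_pull_faithful[OF x _ a]) (use a in simp_all)
  with a show thesis using \<iota>\<pi> by (rule that)
qed

lemma stable_retract_functor_retract:
  assumes proj: "enough_projectives C" and r: "r \<in> Hom C A B" and s: "s \<in> Hom C B A"
    and retract: "stable_class C (projective C) (r \<^bold>\<circ> s) =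
      stable_class C (projective C) (Ident C B)"
  shows "functor_retract C X (Ext1_cov C B) (Ext1_cov C A) (\<lambda>_. ext_pull C r) (\<lambda>_. ext_pull C s)"
proof -
  have "ext_pull C s (ext_pull C r \<xi>) = \<xi>" if \<xi>: "\<xi> \<in> carrier (Ext1 C B Y)" for Y \<xi>
  proof -
    have "ext_pull C s (ext_pull C r \<xi>) = ext_pull C (r \<^bold>\<circ> s) \<xi>"
      using ext_pull_comp[OF \<xi> r s] by simp
    also have "\<dots> = ext_pull C (Ident C B) \<xi>"
      by (rule ext_pull_stable_cong[OF \<xi> _ _ retract]) (use r s Hom_objs[OF s] in simp_all)
    finally show ?thesis unfolding ext_pull_ident[OF \<xi>] .
  qed
  then show ?thesis
    unfolding functor_retract_def
    using ext_pull_natural[OF proj r] ext_pull_natural[OF proj s] by simp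
qed

end

lemma (in stable_subcategory) stable_idempotent_splits:
  assumes split: "has_split_idempotents stable" and A: "A \<in> X"
    and a: "a \<in> Hom C A A" "\<langle>a \<^bold>\<circ> a\<rangle> = \<langle>a\<rangle>"
  obtains B r s
    where "B \<in> X" "r \<in> Hom C A B" "s \<in> Hom C B A" "\<langle>r \<^bold>\<circ> s\<rangle> = \<langle>Ident C B\<rangle>" "\<langle>s \<^bold>\<circ> r\<rangle> = \<langle>a\<rangle>"
proof -
  have "\<langle>a\<rangle> \<in> Hom stable A A" "\<langle>a\<rangle> \<^bold>\<circ>\<^bsub>stable\<^esub> \<langle>a\<rangle> = \<langle>a\<rangle>" using a A by simp_all
  then obtain B u v where B: "B \<in> X" and u: "u \<in> Hom stable A B" and v: "v \<in> Hom stable B A"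
    and eqs: "u \<^bold>\<circ>\<^bsub>stable\<^esub> v = Ident stable B" "v \<^bold>\<circ>\<^bsub>stable\<^esub> u = \<langle>a\<rangle>"
    using split A unfolding has_split_idempotents_def stable_simps by blast
  obtain r where r: "r \<in> Hom C A B" "u = \<langle>r\<rangle>" by (rule stable_HomE[OF u])
  obtain s where s: "s \<in> Hom C B A" "v = \<langle>s\<rangle>" by (rule stable_HomE[OF v])
  show thesis by (rule that[OF B r(1) s(1)]) (use eqs r s in simp_all)
qed

theorem (in abelian_category) Ext1_cov_summand:
  fixes F :: "('a, 'b, 'g) ab_functor" and G :: "('a, 'b, 'h) ab_functor"
  assumes proj: "enough_projectives C" and X: "X \<subseteq> Obj C" "\<And>P. projective C P \<Longrightarrow> P \<in> X"
    and kernels: "closed_kernels_of_epis C X"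
    and split: "has_split_idempotents (stable_cat C X (projective C))"
    and A: "A \<in> X" and summand: "direct_summand_compl C X F G (Ext1_cov C A)"
  shows "\<exists>B \<in> X. functor_iso C X F (Ext1_cov C B)"
proof -
  interpret stable_subcategory C "projective C" X
    by (intro stable_subcategory.intro projective_stable_ideal stable_subcategory_axioms.intro X(1))
  have A_obj: "A \<in> Obj C" using A X(1) by blast
  obtain x K where x: "projective_presentation C A K x"
    by (rule ex_projective_presentation[OF proj A_obj])
  then have xe: "x \<in> extensions C A K" and P: "middle C x \<in> X"
    using X(2) by (simp_all add: projective_presentation_def)
  have K: "K \<in> X"
    using kernels extensions_exact(1,4)[OF xe] extensions_typing[OF xe] P A
    unfolding closed_kernels_of_epis_def
    by force
  obtain \<iota> \<pi> where retract: "functor_retract C X F (Ext1_cov C A) \<iota> \<pi>"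
    by (rule direct_summand_retract[OF Ext1_cov_additive[OF proj X(1) A_obj] summand])
  let ?stable = "stable_class C (projective C)"
  obtain a where a: "a \<in> Hom C A A" "?stable (a \<^bold>\<circ> a) = ?stable a"
    and \<iota>\<pi>: "\<And>Y \<xi>. Y \<in> X \<Longrightarrow> \<xi> \<in> carrier (Ext1 C A Y) \<Longrightarrow> \<iota> Y (\<pi> Y \<xi>) = ext_pull C a \<xi>"
    using functor_retract_idempotent[OF proj x K P retract] by metis
  obtain B r s where B: "B \<in> X" and r: "r \<in> Hom C A B" and s: "s \<in> Hom C B A"
    and rs: "?stable (r \<^bold>\<circ> s) = ?stable (Ident C B)" and sr: "?stable (s \<^bold>\<circ> r) = ?stable a"
    by (rule stable_idempotent_splits[OF split A a])
  have "\<iota> Y (\<pi> Y \<xi>) = ext_pull C r (ext_pull C s \<xi>)" if Y: "Y \<in> X" and \<xi>: "\<xi> \<in> carrier (Ext1 C A Y)"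
    for Y \<xi>
    using \<iota>\<pi>[OF Y \<xi>] ext_pull_comp[OF \<xi> s r] ext_pull_stable_cong[OF \<xi> comp_hom[OF r s] a(1) sr]
    by simp
  then have "functor_iso C X F (Ext1_cov C B)"
    by (intro functor_iso_of_retracts[OF retract stable_retract_functor_retract[OF proj r s rs]])
      simp
  with B show ?thesis by blast
qed


section \<open>Splitting idempotents in Krull--Schmidt categories\<close>

definition split_idempotent :: "('o, 'm) cat \<Rightarrow> 'o \<Rightarrow> 'm \<Rightarrow> bool" where
  "split_idempotent C A e \<longleftrightarrow>
     (\<exists>B \<in> Obj C. \<exists>r \<in> Hom C A B. \<exists>s \<in> Hom C B A. r \<^bold>\<circ>\<^bsub>C\<^esub> s = Ident C B \<and> s \<^bold>\<circ>\<^bsub>C\<^esub> r = e)"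

locale additive_category = preadditive_category +
  assumes ex_null_object: "\<exists>Z \<in> Obj C. Ident C Z = Zero C Z Z"
    and ex_direct_sum: "A \<in> Obj C \<Longrightarrow> B \<in> Obj C \<Longrightarrow>
      \<exists>S i\<^sub>1 i\<^sub>2 p\<^sub>1 p\<^sub>2. is_biproduct C A B S i\<^sub>1 i\<^sub>2 p\<^sub>1 p\<^sub>2"
begin

lemma split_idempotent_zero:
  assumes "A \<in> Obj C"
  shows "split_idempotent C A (Zero C A A)"
proof -
  obtain Z where "Z \<in> Obj C" "Ident C Z = Zero C Z Z" using ex_null_object by blast
  then show ?thesis
    unfolding split_idempotent_def using assms
    by (intro bexI[of _ Z] bexI[of _ "Zero C A Z"] bexI[of _ "Zero C Z A"]) simp_all
qed

lemma split_idempotent_plus: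
  assumes "split_idempotent C A e" "split_idempotent C A f"
    and ef: "e \<^bold>\<circ> f = Zero C A A" and fe: "f \<^bold>\<circ> e = Zero C A A"
  shows "split_idempotent C A (e \<^bold>+ f)"
proof -
  obtain B r s where e: "r \<in> Hom C A B" "s \<in> Hom C B A" "r \<^bold>\<circ> s = Ident C B" "s \<^bold>\<circ> r = e"
    using assms(1) unfolding split_idempotent_def by blast
  obtain D t u where f: "t \<in> Hom C A D" "u \<in> Hom C D A" "t \<^bold>\<circ> u = Ident C D" "u \<^bold>\<circ> t = f"
    using assms(2) unfolding split_idempotent_def by blast
  note objs = Hom_objs[OF e(1)] Hom_objs[OF f(1)]
  have endo: "e \<in> Hom C A A" "f \<in> Hom C A A" using e f by auto
  obtain T i\<^sub>1 i\<^sub>2 p\<^sub>1 p\<^sub>2 where T: "is_biproduct C B D T i\<^sub>1 i\<^sub>2 p\<^sub>1 p\<^sub>2"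
    using ex_direct_sum objs by blast
  note T' = biproduct_typing[OF T] biproduct_eqs[OF T] and comp = biproduct_eqs_comp[OF T]
  have absorb: "r \<^bold>\<circ> e = r" "e \<^bold>\<circ> s = s" "t \<^bold>\<circ> f = t" "f \<^bold>\<circ> u = u"
    using comp_eq_precomp[OF e(3), of r] comp_eq_precomp[OF f(3), of t] e(1-3) f(1-3)
    by (simp_all flip: e(4) f(4))
  have "r \<^bold>\<circ> u = (r \<^bold>\<circ> e) \<^bold>\<circ> f \<^bold>\<circ> u" unfolding absorb ..
  also have "\<dots> = r \<^bold>\<circ> (e \<^bold>\<circ> f) \<^bold>\<circ> u" using e f by auto
  finally have ru: "r \<^bold>\<circ> u = Zero C D B" unfolding ef using e(1) f(2) objs by simp
  have "t \<^bold>\<circ> s = (t \<^bold>\<circ> f) \<^bold>\<circ> e \<^bold>\<circ> s" unfolding absorb ..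
  also have "\<dots> = t \<^bold>\<circ> (f \<^bold>\<circ> e) \<^bold>\<circ> s" using e f by auto
  finally have ts: "t \<^bold>\<circ> s = Zero C B D" unfolding fe using e(2) f(1) objs by simp
  note eqs = comp_eq_precomp[OF e(3)] comp_eq_precomp[OF f(3)] comp_eq_precomp[OF ru]
    comp_eq_precomp[OF ts]
  have "(i\<^sub>1 \<^bold>\<circ> r \<^bold>+ i\<^sub>2 \<^bold>\<circ> t) \<^bold>\<circ> (s \<^bold>\<circ> p\<^sub>1 \<^bold>+ u \<^bold>\<circ> p\<^sub>2) = Ident C T"
    using e(1,2) f(1,2) T' eqs by (simp add: distrib)
  moreover have "(s \<^bold>\<circ> p\<^sub>1 \<^bold>+ u \<^bold>\<circ> p\<^sub>2) \<^bold>\<circ> (i\<^sub>1 \<^bold>\<circ> r \<^bold>+ i\<^sub>2 \<^bold>\<circ> t) = e \<^bold>+ f"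
    using e f T' comp objs endo by (simp add: distrib)
  ultimately show ?thesis
    unfolding split_idempotent_def using e(1,2) f(1,2) T'
    by (intro bexI[of _ T] bexI[of _ "i\<^sub>1 \<^bold>\<circ> r \<^bold>+ i\<^sub>2 \<^bold>\<circ> t"] bexI[of _ "s \<^bold>\<circ> p\<^sub>1 \<^bold>+ u \<^bold>\<circ> p\<^sub>2"])
      simp_all
qed

end

context preadditive_category begin

definition is_unit :: "'a \<Rightarrow> 'b \<Rightarrow> bool" where
  "is_unit B d \<longleftrightarrow> (\<exists>d' \<in> Hom C B B. d' \<^bold>\<circ> d = Ident C B \<and> d \<^bold>\<circ> d' = Ident C B)"

definition has_local_endomorphisms :: "'a \<Rightarrow> bool" where
  "has_local_endomorphisms B \<longleftrightarrow>
    B \<in> Obj C \<and> (\<forall>d \<in> Hom C B B. is_unit B d \<or> is_unit B (Ident C B \<^bold>+ neg d))"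

lemma local_ring_has_local_endomorphisms:
  assumes loc: "local_ring (end_ring C B)" and B: "B \<in> Obj C"
  shows "has_local_endomorphisms B"
proof -
  have Units: "d \<in> Units (end_ring C B) \<longleftrightarrow> d \<in> Hom C B B \<and> is_unit B d" for d
    by (auto simp: Units_def is_unit_def end_ring_def)
  have "is_unit B d \<or> is_unit B (Ident C B \<^bold>+ neg d)" if d: "d \<in> Hom C B B" for d
  proof -
    have "Ident C B \<in> Units (end_ring C B)"
      unfolding Units is_unit_def using B by (auto intro!: bexI[of _ "Ident C B"])
    moreover have "d \<^bold>+ (Ident C B \<^bold>+ neg d) = Ident C B" using d B by simp
    ultimately have "d \<oplus>\<^bsub>end_ring C B\<^esub> (Ident C B \<^bold>+ neg d) \<in> Units (end_ring C B)"
      by (simp add: end_ring_def)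
    moreover have "{d, Ident C B \<^bold>+ neg d} \<subseteq> carrier (end_ring C B)"
      using d B by (simp add: end_ring_def)
    ultimately have "d \<in> Units (end_ring C B) \<or> Ident C B \<^bold>+ neg d \<in> Units (end_ring C B)"
      using loc unfolding local_ring_def by blast
    then show ?thesis unfolding Units by blast
  qed
  with B show ?thesis unfolding has_local_endomorphisms_def by blast
qed

text \<open>Since \<open>ex(1 - yex) = egex\<close>, the arrow \<open>ex\<close>, and with it
  \<open>e = eg + exy\<close>, factors through \<open>g\<close>.\<close>

lemma idempotent_factor_if_corner_complement_unit:
  assumes e: "e \<in> Hom C A A" "e \<^bold>\<circ> e = e" and g: "g \<in> Hom C A A" and x: "x \<in> Hom C B A"
    and y: "y \<in> Hom C A B"
    and sum: "e = g \<^bold>+ x \<^bold>\<circ> y" and unit: "is_unit B (Ident C B \<^bold>+ neg (y \<^bold>\<circ> e \<^bold>\<circ> x))"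
  obtains h where "h \<in> Hom C A A" "e = e \<^bold>\<circ> g \<^bold>\<circ> h"
proof -
  note objs = Hom_objs[OF x]
  obtain d where d: "d \<in> Hom C B B" "(Ident C B \<^bold>+ neg (y \<^bold>\<circ> e \<^bold>\<circ> x)) \<^bold>\<circ> d = Ident C B"
    using unit unfolding is_unit_def by blast
  have expand: "e \<^bold>\<circ> g \<^bold>\<circ> k \<^bold>+ e \<^bold>\<circ> x \<^bold>\<circ> y \<^bold>\<circ> k = e \<^bold>\<circ> k" if k: "k \<in> Hom C D A" for k D
  proof -
    have "e \<^bold>\<circ> g \<^bold>\<circ> k \<^bold>+ e \<^bold>\<circ> x \<^bold>\<circ> y \<^bold>\<circ> k = e \<^bold>\<circ> (g \<^bold>+ x \<^bold>\<circ> y) \<^bold>\<circ> k"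
      using e(1) g x y k by (simp add: distrib)
    also have "\<dots> = e \<^bold>\<circ> k"
      unfolding sum[symmetric] using comp_eq_precomp[OF e(2), of k] e(1) k by simp
    finally show ?thesis .
  qed
  have "e \<^bold>\<circ> x = e \<^bold>\<circ> x \<^bold>\<circ> (Ident C B \<^bold>+ neg (y \<^bold>\<circ> e \<^bold>\<circ> x)) \<^bold>\<circ> d"
    unfolding d(2) using e(1) x objs by simp
  also have "\<dots> = (e \<^bold>\<circ> x \<^bold>+ neg (e \<^bold>\<circ> x \<^bold>\<circ> y \<^bold>\<circ> e \<^bold>\<circ> x)) \<^bold>\<circ> d"
    using e(1) x y d(1) objs by (simp add: distrib)
  also have "e \<^bold>\<circ> x \<^bold>+ neg (e \<^bold>\<circ> x \<^bold>\<circ> y \<^bold>\<circ> e \<^bold>\<circ> x) = e \<^bold>\<circ> g \<^bold>\<circ> e \<^bold>\<circ> x"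
    by (rule minus_eq_if_plus_eq)
      (use expand[of "e \<^bold>\<circ> x" B] comp_eq_precomp[OF e(2), of x] e(1) g x y in simp_all)
  finally have ex: "e \<^bold>\<circ> x = e \<^bold>\<circ> g \<^bold>\<circ> e \<^bold>\<circ> x \<^bold>\<circ> d" using e(1) g x d(1) by simp
  have "e = e \<^bold>\<circ> g \<^bold>+ (e \<^bold>\<circ> x) \<^bold>\<circ> y" using expand[of "Ident C A" A] e(1) g x y objs by simp
  also have "\<dots> = e \<^bold>\<circ> g \<^bold>\<circ> (Ident C A \<^bold>+ e \<^bold>\<circ> x \<^bold>\<circ> d \<^bold>\<circ> y)"
    unfolding ex using e(1) g x y d(1) objs by (simp add: distrib)
  finally have "e = e \<^bold>\<circ> g \<^bold>\<circ> (Ident C A \<^bold>+ e \<^bold>\<circ> x \<^bold>\<circ> d \<^bold>\<circ> y)" .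
  moreover have "Ident C A \<^bold>+ e \<^bold>\<circ> x \<^bold>\<circ> d \<^bold>\<circ> y \<in> Hom C A A" using e(1) x y d(1) objs by simp
  ultimately show thesis using that by blast
qed

text \<open>The summand \<open>B\<close> is embedded by \<open>u = ex\<close>; the rest \<open>w = e - uv\<close> kills \<open>x\<close>, so that
  \<open>w = we = wg\<close>.\<close>

lemma idempotent_split_off_if_corner_unit:
  assumes e: "e \<in> Hom C A A" "e \<^bold>\<circ> e = e" and g: "g \<in> Hom C A A" and x: "x \<in> Hom C B A"
    and y: "y \<in> Hom C A B"
    and sum: "e = g \<^bold>+ x \<^bold>\<circ> y" and unit: "is_unit B (y \<^bold>\<circ> e \<^bold>\<circ> x)"
  obtains u v w where "u \<in> Hom C B A" "v \<in> Hom C A B" "w \<in> Hom C A A" "v \<^bold>\<circ> u = Ident C B"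
    "e = w \<^bold>+ u \<^bold>\<circ> v" "w \<^bold>\<circ> w = w" "w \<^bold>\<circ> u = Zero C B A" "v \<^bold>\<circ> w = Zero C A B" "w = w \<^bold>\<circ> g"
proof -
  note objs = Hom_objs[OF x]
  obtain d where d: "d \<in> Hom C B B" "d \<^bold>\<circ> y \<^bold>\<circ> e \<^bold>\<circ> x = Ident C B"
    using unit unfolding is_unit_def by blast
  define u where "u = e \<^bold>\<circ> x"
  define v where "v = d \<^bold>\<circ> y \<^bold>\<circ> e"
  define w where "w = e \<^bold>+ neg (u \<^bold>\<circ> v)"
  have u: "u \<in> Hom C B A" and v: "v \<in> Hom C A B" using e(1) x y d(1) by (simp_all add: u_def v_def)
  then have w: "w \<in> Hom C A A" using e(1) by (simp add: w_def)
  have eu: "e \<^bold>\<circ> u = u" using comp_eq_precomp[OF e(2), of x] e(1) x by (simp add: u_def)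
  have ve: "v \<^bold>\<circ> e = v" using e d(1) y by (simp add: v_def)
  have vx: "v \<^bold>\<circ> x = Ident C B" using d e(1) x y by (simp add: v_def)
  have "v \<^bold>\<circ> u = (v \<^bold>\<circ> e) \<^bold>\<circ> x" using e(1) v x by (simp add: u_def)
  then have vu: "v \<^bold>\<circ> u = Ident C B" unfolding ve vx .
  have wu: "w \<^bold>\<circ> u = Zero C B A" using eu vu e(1) u v objs by (simp add: w_def distrib)
  have vw: "v \<^bold>\<circ> w = Zero C A B"
    using comp_eq_precomp[OF vu, of v] ve e(1) u v objs by (simp add: w_def distrib)
  have "u \<^bold>\<circ> v \<^bold>\<circ> x = e \<^bold>\<circ> x" unfolding vx using u objs by (simp add: u_def)
  then have wx: "w \<^bold>\<circ> x = Zero C B A" using e(1) u v x by (simp add: w_def distrib)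
  have we: "w \<^bold>\<circ> e = w" using e ve u v by (simp add: w_def distrib)
  have "w \<^bold>\<circ> e = w \<^bold>\<circ> g \<^bold>+ w \<^bold>\<circ> x \<^bold>\<circ> y" unfolding sum using w g x y by (simp add: distrib)
  then have wg: "w = w \<^bold>\<circ> g" unfolding we using comp_eq_precomp[OF wx, of y] w g x y objs by simp
  have sum: "e = w \<^bold>+ u \<^bold>\<circ> v" using e(1) u v by (simp add: w_def plus_assoc)
  have "w \<^bold>\<circ> e = w \<^bold>\<circ> w \<^bold>+ w \<^bold>\<circ> u \<^bold>\<circ> v" unfolding sum using w u v by (simp add: distrib)
  then have ww: "w \<^bold>\<circ> w = w" unfolding we using comp_eq_precomp[OF wu, of v] w u v objs by simp
  show thesis by (rule that[OF u v w vu sum ww wu vw wg])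
qed

inductive_set ideal_generated :: "'a set \<Rightarrow> 'a \<Rightarrow> 'a \<Rightarrow> 'b set" for \<B> S T where
  zero: "Zero C S T \<in> ideal_generated \<B> S T"
| plus: "f \<in> ideal_generated \<B> S T \<Longrightarrow> B \<in> \<B> \<Longrightarrow> y \<in> Hom C S B \<Longrightarrow> x \<in> Hom C B T \<Longrightarrow>
    f \<^bold>+ x \<^bold>\<circ> y \<in> ideal_generated \<B> S T"

lemma ideal_generated_Hom:
  assumes "S \<in> Obj C" "T \<in> Obj C" "f \<in> ideal_generated \<B> S T"
  shows "f \<in> Hom C S T"
  using assms(3,1,2) by (induction rule: ideal_generated.induct) simp_all

lemma finite_direct_sum_ident_in_ideal:
  assumes "is_finite_direct_sum C n B S"
  shows "Ident C S \<in> ideal_generated (B ` {..<n}) S S"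
proof -
  obtain i p where S: "S \<in> Obj C" and ip: "\<forall>k<n. i k \<in> Hom C (B k) S \<and> p k \<in> Hom C S (B k)"
    and sum: "finprod (hom_group C S S) (\<lambda>k. i k \<^bold>\<circ> p k) {..<n} = Ident C S"
    using assms unfolding is_finite_direct_sum_def by blast
  interpret comm_group "hom_group C S S" by (rule hom_comm_group[OF S S])
  have "finprod (hom_group C S S) (\<lambda>k. i k \<^bold>\<circ> p k) {..<m} \<in> ideal_generated (B ` {..<n}) S S"
    if "m \<le> n" for m
    using that
  proof (induction m)
    case 0
    show ?case using ideal_generated.zero by simp
  next
    case (Suc m)
    let ?s = "finprod (hom_group C S S) (\<lambda>k. i k \<^bold>\<circ> p k) {..<m}"
    have ip': "i k \<^bold>\<circ> p k \<in> Hom C S S" if "k \<le> m" for k using ip that Suc.prems by simp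
    have s: "?s \<in> ideal_generated (B ` {..<n}) S S" using Suc by simp
    have "finprod (hom_group C S S) (\<lambda>k. i k \<^bold>\<circ> p k) {..<Suc m} = i m \<^bold>\<circ> p m \<^bold>+ ?s"
      unfolding lessThan_Suc using ip' by (subst finprod_insert) (auto simp del: in_Hom)
    also have "\<dots> = ?s \<^bold>+ i m \<^bold>\<circ> p m"
      using ip'[of m] ideal_generated_Hom[OF S S s] plus_comm[of "i m \<^bold>\<circ> p m" ?s] by simp
    finally show ?case
      using ideal_generated.plus[OF s, of "B m" "p m" "i m"] ip Suc.prems by (simp del: in_Hom)
  qed
  from this[of n] show ?thesis unfolding sum by simp
qed

end

context additive_category begin

lemma split_idempotent_plus_local:
  assumes B: "has_local_endomorphisms B"
    and e: "e \<in> Hom C A A" "e \<^bold>\<circ> e = e" and g: "g \<in> Hom C A A" and x: "x \<in> Hom C B A"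
    and y: "y \<in> Hom C A B" and sum: "e = g \<^bold>+ x \<^bold>\<circ> y"
    and through_g: "\<And>f h k. f \<^bold>\<circ> f = f \<Longrightarrow> f = h \<^bold>\<circ> g \<^bold>\<circ> k \<Longrightarrow> h \<in> Hom C A A \<Longrightarrow> k \<in> Hom C A A \<Longrightarrow>
      split_idempotent C A f"
  shows "split_idempotent C A e"
proof -
  have "y \<^bold>\<circ> e \<^bold>\<circ> x \<in> Hom C B B" using e(1) x y by simp
  then consider (complement_unit) "is_unit B (Ident C B \<^bold>+ neg (y \<^bold>\<circ> e \<^bold>\<circ> x))"
    | (corner_unit) "is_unit B (y \<^bold>\<circ> e \<^bold>\<circ> x)"
    using B unfolding has_local_endomorphisms_def by blast
  then show ?thesis
  proof cases
    case complement_unit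
    obtain h where "h \<in> Hom C A A" "e = e \<^bold>\<circ> g \<^bold>\<circ> h"
      by (rule idempotent_factor_if_corner_complement_unit[OF e g x y sum complement_unit])
    then show ?thesis using through_g e by blast
  next
    case corner_unit
    obtain u v w where uvw: "u \<in> Hom C B A" "v \<in> Hom C A B" "w \<in> Hom C A A"
      and vu: "v \<^bold>\<circ> u = Ident C B" and e_eq: "e = w \<^bold>+ u \<^bold>\<circ> v" and ww: "w \<^bold>\<circ> w = w"
      and orth: "w \<^bold>\<circ> u = Zero C B A" "v \<^bold>\<circ> w = Zero C A B" and wg: "w = w \<^bold>\<circ> g"
      by (rule idempotent_split_off_if_corner_unit[OF e g x y sum corner_unit])
    note objs = Hom_objs[OF uvw(1)]
    have "w = w \<^bold>\<circ> g \<^bold>\<circ> Ident C A" using wg g by simp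
    then have "split_idempotent C A w"
      using through_g[OF ww _ uvw(3)] ident_hom[OF objs(2)] by blast
    moreover have "split_idempotent C A (u \<^bold>\<circ> v)"
      unfolding split_idempotent_def using uvw vu objs by blast
    moreover have "w \<^bold>\<circ> u \<^bold>\<circ> v = Zero C A A" "(u \<^bold>\<circ> v) \<^bold>\<circ> w = Zero C A A"
      using comp_eq_precomp[OF orth(1), of v] orth(2) uvw objs by simp_all
    ultimately show ?thesis unfolding e_eq by (rule split_idempotent_plus)
  qed
qed

lemma split_idempotent_if_factors_through_ideal:
  assumes \<B>: "\<And>B. B \<in> \<B> \<Longrightarrow> has_local_endomorphisms B"
    and S: "S \<in> Obj C" and T: "T \<in> Obj C" and f: "f \<in> ideal_generated \<B> S T"
  shows "e \<^bold>\<circ> e = e \<Longrightarrow> e = a \<^bold>\<circ> f \<^bold>\<circ> b \<Longrightarrow> a \<in> Hom C T A \<Longrightarrow> b \<in> Hom C A S \<Longrightarrow> split_idempotent C A e"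
  using f
proof (induction arbitrary: a b e rule: ideal_generated.induct)
  case zero
  then have "e = Zero C A A" using S T Hom_objs[OF zero.prems(3)] by simp
  then show ?case using split_idempotent_zero Hom_objs[OF zero.prems(3)] by simp
next
  case (plus f B y x)
  note a = plus.prems(3) and b = plus.prems(4)
  note f = ideal_generated_Hom[OF S T plus.hyps(1)]
  have sum: "e = a \<^bold>\<circ> f \<^bold>\<circ> b \<^bold>+ (a \<^bold>\<circ> x) \<^bold>\<circ> y \<^bold>\<circ> b"
    using plus.prems(2) a b f plus.hyps(3,4) by (simp add: distrib)
  show ?case
  proof (rule split_idempotent_plus_local[OF \<B>[OF plus.hyps(2)] _ plus.prems(1) _ _ _ sum])
    show "e \<in> Hom C A A" "a \<^bold>\<circ> f \<^bold>\<circ> b \<in> Hom C A A" "a \<^bold>\<circ> x \<in> Hom C B A" "y \<^bold>\<circ> b \<in> Hom C A B"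
      using plus.prems(2) a b f plus.hyps(3,4) by simp_all
    fix e' h k
    assume e': "e' \<^bold>\<circ> e' = e'" "e' = h \<^bold>\<circ> (a \<^bold>\<circ> f \<^bold>\<circ> b) \<^bold>\<circ> k"
      and hk: "h \<in> Hom C A A" "k \<in> Hom C A A"
    have "e' = (h \<^bold>\<circ> a) \<^bold>\<circ> f \<^bold>\<circ> b \<^bold>\<circ> k" using e'(2) hk a b f by simp
    then show "split_idempotent C A e'"
      using plus.IH[of e' "h \<^bold>\<circ> a" "b \<^bold>\<circ> k"] e'(1) hk a b by simp
  qed
qed

end

context stable_subcategory begin

sublocale stable: preadditive_category stable
  by (rule stable_preadditive)

lemma stable_neg: "f \<in> Hom C A B \<Longrightarrow> A \<in> X \<Longrightarrow> B \<in> X \<Longrightarrow> stable.neg \<langle>f\<rangle> = \<langle>neg f\<rangle>"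
  by (rule stable.neg_unique[symmetric]) simp_all

lemma stable_has_local_endomorphisms:
  assumes B: "B \<in> X" and loc: "has_local_endomorphisms B"
  shows "stable.has_local_endomorphisms B"
proof -
  have unit: "stable.is_unit B \<langle>d\<rangle>" if d: "d \<in> Hom C B B" and "is_unit B d" for d
  proof -
    obtain d' where d': "d' \<in> Hom C B B" "d' \<^bold>\<circ> d = Ident C B" "d \<^bold>\<circ> d' = Ident C B"
      using \<open>is_unit B d\<close> unfolding is_unit_def by blast
    then show ?thesis unfolding stable.is_unit_def using d B by (intro bexI[of _ "\<langle>d'\<rangle>"]) simp_all
  qed
  have "stable.is_unit B u \<or> stable.is_unit B (Ident stable B \<^bold>+\<^bsub>stable\<^esub> stable.neg u)"
    if u: "u \<in> Hom stable B B" for u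
  proof -
    obtain d where d: "d \<in> Hom C B B" "u = \<langle>d\<rangle>" using stable_HomE[OF u] .
    have "is_unit B d \<or> is_unit B (Ident C B \<^bold>+ neg d)"
      using loc d(1) unfolding has_local_endomorphisms_def by blast
    moreover have "Ident stable B \<^bold>+\<^bsub>stable\<^esub> stable.neg u = \<langle>Ident C B \<^bold>+ neg d\<rangle>"
      using d stable_neg[OF d(1) B B] Hom_objs[OF d(1)] by simp
    ultimately show ?thesis
      using unit[OF d(1)] unit[of "Ident C B \<^bold>+ neg d"] d Hom_objs[OF d(1)] by auto
  qed
  with B show ?thesis unfolding stable.has_local_endomorphisms_def by simp
qed

lemma stable_ideal_generated:
  assumes "\<B> \<subseteq> X" "S \<in> X" "T \<in> X" and f: "f \<in> ideal_generated \<B> S T"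
  shows "\<langle>f\<rangle> \<in> stable.ideal_generated \<B> S T"
  using f
proof (induction rule: ideal_generated.induct)
  case zero
  show ?case using stable.ideal_generated.zero by simp
next
  case (plus f B y x)
  have "f \<in> Hom C S T" using ideal_generated_Hom plus.hyps(1) assms X_obj by blast
  moreover have "\<langle>y\<rangle> \<in> Hom stable S B" "\<langle>x\<rangle> \<in> Hom stable B T" using plus.hyps assms by auto
  ultimately show ?case
    using stable.ideal_generated.plus[OF plus.IH plus.hyps(2), of "\<langle>y\<rangle>" "\<langle>x\<rangle>"] plus.hyps by simp
qed

lemma stable_additive:
  assumes X: "X = Obj C"
  shows "additive_category stable"
proof (intro additive_category.intro additive_category_axioms.intro stable_preadditive)
  have mem: "A \<in> X \<longleftrightarrow> A \<in> Obj C" for A using X by simp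
  obtain Z where Z: "is_zero_object C Z" using ex_zero_object by blast
  then have "Z \<in> Obj C" by (simp add: is_zero_object_def)
  moreover from this have "Ident C Z = Zero C Z Z"
    using Z ident_hom[of Z] zero_typing[of Z Z] unfolding is_zero_object_def by (metis in_Hom)
  ultimately show "\<exists>Z \<in> Obj stable. Ident stable Z = Zero stable Z Z" 
    using mem by (intro bexI[of _ Z]) simp_all
  fix A B assume "A \<in> Obj stable" "B \<in> Obj stable"
  then obtain S i\<^sub>1 i\<^sub>2 p\<^sub>1 p\<^sub>2 where S: "is_biproduct C A B S i\<^sub>1 i\<^sub>2 p\<^sub>1 p\<^sub>2"
    using ex_biproduct[of A B] mem by auto
  have "is_biproduct stable A B S \<langle>i\<^sub>1\<rangle> \<langle>i\<^sub>2\<rangle> \<langle>p\<^sub>1\<rangle> \<langle>p\<^sub>2\<rangle>"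
    unfolding is_biproduct_def using biproduct_typing[OF S] biproduct_eqs[OF S] mem by simp
  then show "\<exists>S i\<^sub>1 i\<^sub>2 p\<^sub>1 p\<^sub>2. is_biproduct stable A B S i\<^sub>1 i\<^sub>2 p\<^sub>1 p\<^sub>2" by blast
qed

lemma krull_schmidt_stable_split:
  assumes X: "X = Obj C" and ks: "krull_schmidt C"
  shows "has_split_idempotents stable"
  unfolding has_split_idempotents_def split_idempotent_def[symmetric]
proof (intro ballI impI)
  interpret stable: additive_category stable by (rule stable_additive[OF X])
  fix A u assume "A \<in> Obj stable" and u: "u \<in> Hom stable A A" and uu: "u \<^bold>\<circ>\<^bsub>stable\<^esub> u = u"
  have mem: "D \<in> X \<longleftrightarrow> D \<in> Obj C" for D using X by simp
  with \<open>A \<in> Obj stable\<close> have A: "A \<in> X" "A \<in> Obj C" by simp_all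
  obtain n B where sum: "is_finite_direct_sum C n B A"
    and loc: "\<forall>k<n. local_ring (end_ring C (B k))"
    using ks A unfolding krull_schmidt_def by blast
  then have B: "\<forall>k<n. B k \<in> Obj C" unfolding is_finite_direct_sum_def by blast
  have "stable.has_local_endomorphisms D" if "D \<in> B ` {..<n}" for D
    using that loc B mem stable_has_local_endomorphisms local_ring_has_local_endomorphisms by auto
  moreover have "\<langle>Ident C A\<rangle> \<in> stable.ideal_generated (B ` {..<n}) A A"
    using stable_ideal_generated[OF _ A(1) A(1) finite_direct_sum_ident_in_ideal[OF sum]] B mem
    by auto
  ultimately show "split_idempotent stable A u"
    using stable.split_idempotent_if_factors_through_ideal[of "B ` {..<n}" A A
        "\<langle>Ident C A\<rangle>" u u "\<langle>Ident C A\<rangle>" A]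
      stable.comp_ident(1)[of u A] u uu A by simp
qed

end


section \<open>Contravariant \<open>Ext\<^sup>1\<close>-functors\<close>

lemma factors_through_op [simp]: "factors_through (op_cat C) \<P> h \<longleftrightarrow> factors_through C \<P> h"
  unfolding factors_through_def by auto

lemma stable_class_op [simp]: "stable_class (op_cat C) \<P> f = stable_class C \<P> f"
  by (simp add: stable_class_def)

lemma stable_cat_op: "stable_cat (op_cat C) X \<P> = op_cat (stable_cat C X \<P>)"
  by (rule cat.equality) (auto simp: stable_cat_def fun_eq_iff)

lemma has_split_idempotents_op [simp]: "has_split_idempotents (op_cat D) \<longleftrightarrow> has_split_idempotents D"
  unfolding has_split_idempotents_def by (simp del: in_Hom) blast

context abelian_category begin

lemma Ext1_cov_op_iso:
  assumes inj: "enough_injectives C"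
  shows "functor_iso (op_cat C) X (Ext1_cov (op_cat C) A) (Ext1_contra C A)"
  unfolding functor_iso_iff natural_transformation_def Ext1_functor_simps
proof (intro exI[of _ "\<lambda>_. image prod.swap"] conjI ballI)
  interpret op: abelian_category "op_cat C" by (rule abelian_op)
  have swap_swap: "prod.swap ` prod.swap ` \<xi> = \<xi>" for \<xi> :: "('b \<times> 'b) set"
    by (simp add: image_image)
  fix Y
  have closed: "prod.swap ` \<xi> \<in> carrier (Ext1 C Y A)" if "\<xi> \<in> carrier (Ext1 (op_cat C) A Y)" for \<xi> Y
    using that by (auto simp: carrier_Ext1_op swap_swap)
  show "bij_betw (image prod.swap) (carrier (Ext1 (op_cat C) A Y)) (carrier (Ext1 C Y A))"
    by (rule bij_betw_byWitness[where f' = "image prod.swap"])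
      (auto simp: carrier_Ext1_op swap_swap)
  have push_op: "prod.swap ` ext_push (op_cat C) f \<xi> = ext_pull C f (prod.swap ` \<xi>)"
    if "\<xi> \<in> carrier (Ext1 (op_cat C) A K)" "f \<in> Hom C Y K" for \<xi> f K Y
    using ext_push_op[OF carrier_Ext1_subset[OF closed[OF that(1)]] that(2)]
    by (simp add: swap_swap)
  show "prod.swap ` ext_push (op_cat C) f \<xi> = ext_pull C f (prod.swap ` \<xi>)"
    if "f \<in> Hom (op_cat C) Y Y'" "\<xi> \<in> carrier (Ext1 (op_cat C) A Y)" for f Y' \<xi>
    using push_op that by (simp del: in_Hom)
  show "image prod.swap \<in> hom (Ext1 (op_cat C) A Y) (Ext1 C Y A)"
  proof (rule homI)
    fix \<xi> \<eta> assume "\<xi> \<in> carrier (Ext1 (op_cat C) A Y)" "\<eta> \<in> carrier (Ext1 (op_cat C) A Y)"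
    then obtain K \<omega> f g where \<omega>: "\<omega> \<in> carrier (Ext1 (op_cat C) A K)"
      and fg: "f \<in> Hom (op_cat C) K Y" "g \<in> Hom (op_cat C) K Y"
      "\<xi> = ext_push (op_cat C) f \<omega>" "\<eta> = ext_push (op_cat C) g \<omega>"
      using op.ext_push_common_source[of \<xi> A Y \<eta>] inj by auto
    have "f \<^bold>+ g \<in> Hom C Y K" using fg(1,2) by simp
    then show "prod.swap ` (\<xi> \<otimes>\<^bsub>Ext1 (op_cat C) A Y\<^esub> \<eta>) = prod.swap ` \<xi> \<otimes>\<^bsub>Ext1 C Y A\<^esub> prod.swap ` \<eta>"
      using fg op.ext_push_plus[OF \<omega> fg(1,2)]
      by (simp add: push_op[OF \<omega>] ext_pull_plus[OF closed[OF \<omega>]] del: in_Hom)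
  qed (rule closed)
qed

theorem Ext1_contra_summand:
  fixes F :: "('a, 'b, 'g) ab_functor" and G :: "('a, 'b, 'h) ab_functor"
  assumes inj: "enough_injectives C" and X: "X \<subseteq> Obj C" "\<And>I. injective C I \<Longrightarrow> I \<in> X"
    and cokernels: "closed_cokernels_of_monos C X"
    and split: "has_split_idempotents (stable_cat C X (injective C))"
    and A: "A \<in> X" and summand: "direct_summand_compl (op_cat C) X F G (Ext1_contra C A)"
  shows "\<exists>B \<in> X. functor_iso (op_cat C) X F (Ext1_contra C B)"
proof -
  have "direct_summand_compl (op_cat C) X F G (Ext1_cov (op_cat C) A)"
    using summand functor_iso_trans[OF Ext1_cov_op_iso[OF inj]]
    unfolding direct_summand_compl_def by blast
  then obtain B where "B \<in> X" "functor_iso (op_cat C) X F (Ext1_cov (op_cat C) B)"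
    using abelian_category.Ext1_cov_summand[OF abelian_op, of X A F G] inj X cokernels split A
    by (auto simp: stable_cat_op)
  then show ?thesis using functor_iso_trans[OF _ Ext1_cov_op_iso[OF inj]] by blast
qed

end

theorem theorem3p10:
  fixes C :: "('o, 'm) cat" and X :: "'o set"
  assumes "abelian_category C"
    and "enough_projectives C" and "enough_injectives C"
    and "subcategory C X" and "functorially_finite C X"
    and "\<And>P. projective C P \<Longrightarrow> P \<in> X"
    and "\<And>I. injective C I \<Longrightarrow> I \<in> X"
    and "closed_kernels_of_epis C X" and "closed_cokernels_of_monos C X"
  shows
    "(has_split_idempotents (projectively_stable_cat C X) \<longrightarrow>
        (\<forall>A \<in> X. \<forall>(F :: ('o, 'm, 'g) ab_functor) (G :: ('o, 'm, 'h) ab_functor).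
           direct_summand_compl C X F G (Ext1_cov C A) \<longrightarrow>
           (\<exists>B \<in> X. functor_iso C X F (Ext1_cov C B)))) \<and>
     (X = Obj C \<and> krull_schmidt C \<longrightarrow>
        (\<forall>A \<in> Obj C. \<forall>(F :: ('o, 'm, 'g) ab_functor) (G :: ('o, 'm, 'h) ab_functor).
           direct_summand_compl C (Obj C) F G (Ext1_cov C A) \<longrightarrow>
           (\<exists>B \<in> Obj C. functor_iso C (Obj C) F (Ext1_cov C B)))) \<and>
     (has_split_idempotents (injectively_stable_cat C X) \<longrightarrow>
        (\<forall>A \<in> X. \<forall>(F :: ('o, 'm, 'g) ab_functor) (G :: ('o, 'm, 'h) ab_functor).
           direct_summand_compl (op_cat C) X F G (Ext1_contra C A) \<longrightarrow>
           (\<exists>B \<in> X. functor_iso (op_cat C) X F (Ext1_contra C B)))) \<and>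
     (X = Obj C \<and> krull_schmidt C \<longrightarrow>
        (\<forall>A \<in> Obj C. \<forall>(F :: ('o, 'm, 'g) ab_functor) (G :: ('o, 'm, 'h) ab_functor).
           direct_summand_compl (op_cat C) (Obj C) F G (Ext1_contra C A) \<longrightarrow>
           (\<exists>B \<in> Obj C. functor_iso (op_cat C) (Obj C) F (Ext1_contra C B))))"
proof -
  interpret abelian_category C by fact
  have X: "X \<subseteq> Obj C" using assms(4) by (simp add: subcategory_def)
  interpret proj: stable_subcategory C "projective C" X
    by (intro stable_subcategory.intro stable_subcategory_axioms.intro projective_stable_ideal X)
  interpret inj: stable_subcategory C "injective C" X
    by (intro stable_subcategory.intro stable_subcategory_axioms.intro injective_stable_ideal X)
  note cov = Ext1_cov_summand[OF assms(2) X assms(6,8)]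
  note contra = Ext1_contra_summand[OF assms(3) X assms(7,9)]
  note krull_schmidt = proj.krull_schmidt_stable_split inj.krull_schmidt_stable_split
  show ?thesis
    unfolding projectively_stable_cat_def injectively_stable_cat_def
    using cov contra krull_schmidt by blast
qed

end
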